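(* Let $G$ be any finite group of $\mathbb{C}$-algebra automorphisms of $A_1^q(\mathbb{C})$, and let $m$ be the order of $G$. Then the invariant subring $A_1^q(\mathbb{C})^G$ is a Galois order over $\Gamma=\mathbb{C}[x^m]$ in $\mathbb{C}(x^m)*\mathbb{N}$, where the generator of $\mathbb{N}$ acts on $\mathbb{C}(x^m)$ by $x^m\mapsto q^nx^m$ for some positive integer $n$. Moreover, $A_1^q(\mathbb{C})^G$ is free as a left $\Gamma$-module and free as a right $\Gamma$-module.
   Context: $q\in\mathbb{C}$ is nonzero and not a root of unity, and $A_1^q(\mathbb{C})=\mathbb{C}\langle x,y\mid yx-qxy=1\rangle$ is the first quantum Weyl algebra. Every finite group of automorphisms of $A_1^q(\mathbb{C})$ is a cyclic group $G_m$ with a generator acting by $x\mapsto\alpha x$, $y\mapsto\alpha^{-1}y$, with $\alpha$ a primitive $m$-th root of unity. Galois orders (case of trivial Galois group): Let $\Gamma$ be a commutative domain with field of fractions $K$ and $\mathfrak{M}\subset\mathrm{Aut}_{\mathbb{C}}K$ a monoid; $K*\mathfrak{M}$ is the skew monoid ring ($ma=m(a)m$ for $a\in K$). A finitely generated $\Gamma$-ring $U$ with $\Gamma\subset U\subset K*\mathfrak{M}$ is a Galois ring over $\Gamma$ if $KU=UK=K*\mathfrak{M}$. It is a right (left) Galois order over $\Gamma$ in $K*\mathfrak{M}$ if moreover for every finite-dimensional right (left) $K$-subspace $W\subset K*\mathfrak{M}$, $W\cap U$ is a finitely generated right (left) $\Gamma$-module; it is a Galois order if it is both a left and a right Galois order.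 An algebra containing $\Gamma$ is called a Galois order over $\Gamma$ in $K*\mathfrak{M}$ if it is isomorphic, over $\Gamma$, to such a $U$. Here $K=\mathbb{C}(x^m)$ and $\mathfrak{M}=\mathbb{N}$. *)

theory Defs
  imports "HOL-Algebra.Algebra" "HOL-Algebra.Bij" "HOL-Algebra.Algebraic_Closure_Type"
begin

section \<open>Modules inside a noncommutative ring\<close>

text \<open>
  For a subring \<open>S\<close> of a ring \<open>R\<close>, the left (right) \<open>S\<close>-submodule of \<open>R\<close> generated by \<open>B\<close> is the
  additive group generated by the products \<open>s b\<close> (respectively \<open>b s\<close>).
\<close>

definition left_span :: "('a, 'e) ring_scheme \<Rightarrow> 'a set \<Rightarrow> 'a set \<Rightarrow> 'a set" where
  "left_span R S B = generate (add_monoid R) (S <#>\<^bsub>R\<^esub> B)"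

definition right_span :: "('a, 'e) ring_scheme \<Rightarrow> 'a set \<Rightarrow> 'a set \<Rightarrow> 'a set" where
  "right_span R S B = generate (add_monoid R) (B <#>\<^bsub>R\<^esub> S)"

text \<open>
  When \<open>S\<close> is a field these two predicates say that \<open>N\<close> is a finite-dimensional left (right)
  \<open>S\<close>-subspace of \<open>R\<close>.
\<close>

definition fin_gen_left :: "('a, 'e) ring_scheme \<Rightarrow> 'a set \<Rightarrow> 'a set \<Rightarrow> bool" where
  "fin_gen_left R S N \<longleftrightarrow> (\<exists>B. finite B \<and> B \<subseteq> carrier R \<and> N = left_span R S B)"

definition fin_gen_right :: "('a, 'e) ring_scheme \<Rightarrow> 'a set \<Rightarrow> 'a set \<Rightarrow> bool" where
  "fin_gen_right R S N \<longleftrightarrow> (\<exists>B. finite B \<and> B \<subseteq> carrier R \<and> N = right_span R S B)"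

definition free_left_module :: "('a, 'e) ring_scheme \<Rightarrow> 'a set \<Rightarrow> bool" where
  "free_left_module R S \<longleftrightarrow>
     (\<exists>B \<subseteq> carrier R. left_span R S B = carrier R \<and>
        (\<forall>F c. finite F \<and> F \<subseteq> B \<and> c \<in> F \<rightarrow> S \<and> (\<Oplus>\<^bsub>R\<^esub>b\<in>F. c b \<otimes>\<^bsub>R\<^esub> b) = \<zero>\<^bsub>R\<^esub>
           \<longrightarrow> (\<forall>b\<in>F. c b = \<zero>\<^bsub>R\<^esub>)))"

definition free_right_module :: "('a, 'e) ring_scheme \<Rightarrow> 'a set \<Rightarrow> bool" where
  "free_right_module R S \<longleftrightarrow>
     (\<exists>B \<subseteq> carrier R. right_span R S B = carrier R \<and>
        (\<forall>F c. finite F \<and> F \<subseteq> B \<and> c \<in> F \<rightarrow> S \<and> (\<Oplus>\<^bsub>R\<^esub>b\<in>F. b \<otimes>\<^bsub>R\<^esub> c b) = \<zero>\<^bsub>R\<^esub>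
           \<longrightarrow> (\<forall>b\<in>F. c b = \<zero>\<^bsub>R\<^esub>)))"


section \<open>Skew monoid rings\<close>

text \<open>
  A finite sum of terms \<open>f(m) m\<close> is the finitely supported function \<open>f\<close>, extended by zero outside
  the carrier of the monoid.  The product is determined by \<open>(a m) (b n) = (a \<cdot> act m b) (m n)\<close>,
  that is, by \<open>m b = m(b) m\<close>.
\<close>

definition skew_monoid_ring ::
  "('k, 'e) ring_scheme \<Rightarrow> ('m, 'f) monoid_scheme \<Rightarrow> ('m \<Rightarrow> 'k \<Rightarrow> 'k) \<Rightarrow> ('m \<Rightarrow> 'k) ring" where
  "skew_monoid_ring K M act =
    \<lparr>carrier = {f. (\<forall>m \<in> carrier M. f m \<in> carrier K) \<and> (\<forall>m. m \<notin> carrier M \<longrightarrow> f m = \<zero>\<^bsub>K\<^esub>) \<and>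
                  finite {m. f m \<noteq> \<zero>\<^bsub>K\<^esub>}},
     monoid.mult = (\<lambda>f g p. finsum K (\<lambda>(m, n). f m \<otimes>\<^bsub>K\<^esub> act m (g n))
                             {(m, n). f m \<noteq> \<zero>\<^bsub>K\<^esub> \<and> g n \<noteq> \<zero>\<^bsub>K\<^esub> \<and> m \<otimes>\<^bsub>M\<^esub> n = p}),
     one = (\<lambda>p. if p = \<one>\<^bsub>M\<^esub> then \<one>\<^bsub>K\<^esub> else \<zero>\<^bsub>K\<^esub>),
     ring.zero = (\<lambda>_. \<zero>\<^bsub>K\<^esub>),
     add = (\<lambda>f g p. f p \<oplus>\<^bsub>K\<^esub> g p)\<rparr>"

definition monom_elem ::
  "('k, 'e) ring_scheme \<Rightarrow> 'k \<Rightarrow> 'm \<Rightarrow> 'm \<Rightarrow> 'k" where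
  "monom_elem K a m = (\<lambda>p. if p = m then a else \<zero>\<^bsub>K\<^esub>)"

definition coeff_embed ::
  "('k, 'e) ring_scheme \<Rightarrow> ('m, 'f) monoid_scheme \<Rightarrow> 'k \<Rightarrow> 'm \<Rightarrow> 'k" where
  "coeff_embed K M a = monom_elem K a \<one>\<^bsub>M\<^esub>"


section \<open>Galois rings and Galois orders\<close>

text \<open>
  \<open>K\<close> is the field of fractions of its subring \<open>\<Gamma>\<close>, and the monoid \<open>M\<close> is a submonoid of the
  automorphisms of \<open>K\<close> that fix the subfield \<open>F\<close>: the inclusion is given by \<open>act\<close>, which is
  a monoid homomorphism, injective on the carrier.
\<close>

locale galois_datum =
  fixes F :: "'k set" and \<Gamma> :: "'k set" and K :: "('k, 'e) ring_scheme"
    and M :: "('m, 'f) monoid_scheme" and act :: "'m \<Rightarrow> 'k \<Rightarrow> 'k"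
  assumes field_K: "Ring.field K"
    and subfield_F: "subfield F K"
    and subring_\<Gamma>: "subring \<Gamma> K"
    and fractions: "\<And>a. a \<in> carrier K \<Longrightarrow> \<exists>g\<in>\<Gamma>. \<exists>h\<in>\<Gamma>. h \<noteq> \<zero>\<^bsub>K\<^esub> \<and> a \<otimes>\<^bsub>K\<^esub> h = g"
    and monoid_M: "Group.monoid M"
    and act_iso: "\<And>m. m \<in> carrier M \<Longrightarrow> act m \<in> ring_iso K K"
    and act_fixes: "\<And>m c. m \<in> carrier M \<Longrightarrow> c \<in> F \<Longrightarrow> act m c = c"
    and act_one: "\<And>a. a \<in> carrier K \<Longrightarrow> act \<one>\<^bsub>M\<^esub> a = a"
    and act_mult: "\<And>m n a. m \<in> carrier M \<Longrightarrow> n \<in> carrier M \<Longrightarrow> a \<in> carrier K \<Longrightarrow>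
                     act (m \<otimes>\<^bsub>M\<^esub> n) a = act m (act n a)"
    and act_inj: "\<And>m n. m \<in> carrier M \<Longrightarrow> n \<in> carrier M \<Longrightarrow>
                     (\<forall>a\<in>carrier K. act m a = act n a) \<Longrightarrow> m = n"

definition galois_ring ::
  "'k set \<Rightarrow> 'k set \<Rightarrow> ('k, 'e) ring_scheme \<Rightarrow> ('m, 'f) monoid_scheme \<Rightarrow> ('m \<Rightarrow> 'k \<Rightarrow> 'k)
    \<Rightarrow> ('m \<Rightarrow> 'k) set \<Rightarrow> bool" where
  "galois_ring F \<Gamma> K M act U \<longleftrightarrow>
     galois_datum F \<Gamma> K M act \<and>
     (let S = skew_monoid_ring K M act; K' = coeff_embed K M ` carrier K;
          \<Gamma>' = coeff_embed K M ` \<Gamma>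
      in subring U S \<and> \<Gamma>' \<subseteq> U \<and>
         (\<exists>T. finite T \<and> T \<subseteq> U \<and> U = generate_ring S (\<Gamma>' \<union> T)) \<and>
         left_span S K' U = carrier S \<and> right_span S K' U = carrier S)"

definition left_galois_order ::
  "'k set \<Rightarrow> 'k set \<Rightarrow> ('k, 'e) ring_scheme \<Rightarrow> ('m, 'f) monoid_scheme \<Rightarrow> ('m \<Rightarrow> 'k \<Rightarrow> 'k)
    \<Rightarrow> ('m \<Rightarrow> 'k) set \<Rightarrow> bool" where
  "left_galois_order F \<Gamma> K M act U \<longleftrightarrow>
     galois_ring F \<Gamma> K M act U \<and>
     (let S = skew_monoid_ring K M act; K' = coeff_embed K M ` carrier K;
          \<Gamma>' = coeff_embed K M ` \<Gamma>
      in \<forall>W. fin_gen_left S K' W \<longrightarrow> fin_gen_left S \<Gamma>' (W \<inter> U))"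

definition right_galois_order ::
  "'k set \<Rightarrow> 'k set \<Rightarrow> ('k, 'e) ring_scheme \<Rightarrow> ('m, 'f) monoid_scheme \<Rightarrow> ('m \<Rightarrow> 'k \<Rightarrow> 'k)
    \<Rightarrow> ('m \<Rightarrow> 'k) set \<Rightarrow> bool" where
  "right_galois_order F \<Gamma> K M act U \<longleftrightarrow>
     galois_ring F \<Gamma> K M act U \<and>
     (let S = skew_monoid_ring K M act; K' = coeff_embed K M ` carrier K;
          \<Gamma>' = coeff_embed K M ` \<Gamma>
      in \<forall>W. fin_gen_right S K' W \<longrightarrow> fin_gen_right S \<Gamma>' (W \<inter> U))"

definition galois_order ::
  "'k set \<Rightarrow> 'k set \<Rightarrow> ('k, 'e) ring_scheme \<Rightarrow> ('m, 'f) monoid_scheme \<Rightarrow> ('m \<Rightarrow> 'k \<Rightarrow> 'k)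
    \<Rightarrow> ('m \<Rightarrow> 'k) set \<Rightarrow> bool" where
  "galois_order F \<Gamma> K M act U \<longleftrightarrow>
     left_galois_order F \<Gamma> K M act U \<and> right_galois_order F \<Gamma> K M act U"

text \<open>
  A ring \<open>A\<close> containing \<open>\<Gamma>\<close> is a Galois order over \<open>\<Gamma>\<close> in \<open>K*M\<close> if it is isomorphic over \<open>\<Gamma>\<close> to
  one inside \<open>K*M\<close>.  Here \<open>\<Gamma>\<close> is an abstract ring, and the inclusions of \<open>\<Gamma>\<close> in \<open>K\<close> and in
  \<open>A\<close> are the maps \<open>j\<close> and \<open>\<iota>\<close>.
\<close>

definition is_galois_order_over ::
  "'k set \<Rightarrow> ('g, 'h) ring_scheme \<Rightarrow> ('g \<Rightarrow> 'k) \<Rightarrow> ('k, 'e) ring_scheme \<Rightarrow> ('m, 'f) monoid_scheme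
    \<Rightarrow> ('m \<Rightarrow> 'k \<Rightarrow> 'k) \<Rightarrow> ('g \<Rightarrow> 'a) \<Rightarrow> ('a, 'b) ring_scheme \<Rightarrow> bool" where
  "is_galois_order_over F \<Gamma> j K M act \<iota> A \<longleftrightarrow>
     j \<in> ring_hom \<Gamma> K \<and> inj_on j (carrier \<Gamma>) \<and>
     \<iota> \<in> ring_hom \<Gamma> A \<and> inj_on \<iota> (carrier \<Gamma>) \<and>
     (\<exists>U \<phi>. galois_order F (j ` carrier \<Gamma>) K M act U \<and>
        \<phi> \<in> ring_iso A (skew_monoid_ring K M act\<lparr>carrier := U\<rparr>) \<and>
        (\<forall>\<gamma>\<in>carrier \<Gamma>. \<phi> (\<iota> \<gamma>) = coeff_embed K M (j \<gamma>)))"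


section \<open>The first quantum Weyl algebra\<close>

datatype weyl_gen = Gen_x | Gen_y

abbreviation complex_ring :: "complex ring" where
  "complex_ring \<equiv> ring_of_type_algebra"

definition free_monoid :: "'g list monoid" where
  "free_monoid = \<lparr>carrier = UNIV, monoid.mult = (@), one = []\<rparr>"

text \<open>
  The free algebra \<open>\<complex>\<langle>x, y\<rangle>\<close> is the monoid ring of the free monoid on \<open>x\<close>, \<open>y\<close>, that is, the skew
  monoid ring for the trivial action.
\<close>

definition free_alg :: "(weyl_gen list \<Rightarrow> complex) ring" where
  "free_alg = skew_monoid_ring complex_ring free_monoid (\<lambda>_ c. c)"

abbreviation free_alg_const :: "complex \<Rightarrow> weyl_gen list \<Rightarrow> complex" where
  "free_alg_const c \<equiv> monom_elem complex_ring c []"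

abbreviation free_alg_gen :: "weyl_gen \<Rightarrow> weyl_gen list \<Rightarrow> complex" where
  "free_alg_gen g \<equiv> monom_elem complex_ring 1 [g]"

definition qweyl_relator :: "complex \<Rightarrow> weyl_gen list \<Rightarrow> complex" where
  "qweyl_relator q =
     (free_alg_gen Gen_y \<otimes>\<^bsub>free_alg\<^esub> free_alg_gen Gen_x)
       \<ominus>\<^bsub>free_alg\<^esub> (free_alg_const q \<otimes>\<^bsub>free_alg\<^esub> (free_alg_gen Gen_x \<otimes>\<^bsub>free_alg\<^esub> free_alg_gen Gen_y))
       \<ominus>\<^bsub>free_alg\<^esub> \<one>\<^bsub>free_alg\<^esub>"

definition qweyl_ideal :: "complex \<Rightarrow> (weyl_gen list \<Rightarrow> complex) set" where
  "qweyl_ideal q = Idl\<^bsub>free_alg\<^esub> {qweyl_relator q}"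

definition qweyl :: "complex \<Rightarrow> (weyl_gen list \<Rightarrow> complex) set ring" where
  "qweyl q = free_alg Quot qweyl_ideal q"

definition qweyl_scalar :: "complex \<Rightarrow> complex \<Rightarrow> (weyl_gen list \<Rightarrow> complex) set" where
  "qweyl_scalar q c = qweyl_ideal q +>\<^bsub>free_alg\<^esub> free_alg_const c"

definition qweyl_x :: "complex \<Rightarrow> (weyl_gen list \<Rightarrow> complex) set" where
  "qweyl_x q = qweyl_ideal q +>\<^bsub>free_alg\<^esub> free_alg_gen Gen_x"

text \<open>
  The group of \<open>\<complex>\<close>-algebra automorphisms, with composition.  As in \<^const>\<open>AutoGroup\<close>, its elements
  are extensional functions, so that the cardinality of a set of automorphisms is meaningful.
\<close>

definition qweyl_aut_group ::
  "complex \<Rightarrow> ((weyl_gen list \<Rightarrow> complex) set \<Rightarrow> (weyl_gen list \<Rightarrow> complex) set) monoid" where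
  "qweyl_aut_group q = BijGroup (carrier (qweyl q))
     \<lparr>carrier := {g \<in> Bij (carrier (qweyl q)). g \<in> ring_hom (qweyl q) (qweyl q) \<and>
                   (\<forall>c. g (qweyl_scalar q c) = qweyl_scalar q c)}\<rparr>"

definition invariant_ring :: "('a, 'e) ring_scheme \<Rightarrow> ('a \<Rightarrow> 'a) set \<Rightarrow> ('a, 'e) ring_scheme" where
  "invariant_ring A G = A\<lparr>carrier := {a \<in> carrier A. \<forall>g\<in>G. g a = a}\<rparr>"


section \<open>The base ring and its field of fractions\<close>

text \<open>
  The ring \<open>\<Gamma> = \<complex>[x\<^sup>m]\<close> is modelled as \<open>\<complex>[t]\<close> and its field of fractions \<open>\<complex>(x\<^sup>m)\<close> as \<open>\<complex>(t)\<close>, the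
  indeterminate \<open>t\<close> standing for \<open>x\<^sup>m\<close>; \<open>qweyl_eval\<close> below is the resulting map
  \<open>p \<mapsto> p(x\<^sup>m)\<close> to the quantum Weyl algebra.
\<close>

abbreviation cpoly_ring :: "complex poly ring" where
  "cpoly_ring \<equiv> ring_of_type_algebra"

abbreviation ratfun_field :: "complex poly fract ring" where
  "ratfun_field \<equiv> ring_of_type_algebra"

definition poly_to_ratfun :: "complex poly \<Rightarrow> complex poly fract" where
  "poly_to_ratfun p = Fraction_Field.Fract p 1"

definition ratfun_consts :: "complex poly fract set" where
  "ratfun_consts = range (\<lambda>c. poly_to_ratfun [:c:])"

definition qweyl_eval :: "complex \<Rightarrow> nat \<Rightarrow> complex poly \<Rightarrow> (weyl_gen list \<Rightarrow> complex) set" where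
  "qweyl_eval q m p =
     (\<Oplus>\<^bsub>qweyl q\<^esub>k \<in> {..Polynomial.degree p}.
        qweyl_scalar q (Polynomial.coeff p k) \<otimes>\<^bsub>qweyl q\<^esub> ((qweyl_x q [^]\<^bsub>qweyl q\<^esub> m) [^]\<^bsub>qweyl q\<^esub> k))"

definition nat_add_monoid :: "nat monoid" where
  "nat_add_monoid = \<lparr>carrier = UNIV, monoid.mult = (+), one = 0\<rparr>"

end

theory Submission
  imports Defs
begin

text \<open>
  Let \<open>Z\<close> be the substitution \<open>t \<mapsto> q t\<close> on \<open>\<complex>(t)\<close>.  The algebra \<open>A\<^sub>1\<^sup>q\<close> acts on \<open>\<complex>(t)\<close>: \<open>x\<close> acts as
  multiplication by \<open>t\<close> and \<open>y\<close> as the \<open>q\<close>-derivative \<open>t\<inverse> (Z - 1) / (q - 1)\<close>, so that \<open>Z = 1 + (q - 1) x y\<close>.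
  Everything takes place in the ring of operators \<open>\<Sum>\<^sub>k a\<^sub>k Z\<^sup>k\<close> with \<open>a\<^sub>k \<in> \<complex>(t)\<close>.  As \<open>q\<close> is not a root of
  unity, the powers of \<open>Z\<close> are linearly independent over \<open>\<complex>(t)\<close> (\<open>dedekind\<close>), hence the degree in \<open>Z\<close> is
  additive and leading coefficients multiply up to a twist (\<open>lead_mult\<close>).  Since \<open>x\<^sup>i y\<^sup>j\<close> has degree
  exactly \<open>j\<close>, the representation is faithful: \<open>A\<^sub>1\<^sup>q\<close> is identified with the algebra \<open>B\<close> of operators
  generated by \<open>x\<close> and \<open>y\<close> (\<open>ev_eq_0_iff\<close>).

  An automorphism \<open>g\<close> is diagonal (\<open>aut_form\<close>).  All commutators lie in \<open>Z B = B Z\<close>, and \<open>Z = y x - x y\<close> is one,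
  so \<open>g(Z)\<close> and \<open>Z\<close> divide each other; the units being scalars, \<open>g(Z) = \<lambda> Z\<close>.  Thus \<open>g(x)\<close> and \<open>g(y)\<close> are
  eigenvectors of conjugation by \<open>Z\<close> whose degrees add up to \<open>1\<close>, and the elements of \<open>B\<close> of degree at most one
  with these eigenvalues are the multiples of \<open>x\<close> and of \<open>y\<close>.  A finite group of order \<open>m\<close> of automorphisms is
  therefore the group of \<open>m\<close>-th roots of unity acting by \<open>x \<mapsto> \<alpha> x\<close>, \<open>y \<mapsto> \<alpha>\<inverse> y\<close>, and averaging shows that the
  invariants are spanned by the \<open>x\<^sup>i y\<^sup>j\<close> with \<open>i \<equiv> j\<close> modulo \<open>m\<close>, and equally by the \<open>y\<^sup>j x\<^sup>i\<close>
  (\<open>invariants_of_root_group\<close>).  With \<open>r = j mod m\<close>, the elements \<open>x\<^sup>r y\<^sup>j\<close> are then a basis of the invariants as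
  a left \<open>\<Gamma>\<close>-module, and the \<open>y\<^sup>j x\<^sup>r\<close> as a right \<open>\<Gamma>\<close>-module.

  The operators with coefficients in \<open>\<complex>(t\<^sup>m)\<close> form a copy of \<open>\<complex>(x\<^sup>m) * \<nat>\<close>, in which the generator of \<open>\<nat>\<close> is \<open>Z\<close> and
  maps \<open>t\<^sup>m\<close> to \<open>q\<^sup>m t\<^sup>m\<close>.  It contains the invariants, because \<open>x\<^sup>r y\<^sup>r\<close> is a polynomial in \<open>Z\<close>
  (\<open>I_subset_imE\<close>), and the invariants contain \<open>Z\<close>, which makes them a Galois ring (\<open>galois_ring\<close>).  A finite
  dimensional subspace has bounded degree, and the invariants of bounded degree are spanned over \<open>\<Gamma>\<close> by
  finitely many basis elements.  As \<open>\<Gamma> = \<complex>[t]\<close> is a principal ideal domain, submodules of finitely generated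
  modules are finitely generated, which is the Galois order condition.
\<close>

hide_const (open) Polynomials.degree

section \<open>Additive endomorphisms of a commutative ring\<close>

text \<open>
  Composition turns the additive endomorphisms into a noncommutative ring.  Having it as a
  type of class \<^class>\<open>ring_1\<close> makes identities between operators accessible to rewriting.
\<close>

typedef (overloaded) 'a endo = "{f :: 'a::comm_ring_1 \<Rightarrow> 'a. \<forall>x y. f (x + y) = f x + f y}"
  morphisms endo_apply Endo
  by (rule exI[of _ "\<lambda>x. x"]) simp

setup_lifting type_definition_endo

instantiation endo :: (comm_ring_1) ring_1
begin

lift_definition zero_endo :: "'a endo" is "\<lambda>_. 0" by simp
lift_definition one_endo :: "'a endo" is "\<lambda>x. x" by simp
lift_definition plus_endo :: "'a endo \<Rightarrow> 'a endo \<Rightarrow> 'a endo" is "\<lambda>f g x. f x + g x"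
  by (simp add: algebra_simps)
lift_definition uminus_endo :: "'a endo \<Rightarrow> 'a endo" is "\<lambda>f x. - f x"
  by simp
lift_definition minus_endo :: "'a endo \<Rightarrow> 'a endo \<Rightarrow> 'a endo" is "\<lambda>f g x. f x - g x"
  by simp
lift_definition times_endo :: "'a endo \<Rightarrow> 'a endo \<Rightarrow> 'a endo" is "\<lambda>f g x. f (g x)"
  by simp

instance
  by standard (transfer; auto simp: algebra_simps fun_eq_iff intro: exI[of _ 1])+

end

lift_definition lmult :: "'a::comm_ring_1 \<Rightarrow> 'a endo" is "\<lambda>a x. a * x"
  by (simp add: algebra_simps)

lemma endo_eqI: "(\<And>x. endo_apply f x = endo_apply g x) \<Longrightarrow> f = g"
  by transfer auto

lemma endo_apply_simps [simp]:
  "endo_apply 0 x = 0" "endo_apply 1 x = x" "endo_apply (f + g) x = endo_apply f x + endo_apply g x"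
  "endo_apply (f - g) x = endo_apply f x - endo_apply g x" "endo_apply (- f) x = - endo_apply f x"
  "endo_apply (f * g) x = endo_apply f (endo_apply g x)" "endo_apply (lmult a) x = a * x"
  by (transfer; simp)+

lemma endo_apply_add: "endo_apply f (x + y) = endo_apply f x + endo_apply f y"
  by transfer simp

lemma endo_apply_zero [simp]: "endo_apply f 0 = 0"
  using endo_apply_add[of f 0 0] by simp

lemma endo_apply_sum: "endo_apply (\<Sum>i\<in>A. f i) x = (\<Sum>i\<in>A. endo_apply (f i) x)"
  by (induction A rule: infinite_finite_induct) auto

lemma lmult_hom:
  "lmult 0 = 0" "lmult 1 = 1" "lmult (a + b) = lmult a + lmult b" "lmult (a - b) = lmult a - lmult b"
  "lmult (- a) = - lmult a" "lmult (a * b) = lmult a * lmult b"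
  by (auto intro!: endo_eqI simp: algebra_simps)

lemma lmult_power: "lmult (a ^ k) = lmult a ^ k"
  by (induction k) (auto simp: lmult_hom)

lemma lmult_commute: "lmult a * lmult b = lmult b * lmult a"
  by (metis lmult_hom(6) mult.commute)

lemma lmult_eq_iff [simp]: "lmult a = lmult b \<longleftrightarrow> a = b"
proof
  assume "lmult a = lmult b"
  then have "endo_apply (lmult a) 1 = endo_apply (lmult b) 1" by simp
  then show "a = b" by simp
qed simp

lemma lmult_eq_0_iff [simp]: "lmult a = 0 \<longleftrightarrow> a = 0"
  using lmult_eq_iff[of a 0] by (simp add: lmult_hom)

section \<open>Substitution in rational functions\<close>

type_synonym ratfun = "complex poly fract"

lemma poly_to_ratfun_hom:
  "poly_to_ratfun 0 = 0" "poly_to_ratfun 1 = 1"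
  "poly_to_ratfun (a + b) = poly_to_ratfun a + poly_to_ratfun b"
  "poly_to_ratfun (a - b) = poly_to_ratfun a - poly_to_ratfun b"
  "poly_to_ratfun (- a) = - poly_to_ratfun a"
  "poly_to_ratfun (a * b) = poly_to_ratfun a * poly_to_ratfun b"
  by (auto simp: poly_to_ratfun_def Zero_fract_def One_fract_def)

lemma poly_to_ratfun_power: "poly_to_ratfun (a ^ k) = poly_to_ratfun a ^ k"
  by (induction k) (auto simp: poly_to_ratfun_hom)

lemma poly_to_ratfun_eq_iff [simp]: "poly_to_ratfun a = poly_to_ratfun b \<longleftrightarrow> a = b"
  by (simp add: poly_to_ratfun_def eq_fract)

lemma poly_to_ratfun_eq_0_iff [simp]: "poly_to_ratfun a = 0 \<longleftrightarrow> a = 0"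
  using poly_to_ratfun_eq_iff[of a 0] by (simp add: poly_to_ratfun_hom)

lemma ratfun_cases:
  obtains a b where "b \<noteq> 0" "f = poly_to_ratfun a / poly_to_ratfun b"
proof (cases f)
  case (Fract a b)
  then show ?thesis
    by (intro that[of b a]) (auto simp: poly_to_ratfun_def divide_fract_def)
qed

text \<open>
  The substitution \<open>f(t) \<mapsto> f(r(t))\<close>, which is defined for nonconstant \<open>r\<close>.  Both the action of \<open>\<nat>\<close> and the
  inclusion of \<open>\<complex>(x\<^sup>m)\<close> in \<open>\<complex>(x)\<close> are of this form.
\<close>

definition ratfun_subst :: "complex poly \<Rightarrow> ratfun \<Rightarrow> ratfun" where
  "ratfun_subst r f = (THE g. \<exists>a b. b \<noteq> 0 \<and> f = poly_to_ratfun a / poly_to_ratfun b \<and>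
      g = poly_to_ratfun (a \<circ>\<^sub>p r) / poly_to_ratfun (b \<circ>\<^sub>p r))"

lemma pcompose_nonzero:
  fixes b r :: "complex poly"
  shows "degree r > 0 \<Longrightarrow> b \<noteq> 0 \<Longrightarrow> b \<circ>\<^sub>p r \<noteq> 0"
  using pcompose_eq_0[of b r] by auto

lemma ratfun_subst_quotient:
  assumes r: "degree r > 0" and b: "b \<noteq> 0"
  shows "ratfun_subst r (poly_to_ratfun a / poly_to_ratfun b)
           = poly_to_ratfun (a \<circ>\<^sub>p r) / poly_to_ratfun (b \<circ>\<^sub>p r)"
  unfolding ratfun_subst_def
proof (rule the_equality)
  show "\<exists>a' b'. b' \<noteq> 0 \<and> poly_to_ratfun a / poly_to_ratfun b = poly_to_ratfun a' / poly_to_ratfun b' \<and>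
      poly_to_ratfun (a \<circ>\<^sub>p r) / poly_to_ratfun (b \<circ>\<^sub>p r) =
      poly_to_ratfun (a' \<circ>\<^sub>p r) / poly_to_ratfun (b' \<circ>\<^sub>p r)"
    using b by blast
next
  fix g
  assume "\<exists>a' b'. b' \<noteq> 0 \<and> poly_to_ratfun a / poly_to_ratfun b = poly_to_ratfun a' / poly_to_ratfun b' \<and>
      g = poly_to_ratfun (a' \<circ>\<^sub>p r) / poly_to_ratfun (b' \<circ>\<^sub>p r)"
  then obtain a' b' where b': "b' \<noteq> 0"
    and eq: "poly_to_ratfun a / poly_to_ratfun b = poly_to_ratfun a' / poly_to_ratfun b'"
    and g: "g = poly_to_ratfun (a' \<circ>\<^sub>p r) / poly_to_ratfun (b' \<circ>\<^sub>p r)"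
    by blast
  from eq b b' have "poly_to_ratfun (a * b') = poly_to_ratfun (a' * b)"
    by (simp add: poly_to_ratfun_hom field_simps)
  then have "(a * b') \<circ>\<^sub>p r = (a' * b) \<circ>\<^sub>p r" by simp
  then have "poly_to_ratfun (a \<circ>\<^sub>p r) * poly_to_ratfun (b' \<circ>\<^sub>p r)
      = poly_to_ratfun (a' \<circ>\<^sub>p r) * poly_to_ratfun (b \<circ>\<^sub>p r)"
    by (simp add: pcompose_mult flip: poly_to_ratfun_hom(6))
  then show "g = poly_to_ratfun (a \<circ>\<^sub>p r) / poly_to_ratfun (b \<circ>\<^sub>p r)"
    using pcompose_nonzero[OF r b] pcompose_nonzero[OF r b'] g by (simp add: frac_eq_eq)
qed

lemma ratfun_subst_poly:
  assumes "degree r > 0"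
  shows "ratfun_subst r (poly_to_ratfun a) = poly_to_ratfun (a \<circ>\<^sub>p r)"
  using ratfun_subst_quotient[OF assms, of 1 a] by (simp add: poly_to_ratfun_hom pcompose_1)

lemma ratfun_subst_const:
  assumes "degree r > 0"
  shows "ratfun_subst r (poly_to_ratfun [:c:]) = poly_to_ratfun [:c:]"
  using ratfun_subst_poly[OF assms, of "[:c:]"] by simp

lemma ratfun_subst_hom:
  assumes r: "degree r > 0"
  shows "ratfun_subst r 0 = 0" "ratfun_subst r 1 = 1"
    "ratfun_subst r (f + g) = ratfun_subst r f + ratfun_subst r g"
    "ratfun_subst r (f * g) = ratfun_subst r f * ratfun_subst r g"
proof -
  show "ratfun_subst r 0 = 0" "ratfun_subst r 1 = 1"
    using ratfun_subst_poly[OF r, of 0] ratfun_subst_poly[OF r, of 1]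
    by (auto simp: poly_to_ratfun_hom pcompose_1)
  obtain a b where f: "b \<noteq> 0" "f = poly_to_ratfun a / poly_to_ratfun b" by (rule ratfun_cases)
  obtain c d where g: "d \<noteq> 0" "g = poly_to_ratfun c / poly_to_ratfun d" by (rule ratfun_cases)
  note nz = pcompose_nonzero[OF r f(1)] pcompose_nonzero[OF r g(1)]
  have "f + g = poly_to_ratfun (a * d + c * b) / poly_to_ratfun (b * d)"
    using f g by (simp add: poly_to_ratfun_hom field_simps)
  then have "ratfun_subst r (f + g)
      = poly_to_ratfun ((a * d + c * b) \<circ>\<^sub>p r) / poly_to_ratfun ((b * d) \<circ>\<^sub>p r)"
    using ratfun_subst_quotient[OF r] f g by simp
  then show "ratfun_subst r (f + g) = ratfun_subst r f + ratfun_subst r g"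
    using nz unfolding f(2) g(2) ratfun_subst_quotient[OF r f(1)] ratfun_subst_quotient[OF r g(1)]
    by (simp add: poly_to_ratfun_hom pcompose_add pcompose_mult add_frac_eq)
  have "f * g = poly_to_ratfun (a * c) / poly_to_ratfun (b * d)"
    using f g by (simp add: poly_to_ratfun_hom field_simps)
  then have "ratfun_subst r (f * g)
      = poly_to_ratfun ((a * c) \<circ>\<^sub>p r) / poly_to_ratfun ((b * d) \<circ>\<^sub>p r)"
    using ratfun_subst_quotient[OF r] f g by simp
  then show "ratfun_subst r (f * g) = ratfun_subst r f * ratfun_subst r g"
    unfolding f(2) g(2) ratfun_subst_quotient[OF r f(1)] ratfun_subst_quotient[OF r g(1)]
    by (simp add: poly_to_ratfun_hom pcompose_mult)
qed

lemma ratfun_subst_power: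
  "degree r > 0 \<Longrightarrow> ratfun_subst r (f ^ k) = ratfun_subst r f ^ k"
  by (induction k) (auto simp: ratfun_subst_hom)

lemma ratfun_subst_eq_0_iff:
  assumes r: "degree r > 0"
  shows "ratfun_subst r f = 0 \<longleftrightarrow> f = 0"
proof
  assume z: "ratfun_subst r f = 0"
  show "f = 0"
  proof (rule ccontr)
    assume "f \<noteq> 0"
    then have "ratfun_subst r f * ratfun_subst r (inverse f) = 1"
      by (simp add: ratfun_subst_hom(2)[OF r] flip: ratfun_subst_hom(4)[OF r])
    with z show False by simp
  qed
qed (simp add: ratfun_subst_hom[OF r])

lemma ratfun_subst_inverse:
  assumes r: "degree r > 0"
  shows "ratfun_subst r (inverse f) = inverse (ratfun_subst r f)"
proof (cases "f = 0")
  case False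
  then have "ratfun_subst r f * ratfun_subst r (inverse f) = 1"
    by (simp add: ratfun_subst_hom(2)[OF r] flip: ratfun_subst_hom(4)[OF r])
  then show ?thesis by (simp add: inverse_unique)
qed (simp add: ratfun_subst_hom[OF r])

lemma inj_ratfun_subst:
  assumes r: "degree r > 0"
  shows "inj (ratfun_subst r)"
proof (rule injI)
  fix f g assume eq: "ratfun_subst r f = ratfun_subst r g"
  have "ratfun_subst r (f - g) + ratfun_subst r g = ratfun_subst r f"
    using ratfun_subst_hom(3)[OF r, of "f - g" g] by simp
  then have "ratfun_subst r (f - g) = 0" using eq by simp
  then show "f = g" by (simp add: ratfun_subst_eq_0_iff[OF r])
qed

lemma ratfun_subst_subst:
  assumes r: "degree r > 0" and s: "degree s > 0"
  shows "ratfun_subst r (ratfun_subst s f) = ratfun_subst (s \<circ>\<^sub>p r) f"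
proof -
  obtain a b where f: "b \<noteq> 0" "f = poly_to_ratfun a / poly_to_ratfun b" by (rule ratfun_cases)
  have sr: "degree (s \<circ>\<^sub>p r) > 0" using r s by (simp add: degree_pcompose)
  show ?thesis
    using f pcompose_nonzero[OF s f(1)]
    by (simp add: ratfun_subst_quotient[OF r] ratfun_subst_quotient[OF s] ratfun_subst_quotient[OF sr]
        pcompose_assoc)
qed

lemma ratfun_subst_ident: "ratfun_subst [:0, 1:] f = f"
proof -
  obtain a b where f: "b \<noteq> 0" "f = poly_to_ratfun a / poly_to_ratfun b" by (rule ratfun_cases)
  then show ?thesis by (simp add: ratfun_subst_quotient)
qed

section \<open>Modules over a principal ideal domain\<close>

text \<open>
  Induction on the number of generators: the coefficients at the new generator of the elements of \<open>P\<close> form an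
  ideal.  An element of \<open>P\<close> whose coefficient \<open>g\<close> generates that ideal, together with generators of the
  part of \<open>P\<close> in the span of the old ones, generates \<open>P\<close>.
\<close>

lemma submodule_fin_gen:
  fixes scale :: "'a::euclidean_ring \<Rightarrow> 'b::ab_group_add \<Rightarrow> 'b"
  assumes M: "Modules.module scale" and F: "finite F"
    and "P \<subseteq> Modules.module.span scale F" and "Modules.module.subspace scale P"
  shows "\<exists>B. finite B \<and> P = Modules.module.span scale B"
proof -
  interpret Modules.module scale by (rule M)
  show ?thesis
    using F assms(3,4)
  proof (induction F arbitrary: P rule: finite_induct)
    case empty
    then have "P = span {}" using subspace_0 by auto
    then show ?case by blast
  next
    case (insert a F)
    have "subspace (P \<inter> span F)" using insert.prems by (simp add: subspace_inter)
    then obtain B where B: "finite B" "P \<inter> span F = span B"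
      using insert.IH[of "P \<inter> span F"] by blast
    define I where "I r \<longleftrightarrow> (\<exists>v\<in>span F. scale r a + v \<in> P)" for r
    show ?case
    proof (cases "\<exists>r. I r \<and> r \<noteq> 0")
      case False
      have "P \<subseteq> span F"
      proof
        fix x assume x: "x \<in> P"
        then obtain k where k: "x - scale k a \<in> span F"
          using insert.prems(1) span_breakdown_eq by blast
        then have "I k" unfolding I_def using x by (intro bexI[of _ "x - scale k a"]) auto
        then have "k = 0" using False by blast
        then show "x \<in> span F" using k by simp
      qed
      then show ?thesis using B by (metis inf.absorb1)
    next
      case True
      \<comment> \<open>A nonzero element of least Euclidean size generates the ideal of coefficients.\<close>
      obtain g where g: "I g" "g \<noteq> 0"
        and min: "\<And>r. I r \<Longrightarrow> r \<noteq> 0 \<Longrightarrow> euclidean_size g \<le> euclidean_size r"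
        using ex_has_least_nat[of "\<lambda>r. I r \<and> r \<noteq> 0" _ euclidean_size] True by blast
      then obtain v0 where v0: "v0 \<in> span F" "scale g a + v0 \<in> P" unfolding I_def by blast
      define b where "b = scale g a + v0"
      have "P = span (insert b B)"
      proof
        have "insert b B \<subseteq> P" using v0 B span_superset[of B] unfolding b_def by blast
        then show "span (insert b B) \<subseteq> P" using insert.prems(2) by (rule span_minimal)
        show "P \<subseteq> span (insert b B)"
        proof
          fix x assume x: "x \<in> P"
          then obtain k where k: "x - scale k a \<in> span F"
            using insert.prems(1) span_breakdown_eq by blast
          define w where "w = (x - scale k a) - scale (k div g) v0"
          have w: "w \<in> span F" unfolding w_def by (rule span_diff[OF k span_scale[OF v0(1)]])
          have "k = (k div g) * g + k mod g" by simp
          then have "scale k a = scale (k div g) (scale g a) + scale (k mod g) a"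
            by (metis scale_left_distrib scale_scale)
          then have eq: "x - scale (k div g) b = scale (k mod g) a + w"
            unfolding w_def b_def by (simp add: scale_right_distrib)
          have xP: "x - scale (k div g) b \<in> P"
            using x v0(2) insert.prems(2) unfolding b_def by (intro subspace_diff subspace_scale)
          then have "I (k mod g)" unfolding I_def eq using w by blast
          then have "k mod g = 0"
            using min g(2) mod_size_less[of g k] by force
          then have "x - scale (k div g) b \<in> P \<inter> span F" using xP w eq by simp
          then show "x \<in> span (insert b B)" unfolding B(2) span_breakdown_eq by blast
        qed
      qed
      then show ?thesis using B(1) by blast
    qed
  qed
qed

text \<open>
  If multiples of \<open>b\<^sub>j\<close> drop to filtration level \<open>j\<close> only for coefficient zero, no cancellation of top terms is
  possible, and a combination lying in \<open>L n\<close> involves only \<open>b\<^sub>j\<close> with \<open>j < n\<close>.  The case \<open>L 0 = {0}\<close> is linear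
  independence.
\<close>

lemma filtered_coefficients_vanish:
  fixes scale :: "'a::comm_ring_1 \<Rightarrow> 'b::ab_group_add \<Rightarrow> 'b"
  assumes M: "Modules.module scale"
    and L: "\<And>n. Modules.module.subspace scale (L n)" "\<And>n. L n \<subseteq> L (Suc n)"
    and b: "\<And>j. b j \<in> L (Suc j)" "\<And>j c. scale c (b j) \<in> L j \<Longrightarrow> c = 0"
    and "(\<Sum>j<N. scale (c j) (b j)) \<in> L n" "n \<le> j" "j < N"
  shows "c j = 0"
proof -
  interpret Modules.module scale by (rule M)
  have mono: "L i \<subseteq> L k" if "i \<le> k" for i k
    using lift_Suc_mono_le[of L i k] L(2) that by auto
  show ?thesis
    using assms(6-8)
  proof (induction N)
    case (Suc N)
    have "(\<Sum>j<N. scale (c j) (b j)) \<in> L N"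
      using b(1) mono by (intro subspace_sum L(1) subspace_scale) (meson Suc_leI lessThan_iff subsetD)
    moreover have "(\<Sum>j<Suc N. scale (c j) (b j)) \<in> L N"
      using Suc.prems mono[of n N] by auto
    ultimately have "(\<Sum>j<Suc N. scale (c j) (b j)) - (\<Sum>j<N. scale (c j) (b j)) \<in> L N"
      by (intro subspace_diff L(1))
    then have "c N = 0" by (intro b(2)) simp
    then show ?case
      using Suc by (cases "j = N") auto
  qed simp
qed

lemma (in Modules.module) span_range_explicit:
  fixes b :: "nat \<Rightarrow> 'b"
  assumes "x \<in> span (range b)"
  shows "\<exists>N c. x = (\<Sum>j<N. scale (c j) (b j))"
  using assms
proof (induction rule: span_induct_alt)
  case base
  show ?case by (intro exI[of _ 0]) simp
next
  case (step r y x)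
  then obtain j N c where y: "y = b j" and x: "x = (\<Sum>j<N. scale (c j) (b j))" by auto
  define N' where "N' = max N (Suc j)"
  define c' where "c' i = (if i < N then c i else 0)" for i
  have "x = (\<Sum>i<N'. scale (c' i) (b i))"
    unfolding x by (rule sum.mono_neutral_cong_left) (auto simp: N'_def c'_def)
  moreover have "scale r y = (\<Sum>i<N'. scale (if i = j then r else 0) (b i))"
    by (subst sum.mono_neutral_right[of _ "{j}"]) (auto simp: y N'_def)
  ultimately have "scale r y + x = (\<Sum>i<N'. scale ((if i = j then r else 0) + c' i) (b i))"
    by (simp add: scale_left_distrib sum.distrib)
  then show ?case
    by (intro exI[of _ N'] exI[of _ "\<lambda>i. (if i = j then r else 0) + c' i"])
qed

text \<open>
  Passes from families to sets, the form in which freeness is stated: independence of the family \<open>b\<close> forces it to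
  be injective.
\<close>

lemma (in Modules.module) coefficients_vanish_on_range:
  fixes b :: "nat \<Rightarrow> 'b"
  assumes indep: "\<And>N c j. (\<Sum>j<N. scale (c j) (b j)) = 0 \<Longrightarrow> j < N \<Longrightarrow> c j = 0"
    and F: "finite F" "F \<subseteq> range b" "(\<Sum>x\<in>F. scale (p x) x) = 0" "x \<in> F"
  shows "p x = 0"
proof (cases "(1::'a) = 0")
  case True
  then show ?thesis by (metis mult_1 mult_zero_left)
next
  case False
  have inj: "inj b"
  proof (rule injI, rule ccontr)
    fix i j assume eq: "b i = b j" and "i \<noteq> j"
    define c where "c k = (if k = i then 1 else if k = j then - 1 else 0 :: 'a)" for k
    have "(\<Sum>k<Suc (max i j). scale (c k) (b k)) = (\<Sum>k\<in>{i, j}. scale (c k) (b k))"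
      by (rule sum.mono_neutral_right) (auto simp: c_def)
    also have "\<dots> = 0" using \<open>i \<noteq> j\<close> eq by (simp add: c_def)
    finally have "c i = 0" by (rule indep) simp
    then show False using False by (simp add: c_def)
  qed
  define J where "J = b -` F"
  have FJ: "F = b ` J" using F(2) by (auto simp: J_def)
  have "finite J" unfolding J_def using F(1) inj by (rule finite_vimageI)
  then obtain N where N: "J \<subseteq> {..<N}" using finite_nat_iff_bounded by blast
  have "0 = (\<Sum>j\<in>J. scale (p (b j)) (b j))"
    using F(3) unfolding FJ by (simp add: sum.reindex inj_on_subset[OF inj])
  also have "\<dots> = (\<Sum>j<N. scale (if j \<in> J then p (b j) else 0) (b j))"
    by (rule sum.mono_neutral_cong_left) (use N in auto)
  finally have z: "(\<Sum>j<N. scale (if j \<in> J then p (b j) else 0) (b j)) = 0" by simp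
  obtain j where "j \<in> J" "x = b j" using F(4) FJ by blast
  then show ?thesis using indep[OF z, of j] N by auto
qed

section \<open>Skew monoid rings with coefficients in a commutative ring\<close>

lemma ring_of_type_algebra_simps [simp]:
  "carrier (ring_of_type_algebra :: 'a::ring_1 ring) = UNIV"
  "\<zero>\<^bsub>ring_of_type_algebra\<^esub> = (0 :: 'a)" "\<one>\<^bsub>ring_of_type_algebra\<^esub> = (1 :: 'a)"
  "(x::'a) \<oplus>\<^bsub>ring_of_type_algebra\<^esub> y = x + y" "(x::'a) \<otimes>\<^bsub>ring_of_type_algebra\<^esub> y = x * y"
  by (simp_all add: ring_of_type_algebra_def)

lemma finsum_ring_of_type_algebra:
  "finite A \<Longrightarrow> finsum ring_of_type_algebra f A = (\<Sum>a\<in>A. f a :: 'a::comm_ring_1)"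
proof (induction A rule: finite_induct)
  interpret R: cring "ring_of_type_algebra :: 'a ring" by (rule cring_from_type_algebra)
  case empty
  show ?case by simp
next
  interpret R: cring "ring_of_type_algebra :: 'a ring" by (rule cring_from_type_algebra)
  case (insert a A)
  then show ?case by (subst R.finsum_insert) auto
qed

text \<open>
  For coefficients \<open>ring_of_type_algebra\<close> and a monoid on a whole type, carriers are trivial.  This covers both the
  free algebra (a free monoid acting trivially) and \<open>\<complex>(x\<^sup>m) * \<nat>\<close>.
\<close>

locale skew_action =
  fixes M :: "('m, 'f) monoid_scheme" and act :: "'m \<Rightarrow> 'k::comm_ring_1 \<Rightarrow> 'k"
  assumes monoid: "Group.monoid M" and carrier_M: "carrier M = UNIV"
    and act_add: "act m (a + b) = act m a + act m b"
    and act_times: "act m (a * b) = act m a * act m b"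
    and act_unit: "act m 1 = 1"
    and act_id: "act \<one>\<^bsub>M\<^esub> a = a"
    and act_comp: "act (m \<otimes>\<^bsub>M\<^esub> n) a = act m (act n a)"
begin

abbreviation S where "S \<equiv> skew_monoid_ring (ring_of_type_algebra :: 'k ring) M act"

definition supp :: "('m \<Rightarrow> 'k) \<Rightarrow> 'm set" where "supp f = {m. f m \<noteq> 0}"

lemma act_0: "act m 0 = 0"
  using act_add[of m 0 0] by simp

lemma in_carrier_iff: "f \<in> carrier S \<longleftrightarrow> finite (supp f)"
  by (simp add: skew_monoid_ring_def carrier_M supp_def)

lemma S_simps [simp]:
  "\<zero>\<^bsub>S\<^esub> = (\<lambda>_. 0)" "f \<oplus>\<^bsub>S\<^esub> g = (\<lambda>p. f p + g p)" "\<one>\<^bsub>S\<^esub> = (\<lambda>p. if p = \<one>\<^bsub>M\<^esub> then 1 else 0)"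
  by (simp_all add: skew_monoid_ring_def cong: if_cong)

lemma mult_eq:
  assumes "finite A" "supp f \<subseteq> A" "finite B" "supp g \<subseteq> B"
  shows "(f \<otimes>\<^bsub>S\<^esub> g) p = (\<Sum>m\<in>A. \<Sum>n\<in>B. if m \<otimes>\<^bsub>M\<^esub> n = p then f m * act m (g n) else 0)"
proof -
  let ?T = "{(m, n). f m \<noteq> 0 \<and> g n \<noteq> 0 \<and> m \<otimes>\<^bsub>M\<^esub> n = p}"
  have sub: "?T \<subseteq> A \<times> B" using assms by (auto simp: supp_def)
  have fin: "finite ?T" by (rule finite_subset[OF sub]) (use assms in auto)
  have "(f \<otimes>\<^bsub>S\<^esub> g) p = (\<Sum>(m, n)\<in>?T. f m * act m (g n))"
    unfolding skew_monoid_ring_def by (simp add: finsum_ring_of_type_algebra[OF fin])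
  also have "\<dots> = (\<Sum>(m, n)\<in>?T. if m \<otimes>\<^bsub>M\<^esub> n = p then f m * act m (g n) else 0)"
    by (intro sum.cong) auto
  also have "\<dots> = (\<Sum>(m, n)\<in>A \<times> B. if m \<otimes>\<^bsub>M\<^esub> n = p then f m * act m (g n) else 0)"
    using assms sub by (intro sum.mono_neutral_left) (auto simp: act_0 split: if_splits)
  finally show ?thesis by (simp add: sum.cartesian_product)
qed

text \<open>
  Both associativity and multiplicativity of evaluation are instances of this formula, for different \<open>F\<close>.
\<close>

lemma sum_mult_eq:
  fixes F :: "'m \<Rightarrow> 'k \<Rightarrow> 'r::ab_group_add"
  assumes A: "finite A" "supp f \<subseteq> A" and B: "finite B" "supp g \<subseteq> B"
    and D: "finite D" "\<And>m n. m \<in> A \<Longrightarrow> n \<in> B \<Longrightarrow> m \<otimes>\<^bsub>M\<^esub> n \<in> D"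
    and F: "\<And>p a b. F p (a + b) = F p a + F p b"
  shows "(\<Sum>p\<in>D. F p ((f \<otimes>\<^bsub>S\<^esub> g) p)) = (\<Sum>m\<in>A. \<Sum>n\<in>B. F (m \<otimes>\<^bsub>M\<^esub> n) (f m * act m (g n)))"
proof -
  have F0: "F p 0 = 0" for p using F[of p 0 0] by simp
  have Fsum: "F p (\<Sum>i\<in>I. h i) = (\<Sum>i\<in>I. F p (h i))" for p I and h :: "'m \<Rightarrow> 'k"
    by (induction I rule: infinite_finite_induct) (auto simp: F F0)
  have "(\<Sum>p\<in>D. F p ((f \<otimes>\<^bsub>S\<^esub> g) p))
      = (\<Sum>p\<in>D. \<Sum>m\<in>A. \<Sum>n\<in>B. if m \<otimes>\<^bsub>M\<^esub> n = p then F p (f m * act m (g n)) else 0)"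
    by (simp add: mult_eq[OF A B] Fsum if_distrib[of "F _"] F0 cong: if_cong)
  also have "\<dots> = (\<Sum>m\<in>A. \<Sum>n\<in>B. \<Sum>p\<in>D. if m \<otimes>\<^bsub>M\<^esub> n = p then F p (f m * act m (g n)) else 0)"
    by (subst sum.swap, rule sum.cong[OF refl], rule sum.swap)
  also have "\<dots> = (\<Sum>m\<in>A. \<Sum>n\<in>B. F (m \<otimes>\<^bsub>M\<^esub> n) (f m * act m (g n)))"
    by (intro sum.cong refl) (simp add: D sum.delta)
  finally show ?thesis .
qed

lemma supp_mult:
  "finite (supp f) \<Longrightarrow> finite (supp g) \<Longrightarrow>
    supp (f \<otimes>\<^bsub>S\<^esub> g) \<subseteq> (\<lambda>(m, n). m \<otimes>\<^bsub>M\<^esub> n) ` (supp f \<times> supp g)"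
proof
  fix p assume fin: "finite (supp f)" "finite (supp g)" and p: "p \<in> supp (f \<otimes>\<^bsub>S\<^esub> g)"
  show "p \<in> (\<lambda>(m, n). m \<otimes>\<^bsub>M\<^esub> n) ` (supp f \<times> supp g)"
  proof (rule ccontr)
    assume "\<not> ?thesis"
    then have "(f \<otimes>\<^bsub>S\<^esub> g) p = 0"
      unfolding mult_eq[OF fin(1) order_refl fin(2) order_refl]
      by (intro sum.neutral ballI) auto
    then show False using p by (simp add: supp_def)
  qed
qed

lemma supp_add: "supp (\<lambda>p. f p + g p) \<subseteq> supp f \<union> supp g"
  by (auto simp: supp_def)

lemma mult_closed:
  assumes "f \<in> carrier S" "g \<in> carrier S" shows "f \<otimes>\<^bsub>S\<^esub> g \<in> carrier S"
  using assms finite_subset[OF supp_mult[of f g]] by (simp add: in_carrier_iff)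

lemma mult_assoc:
  assumes "f \<in> carrier S" "g \<in> carrier S" "h \<in> carrier S"
  shows "(f \<otimes>\<^bsub>S\<^esub> g) \<otimes>\<^bsub>S\<^esub> h = f \<otimes>\<^bsub>S\<^esub> (g \<otimes>\<^bsub>S\<^esub> h)"
proof
  fix p
  note fin = assms[unfolded in_carrier_iff]
  let ?A = "supp f" and ?B = "supp g" and ?C = "supp h"
  let ?AB = "(\<lambda>(m, n). m \<otimes>\<^bsub>M\<^esub> n) ` (?A \<times> ?B)" and ?BC = "(\<lambda>(m, n). m \<otimes>\<^bsub>M\<^esub> n) ` (?B \<times> ?C)"
  have AB: "finite ?AB" "supp (f \<otimes>\<^bsub>S\<^esub> g) \<subseteq> ?AB" using supp_mult[of f g] fin by auto
  have BC: "finite ?BC" "supp (g \<otimes>\<^bsub>S\<^esub> h) \<subseteq> ?BC" using supp_mult[of g h] fin by auto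
  have assoc: "(a \<otimes>\<^bsub>M\<^esub> b) \<otimes>\<^bsub>M\<^esub> c = a \<otimes>\<^bsub>M\<^esub> (b \<otimes>\<^bsub>M\<^esub> c)" for a b c
    using monoid.m_assoc[OF monoid] by (simp add: carrier_M)
  have "((f \<otimes>\<^bsub>S\<^esub> g) \<otimes>\<^bsub>S\<^esub> h) p
      = (\<Sum>r\<in>?AB. (\<Sum>c\<in>?C. if r \<otimes>\<^bsub>M\<^esub> c = p then (f \<otimes>\<^bsub>S\<^esub> g) r * act r (h c) else 0))"
    by (rule mult_eq[OF AB fin(3) order_refl])
  also have "\<dots> = (\<Sum>a\<in>?A. \<Sum>b\<in>?B. (\<Sum>c\<in>?C. if (a \<otimes>\<^bsub>M\<^esub> b) \<otimes>\<^bsub>M\<^esub> c = p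
      then (f a * act a (g b)) * act (a \<otimes>\<^bsub>M\<^esub> b) (h c) else 0))"
    by (rule sum_mult_eq[OF fin(1) order_refl fin(2) order_refl AB(1),
          where F = "\<lambda>r x. \<Sum>c\<in>?C. if r \<otimes>\<^bsub>M\<^esub> c = p then x * act r (h c) else 0"])
      (auto simp: sum.distrib[symmetric] algebra_simps intro!: sum.cong)
  also have "\<dots> = (\<Sum>a\<in>?A. \<Sum>b\<in>?B. \<Sum>c\<in>?C. if a \<otimes>\<^bsub>M\<^esub> (b \<otimes>\<^bsub>M\<^esub> c) = p
      then f a * act a (g b * act b (h c)) else 0)"
    by (simp add: assoc act_times act_comp mult.assoc cong: if_cong)
  also have "\<dots> = (\<Sum>a\<in>?A. \<Sum>s\<in>?BC. if a \<otimes>\<^bsub>M\<^esub> s = p then f a * act a ((g \<otimes>\<^bsub>S\<^esub> h) s) else 0)"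
  proof (rule sum.cong[OF refl])
    fix a assume "a \<in> ?A"
    show "(\<Sum>b\<in>?B. \<Sum>c\<in>?C. if a \<otimes>\<^bsub>M\<^esub> (b \<otimes>\<^bsub>M\<^esub> c) = p then f a * act a (g b * act b (h c)) else 0)
      = (\<Sum>s\<in>?BC. if a \<otimes>\<^bsub>M\<^esub> s = p then f a * act a ((g \<otimes>\<^bsub>S\<^esub> h) s) else 0)"
      by (rule sum_mult_eq[OF fin(2) order_refl fin(3) order_refl BC(1), symmetric,
            where F = "\<lambda>s x. if a \<otimes>\<^bsub>M\<^esub> s = p then f a * act a x else 0"])
        (auto simp: act_add algebra_simps)
  qed
  also have "\<dots> = (f \<otimes>\<^bsub>S\<^esub> (g \<otimes>\<^bsub>S\<^esub> h)) p"
    by (rule mult_eq[OF fin(1) order_refl BC, symmetric])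
  finally show "((f \<otimes>\<^bsub>S\<^esub> g) \<otimes>\<^bsub>S\<^esub> h) p = (f \<otimes>\<^bsub>S\<^esub> (g \<otimes>\<^bsub>S\<^esub> h)) p" .
qed

lemma monom_elem_closed [simp]: "monom_elem ring_of_type_algebra a m \<in> carrier S"
  by (rule in_carrier_iff[THEN iffD2], rule finite_subset[of _ "{m}"])
    (auto simp: supp_def monom_elem_def)

lemma mult_monom_elem:
  "monom_elem ring_of_type_algebra a m \<otimes>\<^bsub>S\<^esub> monom_elem ring_of_type_algebra b n
     = monom_elem ring_of_type_algebra (a * act m b) (m \<otimes>\<^bsub>M\<^esub> n)"
  by (rule ext, subst mult_eq[of "{m}" _ "{n}"]) (auto simp: supp_def monom_elem_def act_0)

lemma one_mult:
  assumes "f \<in> carrier S" shows "\<one>\<^bsub>S\<^esub> \<otimes>\<^bsub>S\<^esub> f = f" "f \<otimes>\<^bsub>S\<^esub> \<one>\<^bsub>S\<^esub> = f"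
proof -
  note fin = assms[unfolded in_carrier_iff]
  have one: "supp \<one>\<^bsub>S\<^esub> \<subseteq> {\<one>\<^bsub>M\<^esub>}" by (auto simp: supp_def)
  have M: "\<one>\<^bsub>M\<^esub> \<otimes>\<^bsub>M\<^esub> m = m" "m \<otimes>\<^bsub>M\<^esub> \<one>\<^bsub>M\<^esub> = m" for m
    using monoid.l_one[OF monoid] monoid.r_one[OF monoid] by (auto simp: carrier_M)
  show "\<one>\<^bsub>S\<^esub> \<otimes>\<^bsub>S\<^esub> f = f"
    by (rule ext, subst mult_eq[OF _ one fin order_refl]) (use fin in \<open>auto simp: M act_0 act_id sum.delta' supp_def\<close>)
  show "f \<otimes>\<^bsub>S\<^esub> \<one>\<^bsub>S\<^esub> = f"
    by (rule ext, subst mult_eq[OF fin order_refl _ one]) (use fin in \<open>auto simp: M act_0 act_unit sum.delta' supp_def\<close>)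
qed

lemma add_mult:
  assumes "f \<in> carrier S" "g \<in> carrier S" "h \<in> carrier S"
  shows "(f \<oplus>\<^bsub>S\<^esub> g) \<otimes>\<^bsub>S\<^esub> h = (f \<otimes>\<^bsub>S\<^esub> h) \<oplus>\<^bsub>S\<^esub> (g \<otimes>\<^bsub>S\<^esub> h)"
    and "h \<otimes>\<^bsub>S\<^esub> (f \<oplus>\<^bsub>S\<^esub> g) = (h \<otimes>\<^bsub>S\<^esub> f) \<oplus>\<^bsub>S\<^esub> (h \<otimes>\<^bsub>S\<^esub> g)"
proof -
  note fin = assms[unfolded in_carrier_iff]
  let ?A = "supp f \<union> supp g"
  have A: "finite ?A" "supp f \<subseteq> ?A" "supp g \<subseteq> ?A" "supp (f \<oplus>\<^bsub>S\<^esub> g) \<subseteq> ?A"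
    using fin by (auto simp: supp_def)
  show "(f \<oplus>\<^bsub>S\<^esub> g) \<otimes>\<^bsub>S\<^esub> h = (f \<otimes>\<^bsub>S\<^esub> h) \<oplus>\<^bsub>S\<^esub> (g \<otimes>\<^bsub>S\<^esub> h)"
    by (rule ext, simp only: S_simps mult_eq[OF A(1,2) fin(3) order_refl]
        mult_eq[OF A(1,3) fin(3) order_refl] mult_eq[OF A(1,4)[unfolded S_simps] fin(3) order_refl])
      (auto simp: sum.distrib[symmetric] algebra_simps intro!: sum.cong)
  show "h \<otimes>\<^bsub>S\<^esub> (f \<oplus>\<^bsub>S\<^esub> g) = (h \<otimes>\<^bsub>S\<^esub> f) \<oplus>\<^bsub>S\<^esub> (h \<otimes>\<^bsub>S\<^esub> g)"
    by (rule ext, simp only: S_simps mult_eq[OF fin(3) order_refl A(1,2)]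
        mult_eq[OF fin(3) order_refl A(1,3)] mult_eq[OF fin(3) order_refl A(1,4)[unfolded S_simps]])
      (auto simp: sum.distrib[symmetric] algebra_simps act_add intro!: sum.cong)
qed

lemma ring_S: "ring S"
proof (rule ringI)
  show "abelian_group S"
  proof (rule abelian_groupI)
    show "x \<oplus>\<^bsub>S\<^esub> y \<in> carrier S" if "x \<in> carrier S" "y \<in> carrier S" for x y
      using that finite_subset[OF supp_add[of x y]] by (simp add: in_carrier_iff)
    show "\<exists>y\<in>carrier S. y \<oplus>\<^bsub>S\<^esub> x = \<zero>\<^bsub>S\<^esub>" if "x \<in> carrier S" for x
      using that by (intro bexI[of _ "\<lambda>m. - x m"]) (auto simp: in_carrier_iff supp_def)
  qed (auto simp: in_carrier_iff supp_def algebra_simps)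
  show "Group.monoid S"
  proof (rule monoidI)
    show "\<one>\<^bsub>S\<^esub> \<in> carrier S"
      unfolding in_carrier_iff by (rule finite_subset[of _ "{\<one>\<^bsub>M\<^esub>}"]) (auto simp: supp_def)
  qed (use mult_closed mult_assoc one_mult in \<open>simp_all del: S_simps\<close>)
qed (use add_mult in \<open>simp_all del: S_simps\<close>)

lemma a_inv_S: "f \<in> carrier S \<Longrightarrow> \<ominus>\<^bsub>S\<^esub> f = (\<lambda>m. - f m)"
proof -
  interpret ring S by (rule ring_S)
  assume f: "f \<in> carrier S"
  then have "(\<lambda>m. - f m) \<in> carrier S" by (simp add: in_carrier_iff supp_def)
  moreover have "(\<lambda>m. - f m) \<oplus>\<^bsub>S\<^esub> f = \<zero>\<^bsub>S\<^esub>" by simp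
  ultimately show "\<ominus>\<^bsub>S\<^esub> f = (\<lambda>m. - f m)" using f minus_equality by blast
qed

text \<open>
  The universal property: a ring homomorphism \<open>j\<close> on the coefficients and a monoid homomorphism \<open>u\<close> with
  \<open>u(m) j(a) = j(act m a) u(m)\<close> extend to the skew monoid ring.
\<close>

definition eval :: "('k \<Rightarrow> 'r) \<Rightarrow> ('m \<Rightarrow> 'r) \<Rightarrow> ('m \<Rightarrow> 'k) \<Rightarrow> 'r::ring_1" where
  "eval j u f = (\<Sum>m\<in>supp f. j (f m) * u m)"

lemma eval_eq:
  assumes "finite A" "supp f \<subseteq> A" "j 0 = 0"
  shows "eval j u f = (\<Sum>m\<in>A. j (f m) * u m)"
  unfolding eval_def using assms by (intro sum.mono_neutral_left) (auto simp: supp_def)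

lemma eval_monom_elem:
  "j 0 = 0 \<Longrightarrow> eval j u (monom_elem ring_of_type_algebra a m) = j a * u m"
  by (subst eval_eq[of "{m}"]) (auto simp: supp_def monom_elem_def)

lemma eval_add:
  assumes "f \<in> carrier S" "g \<in> carrier S" and j: "\<And>a b. j (a + b) = j a + j b"
  shows "eval j u (f \<oplus>\<^bsub>S\<^esub> g) = eval j u f + eval j u g"
proof -
  have j0: "j 0 = 0" using j[of 0 0] by simp
  let ?A = "supp f \<union> supp g"
  have A: "finite ?A" "supp f \<subseteq> ?A" "supp g \<subseteq> ?A" "supp (\<lambda>p. f p + g p) \<subseteq> ?A"
    using assms(1,2) by (auto simp: supp_def in_carrier_iff)
  show ?thesis
    by (simp add: eval_eq[of ?A, where j = j, OF A(1) _ j0] A j algebra_simps sum.distrib)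
qed

lemma eval_mult:
  fixes u :: "'m \<Rightarrow> 'r::ring_1"
  assumes "f \<in> carrier S" "g \<in> carrier S" and j: "\<And>a b. j (a + b) = j a + j b"
    "\<And>a b. j (a * b) = j a * j b" and u: "\<And>m n. u (m \<otimes>\<^bsub>M\<^esub> n) = u m * u n"
    and uj: "\<And>m a. u m * j a = j (act m a) * u m"
  shows "eval j u (f \<otimes>\<^bsub>S\<^esub> g) = eval j u f * eval j u g"
proof -
  note fin = assms(1,2)[unfolded in_carrier_iff]
  have j0: "j 0 = 0" using j(1)[of 0 0] by simp
  let ?D = "(\<lambda>(m, n). m \<otimes>\<^bsub>M\<^esub> n) ` (supp f \<times> supp g)"
  have D: "finite ?D" "supp (f \<otimes>\<^bsub>S\<^esub> g) \<subseteq> ?D" using supp_mult[of f g] fin by auto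
  have "eval j u (f \<otimes>\<^bsub>S\<^esub> g) = (\<Sum>p\<in>?D. j ((f \<otimes>\<^bsub>S\<^esub> g) p) * u p)"
    by (rule eval_eq[where j = j, OF D j0])
  also have "\<dots> = (\<Sum>m\<in>supp f. \<Sum>n\<in>supp g. j (f m * act m (g n)) * u (m \<otimes>\<^bsub>M\<^esub> n))"
    by (rule sum_mult_eq[OF fin(1) order_refl fin(2) order_refl D(1), where F = "\<lambda>p x. j x * u p"])
      (auto simp: j algebra_simps)
  finally have eq: "eval j u (f \<otimes>\<^bsub>S\<^esub> g)
      = (\<Sum>m\<in>supp f. \<Sum>n\<in>supp g. j (f m * act m (g n)) * u (m \<otimes>\<^bsub>M\<^esub> n))" .
  have "j (f m * act m (g n)) * u (m \<otimes>\<^bsub>M\<^esub> n) = (j (f m) * u m) * (j (g n) * u n)" for m n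
  proof -
    have "(j (f m) * u m) * (j (g n) * u n) = j (f m) * (u m * j (g n)) * u n"
      by (simp add: mult.assoc)
    then show ?thesis by (simp add: uj j u mult.assoc)
  qed
  then show ?thesis unfolding eq by (simp add: eval_def sum_product)
qed

end

lemma (in skew_action) carrier_induct [consumes 1, case_names zero monom add]:
  assumes "f \<in> carrier S" and "P \<zero>\<^bsub>S\<^esub>"
    and monom: "\<And>a m. P (monom_elem ring_of_type_algebra a m)"
    and add: "\<And>f g. f \<in> carrier S \<Longrightarrow> g \<in> carrier S \<Longrightarrow> P f \<Longrightarrow> P g \<Longrightarrow> P (f \<oplus>\<^bsub>S\<^esub> g)"
  shows "P f"
proof -
  have "P g" if "finite A" "supp g \<subseteq> A" for g A
    using that
  proof (induction A arbitrary: g rule: finite_induct)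
    case empty
    then have "g = \<zero>\<^bsub>S\<^esub>" by (auto simp: supp_def)
    then show ?case using assms(2) by simp
  next
    case (insert m A)
    have "supp (g(m := 0)) \<subseteq> A" using insert.prems by (auto simp: supp_def)
    then have "P (g(m := 0))" "g(m := 0) \<in> carrier S"
      using insert.IH insert.hyps finite_subset in_carrier_iff by blast+
    moreover have "g = monom_elem ring_of_type_algebra (g m) m \<oplus>\<^bsub>S\<^esub> g(m := 0)"
      by (auto simp: monom_elem_def)
    ultimately show ?case using add[OF monom_elem_closed _ monom] by metis
  qed
  then show ?thesis using assms(1) in_carrier_iff by blast
qed

section \<open>The operators x, y, Z and the degree in Z\<close>

abbreviation Kc :: "complex \<Rightarrow> ratfun" where "Kc c \<equiv> poly_to_ratfun [:c:]"
abbreviation Kt :: ratfun where "Kt \<equiv> poly_to_ratfun [:0, 1:]"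

lemma Kc_hom:
  "Kc 0 = 0" "Kc 1 = 1" "Kc (a + b) = Kc a + Kc b" "Kc (a - b) = Kc a - Kc b" "Kc (a * b) = Kc a * Kc b"
  "Kc (- a) = - Kc a"
  using poly_to_ratfun_hom(2)
  by (simp_all add: poly_to_ratfun_hom(1) one_pCons flip: poly_to_ratfun_hom(3-6))

lemma Kc_power: "Kc (a ^ k) = Kc a ^ k"
  by (induction k) (auto simp: Kc_hom)

lemma Kc_inverse: "Kc (inverse a) = inverse (Kc a)"
proof (cases "a = 0")
  case False
  then have "Kc a * Kc (inverse a) = 1" by (simp flip: Kc_hom(5) add: Kc_hom(2))
  then show ?thesis by (simp add: inverse_unique)
qed (simp add: Kc_hom poly_to_ratfun_hom)

locale qparam =
  fixes q :: complex
  assumes q_nonzero: "q \<noteq> 0" and q_power: "\<And>k::nat. k > 0 \<Longrightarrow> q ^ k \<noteq> 1"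
begin

lemma q_neq_1: "q \<noteq> 1"
  using q_power[of 1] by simp

lemma Kc_q1_nonzero [simp]: "Kc (q - 1) \<noteq> 0"
  using q_neq_1 by simp

lemma q_power_eq: "q ^ i = q ^ j \<longleftrightarrow> i = j"
proof
  have *: False if "i < j" "q ^ i = q ^ j" for i j :: nat
  proof -
    have "q ^ i * q ^ (j - i) = q ^ i * 1" using that power_add[of q i "j - i"] by simp
    then have "q ^ (j - i) = 1" using q_nonzero by simp
    with q_power[of "j - i"] that show False by simp
  qed
  assume "q ^ i = q ^ j"
  then show "i = j" using *[of i j] *[of j i] by (cases i j rule: linorder_cases) auto
qed simp

text \<open>
  The \<open>k\<close>-th power of \<open>t \<mapsto> q t\<close>.
\<close>

definition sh :: "nat \<Rightarrow> ratfun \<Rightarrow> ratfun" where "sh k = ratfun_subst [:0, q ^ k:]"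

lemma sh_degree: "degree [:0, q ^ k:] > 0"
  using q_nonzero by simp

lemmas sh_hom = ratfun_subst_hom[OF sh_degree, folded sh_def]

lemma sh_Kc [simp]: "sh k (Kc c) = Kc c"
  unfolding sh_def by (rule ratfun_subst_const[OF sh_degree])

lemma sh_poly: "sh k (poly_to_ratfun p) = poly_to_ratfun (p \<circ>\<^sub>p [:0, q ^ k:])"
  unfolding sh_def by (rule ratfun_subst_poly[OF sh_degree])

lemma sh_Kt: "sh k Kt = Kc (q ^ k) * Kt"
  unfolding sh_poly by (simp flip: poly_to_ratfun_hom add: pcompose_pCons)

lemma sh_inverse: "sh k (inverse f) = inverse (sh k f)"
  unfolding sh_def by (rule ratfun_subst_inverse[OF sh_degree])

lemma sh_divide: "sh k (f / g) = sh k f / sh k g"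
  by (simp add: divide_inverse sh_hom sh_inverse)

lemma sh_minus: "sh k (- f) = - sh k f"
  using sh_hom(3)[of k f "- f"] by (simp add: sh_hom(1) eq_neg_iff_add_eq_0 add.commute)

lemma sh_diff: "sh k (f - g) = sh k f - sh k g"
  using sh_hom(3)[of k f "- g"] by (simp add: sh_minus)

lemma sh_pow: "sh k (f ^ n) = sh k f ^ n"
  by (induction n) (auto simp: sh_hom)

lemma sh_eq_0_iff [simp]: "sh k f = 0 \<longleftrightarrow> f = 0"
  unfolding sh_def by (rule ratfun_subst_eq_0_iff[OF sh_degree])

lemma sh_0 [simp]: "sh 0 f = f"
  by (simp add: sh_def ratfun_subst_ident)

lemma sh_sh: "sh i (sh j f) = sh (i + j) f"
  unfolding sh_def by (subst ratfun_subst_subst[OF sh_degree sh_degree])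
    (simp add: pcompose_pCons power_add mult.commute)

definition sh_inv :: "nat \<Rightarrow> ratfun \<Rightarrow> ratfun" where "sh_inv k = ratfun_subst [:0, inverse (q ^ k):]"

lemma sh_inv_degree: "degree [:0, inverse (q ^ k):] > 0"
  using q_nonzero by simp

lemma sh_sh_inv [simp]: "sh k (sh_inv k f) = f" "sh_inv k (sh k f) = f"
  unfolding sh_def sh_inv_def using q_nonzero
  by (simp_all add: ratfun_subst_subst[OF sh_degree sh_inv_degree]
      ratfun_subst_subst[OF sh_inv_degree sh_degree] pcompose_pCons ratfun_subst_ident)

lift_definition opZ :: "ratfun endo" is "ratfun_subst [:0, q:]"
  using ratfun_subst_hom(3)[of "[:0, q:]"] q_nonzero by auto

lift_definition opZinv :: "ratfun endo" is "ratfun_subst [:0, inverse q:]"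
  using ratfun_subst_hom(3)[of "[:0, inverse q:]"] q_nonzero by auto

text \<open>
  The scalars, \<open>x\<close>, and \<open>y\<close>, which is the \<open>q\<close>-derivative.
\<close>

definition opX :: "ratfun endo" where "opX = lmult Kt"
definition opC :: "complex \<Rightarrow> ratfun endo" where "opC c = lmult (Kc c)"
definition opY :: "ratfun endo" where "opY = lmult (1 / (Kc (q - 1) * Kt)) * (opZ - 1)"

lemma apply_Z: "endo_apply opZ f = sh 1 f"
  using q_nonzero by (simp add: opZ.rep_eq sh_def)

lemma apply_Zinv: "endo_apply opZinv f = sh_inv 1 f"
  using q_nonzero by (simp add: opZinv.rep_eq sh_inv_def)

lemma opZ_opZinv [simp]: "opZ * opZinv = 1" "opZinv * opZ = 1"
  by (auto intro!: endo_eqI simp: apply_Z apply_Zinv simp del: One_nat_def)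

lemma apply_Z_power: "endo_apply (opZ ^ k) f = sh k f"
proof (induction k arbitrary: f)
  case (Suc k)
  then show ?case by (simp add: apply_Z sh_sh)
qed simp

lemma opZ_lmult: "opZ ^ k * lmult a = lmult (sh k a) * opZ ^ k"
  by (rule endo_eqI) (simp add: apply_Z_power sh_hom)

lemma apply_Y: "endo_apply opY f = (sh 1 f - f) / (Kc (q - 1) * Kt)"
  by (simp add: opY_def apply_Z)

lemma opC_hom: "opC 0 = 0" "opC 1 = 1" "opC (a + b) = opC a + opC b" "opC (a - b) = opC a - opC b" "opC (a * b) = opC a * opC b"
  "opC (- a) = - opC a"
  by (simp_all add: opC_def Kc_hom lmult_hom)

lemma opC_inverse: "c \<noteq> 0 \<Longrightarrow> opC c * opC (inverse c) = 1" "c \<noteq> 0 \<Longrightarrow> opC (inverse c) * opC c = 1"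
  by (simp_all add: opC_hom flip: opC_hom(5))

lemma opC_eq_iff [simp]: "opC a = opC b \<longleftrightarrow> a = b"
  by (simp add: opC_def)

lemma opC_eq_0_iff [simp]: "opC a = 0 \<longleftrightarrow> a = 0"
  using opC_eq_iff[of a 0] by (simp add: opC_hom)

lemma opZ_opC: "opZ * opC c = opC c * opZ"
  using opZ_lmult[of 1 "Kc c"] by (simp add: opC_def)

lemma opC_commute:
  "opX * opC c = opC c * opX" "opY * opC c = opC c * opY" "opC d * opC c = opC c * opC d"
proof -
  show "opX * opC c = opC c * opX" "opC d * opC c = opC c * opC d"
    unfolding opX_def opC_def by (rule lmult_commute)+
  show "opY * opC c = opC c * opY"
    by (rule endo_eqI) (simp add: apply_Y opC_def sh_hom algebra_simps diff_divide_distrib)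
qed

lemma opZ_eq: "opZ = 1 + opC (q - 1) * opX * opY"
  by (rule endo_eqI) (simp add: apply_Z apply_Y opC_def opX_def q_neq_1)

lemma opZ_opX: "opZ * opX = opC q * opX * opZ"
  by (rule endo_eqI) (simp add: apply_Z opX_def opC_def sh_hom sh_Kt)

lemma opY_opX: "opY * opX = opC q * opX * opY + 1"
proof (rule endo_eqI)
  fix f
  define a where "a = Kc (q - 1)"
  have "a \<noteq> 0" "Kc q = a + 1" unfolding a_def by (rule Kc_q1_nonzero, simp add: Kc_hom)
  then show "endo_apply (opY * opX) f = endo_apply (opC q * opX * opY + 1) f"
    by (simp add: apply_Y opX_def opC_def sh_hom sh_Kt field_simps flip: a_def)
qed

lemma opY_opZ: "opY * opZ = opC q * opZ * opY"
  by (rule endo_eqI) (simp add: apply_Z apply_Y opC_def sh_divide sh_hom sh_Kt sh_diff q_nonzero)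

text \<open>
  Applied to \<open>t\<^sup>N\<close>, the operator \<open>\<Sum>\<^sub>k a\<^sub>k Z\<^sup>k\<close> gives \<open>t\<^sup>N\<close> times the value of the polynomial \<open>\<Sum>\<^sub>k a\<^sub>k u\<^sup>k\<close>
  at \<open>u = q\<^sup>N\<close>.  These points are distinct, so the polynomial has infinitely many roots.
\<close>

lemma dedekind:
  assumes "(\<Sum>k<n. lmult (a k) * opZ ^ k) = 0" "k < n"
  shows "a k = 0"
proof -
  define P where "P = (\<Sum>k<n. Polynomial.monom (a k) k)"
  have "poly P (Kc (q ^ N)) = 0" for N
  proof -
    have "0 = endo_apply (\<Sum>k<n. lmult (a k) * opZ ^ k) (Kt ^ N)"
      by (simp add: assms(1))
    also have "\<dots> = (\<Sum>k<n. a k * Kc (q ^ N) ^ k) * Kt ^ N"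
      by (simp add: endo_apply_sum apply_Z_power sh_pow sh_Kt power_mult_distrib sum_distrib_right sum_distrib_left
          Kc_power algebra_simps flip: power_mult)
    finally have "(\<Sum>k<n. a k * Kc (q ^ N) ^ k) = 0" by simp
    then show ?thesis by (simp add: P_def poly_sum poly_monom)
  qed
  then have "range (\<lambda>N. Kc (q ^ N)) \<subseteq> {x. poly P x = 0}" by auto
  moreover have "inj (\<lambda>N. Kc (q ^ N))" by (simp add: inj_def q_power_eq)
  ultimately have "infinite {x. poly P x = 0}"
    using finite_subset range_inj_infinite by blast
  then have "P = 0" using poly_roots_finite by blast
  moreover have "Polynomial.coeff P k = a k"
    using assms(2) by (simp add: P_def coeff_sum)
  ultimately show ?thesis by simp
qed

text \<open>
  Operators of degree less than \<open>n\<close> in \<open>Z\<close>.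
\<close>

definition L :: "nat \<Rightarrow> ratfun endo set" where
  "L n = range (\<lambda>a. \<Sum>k<n. lmult (a k) * opZ ^ k)"

lemma L_I: "(\<Sum>k<n. lmult (a k) * opZ ^ k) \<in> L n"
  by (auto simp: L_def)

lemma L_E: assumes "b \<in> L n" obtains a where "b = (\<Sum>k<n. lmult (a k) * opZ ^ k)"
  using assms by (auto simp: L_def)

lemma L_0: "L 0 = {0}"
  by (auto simp: L_def)

lemma L_zero [simp]: "0 \<in> L n"
  using L_I[of "\<lambda>_. 0" n] by (simp add: lmult_hom)

lemma L_add: assumes "b \<in> L n" "c \<in> L n" shows "b + c \<in> L n"
proof -
  obtain a d where "b = (\<Sum>k<n. lmult (a k) * opZ ^ k)" "c = (\<Sum>k<n. lmult (d k) * opZ ^ k)"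
    using assms by (auto elim!: L_E)
  then have "b + c = (\<Sum>k<n. lmult (a k + d k) * opZ ^ k)"
    by (simp add: lmult_hom distrib_right sum.distrib)
  then show ?thesis using L_I by simp
qed

lemma L_lmult: assumes "b \<in> L n" shows "lmult r * b \<in> L n"
proof -
  obtain a where "b = (\<Sum>k<n. lmult (a k) * opZ ^ k)" using assms by (auto elim!: L_E)
  then have "lmult r * b = (\<Sum>k<n. lmult (r * a k) * opZ ^ k)"
    by (simp add: lmult_hom sum_distrib_left mult.assoc)
  then show ?thesis using L_I by simp
qed

lemma L_uminus: "b \<in> L n \<Longrightarrow> - b \<in> L n"
  using L_lmult[of b n "-1"] by (simp add: lmult_hom)

lemma L_diff: "b \<in> L n \<Longrightarrow> c \<in> L n \<Longrightarrow> b - c \<in> L n"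
  using L_add[of b n "- c"] L_uminus by simp

lemma L_sum: "(\<And>i. i \<in> I \<Longrightarrow> f i \<in> L n) \<Longrightarrow> sum f I \<in> L n"
  by (induction I rule: infinite_finite_induct) (auto intro: L_add)

lemma L_Suc: "L n \<subseteq> L (Suc n)"
proof
  fix b assume "b \<in> L n"
  then obtain a where b: "b = (\<Sum>k<n. lmult (a k) * opZ ^ k)" by (auto elim!: L_E)
  have "b = (\<Sum>k<Suc n. lmult ((a(n := 0)) k) * opZ ^ k)"
    unfolding b by (auto simp: lmult_hom intro!: sum.cong)
  then show "b \<in> L (Suc n)" using L_I by metis
qed

lemma L_mono: "n \<le> m \<Longrightarrow> L n \<subseteq> L m"
  using lift_Suc_mono_le[of L n m] L_Suc by auto

lemma L_term: "lmult a * opZ ^ k \<in> L (Suc k)"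
proof -
  have eq: "lmult a * opZ ^ k = (\<Sum>i<Suc k. lmult (if i = k then a else 0) * opZ ^ i)"
    by (simp add: lmult_hom)
  show ?thesis unfolding eq by (rule L_I)
qed

lemma L_Z_right: assumes "b \<in> L n" shows "b * opZ ^ k \<in> L (n + k)"
proof -
  obtain a where b: "b = (\<Sum>k<n. lmult (a k) * opZ ^ k)" using assms by (auto elim!: L_E)
  have "b * opZ ^ k = (\<Sum>i<n. lmult (a i) * opZ ^ (i + k))"
    unfolding b by (simp add: sum_distrib_right mult.assoc power_add)
  also have "\<dots> \<in> L (n + k)"
  proof (rule L_sum)
    fix i assume "i \<in> {..<n}"
    then show "lmult (a i) * opZ ^ (i + k) \<in> L (n + k)"
      using L_term[of "a i" "i + k"] L_mono[of "Suc (i + k)" "n + k"] by auto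
  qed
  finally show ?thesis .
qed

lemma L_lmult_right: assumes "b \<in> L n" shows "b * lmult r \<in> L n"
proof -
  obtain a where b: "b = (\<Sum>k<n. lmult (a k) * opZ ^ k)" using assms by (auto elim!: L_E)
  have "b * lmult r = (\<Sum>i<n. lmult (a i * sh i r) * opZ ^ i)"
    unfolding b by (simp add: sum_distrib_right mult.assoc opZ_lmult lmult_hom)
  then show ?thesis using L_I by simp
qed

lemma L_mult: assumes "b \<in> L n" "c \<in> L (Suc k)" shows "b * c \<in> L (n + k)"
proof -
  obtain a where c: "c = (\<Sum>i<Suc k. lmult (a i) * opZ ^ i)" using assms by (auto elim!: L_E)
  have "b * c = (\<Sum>i<Suc k. b * lmult (a i) * opZ ^ i)"
    unfolding c by (simp add: sum_distrib_left mult.assoc distrib_left)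
  also have "\<dots> \<in> L (n + k)"
  proof (rule L_sum)
    fix i assume "i \<in> {..<Suc k}"
    then show "b * lmult (a i) * opZ ^ i \<in> L (n + k)"
      using L_Z_right[OF L_lmult_right[OF assms(1)], of "a i" i] L_mono[of "n + i" "n + k"] by auto
  qed
  finally show ?thesis .
qed

text \<open>
  The coefficient of \<open>b\<close> at \<open>Z\<^sup>n\<close> is \<open>a\<close>, and no higher power of \<open>Z\<close> occurs; \<open>a\<close> may be zero.
\<close>

definition lead :: "nat \<Rightarrow> ratfun endo \<Rightarrow> ratfun \<Rightarrow> bool" where
  "lead n b a \<longleftrightarrow> b - lmult a * opZ ^ n \<in> L n"

lemma lead_L: assumes "lead n b a" shows "b \<in> L (Suc n)"
proof -
  have "(b - lmult a * opZ ^ n) + lmult a * opZ ^ n \<in> L (Suc n)"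
    using assms L_Suc unfolding lead_def by (intro L_add L_term) auto
  then show ?thesis by simp
qed

lemma lead_exists: assumes "b \<in> L (Suc n)" shows "\<exists>a. lead n b a"
proof -
  obtain a where b: "b = (\<Sum>k<Suc n. lmult (a k) * opZ ^ k)" using assms by (auto elim!: L_E)
  have "lead n b (a n)" unfolding lead_def b using L_I by simp
  then show ?thesis by blast
qed

text \<open>
  The twist by \<open>sh n\<close> arises from moving \<open>Z\<^sup>n\<close> past the coefficient \<open>d\<close>.
\<close>

lemma lead_mult:
  assumes "lead n b a" "lead k c d"
  shows "lead (n + k) (b * c) (a * sh n d)"
proof -
  have "lmult (a * sh n d) * opZ ^ (n + k) = lmult a * ((opZ ^ n * lmult d) * opZ ^ k)"
    unfolding opZ_lmult by (simp add: lmult_hom power_add mult.assoc)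
  then have "b * c - lmult (a * sh n d) * opZ ^ (n + k)
      = (b - lmult a * opZ ^ n) * c + lmult a * (opZ ^ n * (c - lmult d * opZ ^ k))"
    by (simp add: algebra_simps)
  moreover have "(b - lmult a * opZ ^ n) * c \<in> L (n + k)"
    using assms by (intro L_mult lead_L) (auto simp: lead_def)
  moreover have "opZ ^ n * (c - lmult d * opZ ^ k) \<in> L (n + k)"
  proof (cases k)
    case 0
    then show ?thesis using assms(2) by (simp add: lead_def L_0)
  next
    case (Suc k')
    have "opZ ^ n \<in> L (Suc n)" using L_term[of 1 n] by (simp add: lmult_hom)
    from L_mult[OF this, of "c - lmult d * opZ ^ k" k'] show ?thesis
      using assms(2) Suc by (simp add: lead_def)
  qed
  ultimately show ?thesis unfolding lead_def by (simp add: L_add L_lmult)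
qed

lemma lead_zero: assumes "lead n b a" "b \<in> L n" shows "a = 0"
proof -
  have "b - (b - lmult a * opZ ^ n) \<in> L n"
    by (rule L_diff[OF assms(2) assms(1)[unfolded lead_def]])
  then obtain d where d: "lmult a * opZ ^ n = (\<Sum>k<n. lmult (d k) * opZ ^ k)" by (auto elim!: L_E)
  have "(\<Sum>k<Suc n. lmult ((d(n := - a)) k) * opZ ^ k) = (\<Sum>k<n. lmult (d k) * opZ ^ k) - lmult a * opZ ^ n"
    by (auto simp: lmult_hom intro!: sum.cong)
  then have "(\<Sum>k<Suc n. lmult ((d(n := - a)) k) * opZ ^ k) = 0" using d by simp
  from dedekind[OF this, of n] show ?thesis by simp
qed

lemma lead_nonzero_exists:
  assumes "b \<in> L N" "b \<noteq> 0"
  shows "\<exists>n a. n < N \<and> lead n b a \<and> a \<noteq> 0"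
  using assms
proof (induction N)
  case 0
  then show ?case by (simp add: L_0)
next
  case (Suc N)
  then obtain a where a: "lead N b a" using lead_exists by blast
  show ?case
  proof (cases "a = 0")
    case True
    then have "b \<in> L N" using a by (simp add: lead_def lmult_hom)
    then show ?thesis using Suc less_Suc_eq by blast
  qed (use a in blast)
qed

lemma lead_degree_unique:
  assumes "lead n b a" "a \<noteq> 0" "lead k b c" "c \<noteq> 0"
  shows "n = k"
proof -
  have "\<not> i < j" if "lead i b a'" "lead j b c'" "c' \<noteq> 0" for i j a' c'
    using lead_zero[OF that(2)] lead_L[OF that(1)] L_mono[of "Suc i" j] that(3)
    by (meson Suc_leI subsetD)
  then show ?thesis using assms by (meson linorder_neqE_nat)
qed

lemma lead_lmult: "lead 0 (lmult a) a"
  by (simp add: lead_def)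

lemma lead_Y: "lead 1 opY (1 / (Kc (q - 1) * Kt))"
proof -
  have "opY - lmult (1 / (Kc (q - 1) * Kt)) * opZ ^ 1 = lmult (- (1 / (Kc (q - 1) * Kt))) * opZ ^ 0"
    by (simp add: opY_def lmult_hom right_diff_distrib)
  then show ?thesis unfolding lead_def using L_term[of _ 0] by (metis One_nat_def)
qed

text \<open>
  All independence statements below rest on this.
\<close>

lemma lead_Y_power: "\<exists>a. a \<noteq> 0 \<and> lead n (opY ^ n) a"
proof (induction n)
  case 0
  show ?case using lead_lmult[of 1] by (auto simp: lmult_hom intro!: exI[of _ 1])
next
  case (Suc n)
  then obtain a where "a \<noteq> 0" "lead n (opY ^ n) a" by blast
  then show ?case using lead_mult[OF lead_Y, of n "opY ^ n" a]
    by (intro exI[of _ "1 / (Kc (q - 1) * Kt) * sh 1 a"]) (auto simp: q_neq_1)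
qed

end

section \<open>The algebra generated by x and y\<close>

context qparam
begin

inductive_set B :: "ratfun endo set" where
  B_C: "opC c \<in> B"
| B_X: "opX \<in> B"
| B_Y: "opY \<in> B"
| B_add: "a \<in> B \<Longrightarrow> b \<in> B \<Longrightarrow> a + b \<in> B"
| B_mult: "a \<in> B \<Longrightarrow> b \<in> B \<Longrightarrow> a * b \<in> B"

lemma B_0: "0 \<in> B" and B_1: "1 \<in> B"
  using B_C[of 0] B_C[of 1] by (simp_all add: opC_hom)

lemma B_sum: "(\<And>i. i \<in> I \<Longrightarrow> f i \<in> B) \<Longrightarrow> sum f I \<in> B"
  by (induction I rule: infinite_finite_induct) (auto intro: B_0 B_add)

lemma B_power: "a \<in> B \<Longrightarrow> a ^ n \<in> B"
  by (induction n) (auto intro: B_1 B_mult)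

lemma B_uminus: "a \<in> B \<Longrightarrow> - a \<in> B"
  using B_mult[OF B_C[of "-1"], of a] by (simp add: opC_hom)

lemma B_Z: "opZ \<in> B"
  unfolding opZ_eq by (intro B_add B_1 B_mult B_C B_X B_Y)

lemma opC_central: "b \<in> B \<Longrightarrow> b * opC c = opC c * b"
proof (induction rule: B.induct)
  case (B_mult a b)
  then show ?case by (metis mult.assoc)
qed (auto simp: opC_commute algebra_simps)

text \<open>
  The operators as a vector space over \<open>\<complex>\<close>; below, \<open>ml\<close> and \<open>mr\<close> are the left and right module structures over
  \<open>\<Gamma>\<close>, and \<open>kl\<close> and \<open>kr\<close> those over \<open>\<complex>(x\<^sup>m)\<close>.
\<close>

sublocale cs: Modules.module "\<lambda>c b. opC c * b"
  by standard (auto simp: opC_hom algebra_simps)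

text \<open>
  Multiplication by \<open>p(t\<^sup>m)\<close>: the operator by which an element \<open>p\<close> of \<open>\<Gamma> = \<complex>[x\<^sup>m]\<close> acts.
\<close>

definition poly_op :: "nat \<Rightarrow> complex poly \<Rightarrow> ratfun endo" where
  "poly_op m p = lmult (poly_to_ratfun (p \<circ>\<^sub>p Polynomial.monom 1 m))"

lemma poly_op_hom: "poly_op m 0 = 0" "poly_op m 1 = 1" "poly_op m (p + r) = poly_op m p + poly_op m r"
  "poly_op m (p * r) = poly_op m p * poly_op m r"
  by (simp_all add: poly_op_def pcompose_add pcompose_mult pcompose_1 poly_to_ratfun_hom lmult_hom)

lemma poly_op_pCons: "poly_op m (pCons c p) = opC c + opX ^ m * poly_op m p"
proof -
  have "Polynomial.monom (1::complex) m = [:0, 1:] ^ m"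
    by (simp add: monom_altdef)
  then show ?thesis
    by (simp add: poly_op_def pcompose_pCons poly_to_ratfun_hom lmult_hom opC_def opX_def
        poly_to_ratfun_power lmult_power)
qed

lemma poly_op_const: "poly_op m [:c:] = opC c"
  by (simp add: poly_op_pCons poly_op_hom)

lemma poly_op_monom: "poly_op m (Polynomial.monom c k) = opC c * opX ^ (m * k)"
proof (induction k)
  case 0
  show ?case by (simp add: monom_0 poly_op_const)
next
  case (Suc k)
  have "opX ^ m * opC c = opC c * opX ^ m"
    by (rule opC_central) (intro B_power B_X)
  then show ?case using Suc
    by (simp add: monom_Suc poly_op_pCons opC_hom power_add flip: mult.assoc)
qed

lemma poly_op_sum: "poly_op m (\<Sum>i\<in>I. p i) = (\<Sum>i\<in>I. poly_op m (p i))"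
  by (induction I rule: infinite_finite_induct) (auto simp: poly_op_hom)

lemma poly_op_expand: "poly_op m p = (\<Sum>k\<le>degree p. opC (Polynomial.coeff p k) * opX ^ (m * k))"
proof -
  have "poly_op m (\<Sum>k\<le>degree p. Polynomial.monom (Polynomial.coeff p k) k)
      = (\<Sum>k\<le>degree p. opC (Polynomial.coeff p k) * opX ^ (m * k))"
    by (simp add: poly_op_sum poly_op_monom)
  then show ?thesis by (simp add: poly_as_sum_of_monoms)
qed

lemma poly_op_B: "poly_op m p \<in> B"
  by (induction p) (auto simp: poly_op_hom poly_op_pCons intro: B_0 B_add B_C B_mult B_power B_X)

sublocale ml: Modules.module "\<lambda>p b. poly_op m p * b" for m
  by standard (auto simp: poly_op_hom algebra_simps)

sublocale mr: Modules.module "\<lambda>p b. b * poly_op m p" for m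
proof
  fix p r x
  have "poly_op m p * poly_op m r = poly_op m r * poly_op m p" by (metis poly_op_hom(4) mult.commute)
  then show "x * poly_op m r * poly_op m p = x * poly_op m (p * r)" by (simp add: poly_op_hom mult.assoc)
qed (auto simp: poly_op_hom algebra_simps)

text \<open>
  With \<open>x\<close> of degree one and \<open>y\<close> of degree minus one, \<open>deg0 m\<close> indexes the monomials of degree divisible by \<open>m\<close>.
\<close>

definition monXY :: "nat \<times> nat \<Rightarrow> ratfun endo" where "monXY = (\<lambda>(i, j). opX ^ i * opY ^ j)"
definition monYX :: "nat \<times> nat \<Rightarrow> ratfun endo" where "monYX = (\<lambda>(i, j). opY ^ j * opX ^ i)"
definition deg0 :: "nat \<Rightarrow> (nat \<times> nat) set" where "deg0 m = {(i, j). i mod m = j mod m}"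

definition qnum :: "nat \<Rightarrow> complex" where "qnum i = (\<Sum>k<i. q ^ k)"

lemma opY_opX_power: "opY * opX ^ Suc i = opC (q ^ Suc i) * opX ^ Suc i * opY + opC (qnum (Suc i)) * opX ^ i"
proof (induction i)
  case 0
  show ?case by (simp add: opY_opX qnum_def opC_hom)
next
  case (Suc i)
  have c: "opX ^ k * opC d = opC d * opX ^ k" for d k
    by (rule opC_central) (intro B_power B_X)
  have "opY * opX ^ Suc (Suc i) = (opY * opX) * opX ^ Suc i" by (simp add: mult.assoc)
  also have "\<dots> = opC q * opX * (opY * opX ^ Suc i) + opX ^ Suc i"
    by (simp add: opY_opX algebra_simps)
  also have "\<dots> = opC q * (opX * opC (q ^ Suc i)) * opX ^ Suc i * opY
      + opC q * (opX * opC (qnum (Suc i))) * opX ^ i + opX ^ Suc i"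
    unfolding Suc by (simp add: algebra_simps)
  also have "\<dots> = opC q * (opC (q ^ Suc i) * opX) * opX ^ Suc i * opY
      + opC q * (opC (qnum (Suc i)) * opX) * opX ^ i + opX ^ Suc i"
    by (simp only: opC_commute(1))
  also have "\<dots> = (opC q * opC (q ^ Suc i)) * (opX * opX ^ Suc i) * opY
      + (opC q * opC (qnum (Suc i)) + 1) * opX ^ Suc i"
    by (simp only: distrib_right mult.assoc power_Suc mult_1 add.assoc)
  also have "\<dots> = opC (q * q ^ Suc i) * opX ^ Suc (Suc i) * opY + opC (q * qnum (Suc i) + 1) * opX ^ Suc i"
    by (simp only: opC_hom power_Suc)
  also have "q * q ^ Suc i = q ^ Suc (Suc i)" by simp
  also have "q * qnum (Suc i) + 1 = qnum (Suc (Suc i))"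
    unfolding qnum_def by (subst (2) sum.lessThan_Suc_shift) (simp add: sum_distrib_left algebra_simps)
  finally show ?case .
qed

text \<open>
  The span of the ordered monomials contains \<open>1\<close> and is stable under left multiplication by the generators, since
  \<open>y x\<^sup>i\<close> can be reordered (\<open>opY_opX_power\<close>).
\<close>

lemma B_eq_monXY: "B = cs.span (range monXY)"
proof
  let ?T = "cs.span (range monXY)"
  have mon: "opX ^ i * opY ^ j \<in> ?T" for i j
    by (rule cs.span_base) (auto simp: monXY_def image_iff)
  have ind: "f * s \<in> ?T" if "s \<in> ?T" "\<And>i j. f * (opX ^ i * opY ^ j) \<in> ?T" "\<And>c. f * opC c = opC c * f" for f s
    using that(1)
  proof (induction rule: cs.span_induct_alt)
    case base
    show ?case by (simp add: cs.span_zero)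
  next
    case (step c x y)
    then obtain i j where x: "x = opX ^ i * opY ^ j" by (auto simp: monXY_def)
    have "f * (opC c * x + y) = opC c * (f * x) + f * y"
      using that(3)[of c] by (simp add: algebra_simps flip: mult.assoc)
    then show ?case using step that(2)[of i j] x by (simp add: cs.span_add cs.span_scale)
  qed
  have X: "opX * s \<in> ?T" if "s \<in> ?T" for s
  proof (rule ind[OF that])
    show "opX * (opX ^ i * opY ^ j) \<in> ?T" for i j using mon[of "Suc i" j] by (simp add: mult.assoc)
  qed (rule opC_commute)
  have Y: "opY * s \<in> ?T" if "s \<in> ?T" for s
  proof (rule ind[OF that])
    fix i j
    show "opY * (opX ^ i * opY ^ j) \<in> ?T"
    proof (cases i)
      case 0
      then show ?thesis using mon[of 0 "Suc j"] by simp
    next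
      case (Suc i')
      have "opY * (opX ^ i * opY ^ j) = (opY * opX ^ Suc i') * opY ^ j" by (simp add: Suc mult.assoc)
      also have "\<dots> = opC (q ^ Suc i') * (opX ^ Suc i' * opY ^ Suc j) + opC (qnum (Suc i')) * (opX ^ i' * opY ^ j)"
        unfolding opY_opX_power by (simp add: algebra_simps)
      also have "\<dots> \<in> ?T" by (intro cs.span_add cs.span_scale mon)
      finally show ?thesis .
    qed
  qed (rule opC_commute)
  have "b * s \<in> ?T" if "b \<in> B" "s \<in> ?T" for b s
    using that
    by (induction arbitrary: s rule: B.induct) (auto simp: X Y cs.span_scale cs.span_add mult.assoc distrib_right)
  from this[OF _ mon[of 0 0]] show "B \<subseteq> ?T" by auto
  have "cs.subspace B" unfolding cs.subspace_def by (auto intro: B_0 B_add B_mult B_C)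
  then show "?T \<subseteq> B"
    by (intro cs.span_minimal) (auto simp: monXY_def intro!: B_mult B_power B_X B_Y)
qed

lemma opX_power_opY: "opX ^ Suc i * opY = opC (inverse (q ^ Suc i)) * (opY * opX ^ Suc i - opC (qnum (Suc i)) * opX ^ i)"
  unfolding opY_opX_power using opC_inverse(2)[of "q ^ Suc i"] q_nonzero
  by (simp add: mult.assoc[symmetric])

text \<open>
  The mirror image, with right multiplication and \<open>opX_power_opY\<close>.
\<close>

lemma B_eq_monYX: "B = cs.span (range monYX)"
proof
  let ?T = "cs.span (range monYX)"
  have mon: "opY ^ j * opX ^ i \<in> ?T" for i j
    by (rule cs.span_base) (auto simp: monYX_def image_iff)
  have ind: "s * f \<in> ?T" if "s \<in> ?T" "\<And>i j. (opY ^ j * opX ^ i) * f \<in> ?T" for f s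
    using that(1)
  proof (induction rule: cs.span_induct_alt)
    case base
    show ?case by (simp add: cs.span_zero)
  next
    case (step c x y)
    then obtain i j where x: "x = opY ^ j * opX ^ i" by (auto simp: monYX_def)
    have "(opC c * x + y) * f = opC c * (x * f) + y * f"
      by (simp add: algebra_simps)
    then show ?case using step that(2)[of j i] x by (simp add: cs.span_add cs.span_scale)
  qed
  have X: "s * opX \<in> ?T" if "s \<in> ?T" for s
  proof (rule ind[OF that])
    show "(opY ^ j * opX ^ i) * opX \<in> ?T" for i j
      using mon[of j "Suc i"] by (simp add: mult.assoc power_commutes)
  qed
  have Y: "s * opY \<in> ?T" if "s \<in> ?T" for s
  proof (rule ind[OF that])
    fix i j
    show "(opY ^ j * opX ^ i) * opY \<in> ?T"
    proof (cases i)
      case 0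
      then show ?thesis using mon[of "Suc j" 0] by (simp add: power_commutes)
    next
      case (Suc i')
      have c: "opY ^ j * opC d = opC d * opY ^ j" for d
        by (rule opC_central) (intro B_power B_Y)
      have "(opY ^ j * opX ^ i) * opY = opY ^ j * (opX ^ Suc i' * opY)" by (simp add: Suc mult.assoc)
      also have "\<dots> = (opY ^ j * opC (inverse (q ^ Suc i'))) * (opY * opX ^ Suc i')
          - (opY ^ j * opC (inverse (q ^ Suc i'))) * (opC (qnum (Suc i')) * opX ^ i')"
        unfolding opX_power_opY by (simp only: right_diff_distrib mult.assoc)
      also have "\<dots> = opC (inverse (q ^ Suc i')) * (opY ^ Suc j * opX ^ Suc i')
          - opC (inverse (q ^ Suc i')) * ((opY ^ j * opC (qnum (Suc i'))) * opX ^ i')"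
        unfolding c[of "inverse (q ^ Suc i')"] by (simp only: mult.assoc power_Suc2)
      also have "\<dots> = opC (inverse (q ^ Suc i')) * (opY ^ Suc j * opX ^ Suc i')
          - opC (inverse (q ^ Suc i')) * (opC (qnum (Suc i')) * (opY ^ j * opX ^ i'))"
        unfolding c[of "qnum (Suc i')"] by (simp only: mult.assoc)
      also have "\<dots> \<in> ?T" by (intro cs.span_diff cs.span_scale mon)
      finally show ?thesis .
    qed
  qed
  have "s * b \<in> ?T" if "b \<in> B" "s \<in> ?T" for b s
    using that
  proof (induction arbitrary: s rule: B.induct)
    case (B_C c)
    have "s * opC c = opC c * s"
      using B_C.prems
    proof (induction rule: cs.span_induct_alt)
      case (step d x y)
      have "x \<in> B" using step(1) by (auto simp: monYX_def intro!: B_mult B_power B_X B_Y)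
      then have "opC d * x \<in> B" by (intro B_mult B.B_C)
      from opC_central[OF this] show ?case using step by (simp add: algebra_simps)
    qed simp
    then show ?case using B_C by (simp add: cs.span_scale)
  qed (auto simp: X Y cs.span_add distrib_left simp flip: mult.assoc)
  from this[OF _ mon[of 0 0]] show "B \<subseteq> ?T" by auto
  have "cs.subspace B" unfolding cs.subspace_def by (auto intro: B_0 B_add B_mult B_C)
  then show "?T \<subseteq> B"
    by (intro cs.span_minimal) (auto simp: monYX_def intro!: B_mult B_power B_X B_Y)
qed

text \<open>
  The exponent of \<open>x\<close> is the least one for which the degree is divisible by \<open>m\<close>; the others are reached by
  multiplying with powers of \<open>x\<^sup>m\<close>.
\<close>

definition bL :: "nat \<Rightarrow> nat \<Rightarrow> ratfun endo" where "bL m j = opX ^ (j mod m) * opY ^ j"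
definition bR :: "nat \<Rightarrow> nat \<Rightarrow> ratfun endo" where "bR m j = opY ^ j * opX ^ (j mod m)"

lemma decompose_mod: "i mod m = j mod m \<Longrightarrow> i = j mod m + m * (i div m)" for i j m :: nat
  by (metis mod_mult_div_eq)

lemma cspan_deg0_left: "cs.span (monXY ` deg0 m) = ml.span m (range (bL m))"
proof
  have sub: "cs.subspace (ml.span m (range (bL m)))"
    unfolding cs.subspace_def
    using ml.span_scale[of _ m "range (bL m)" "[:c:]" for c] 
    by (auto simp: poly_op_const intro: ml.span_zero ml.span_add)
  show "cs.span (monXY ` deg0 m) \<subseteq> ml.span m (range (bL m))"
  proof (rule cs.span_minimal[OF _ sub], safe)
    fix i j assume "(i, j) \<in> deg0 m"
    then have i: "i = j mod m + m * (i div m)" by (intro decompose_mod) (simp add: deg0_def)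
    have "monXY (i, j) = opX ^ (m * (i div m) + j mod m) * opY ^ j"
      using i by (simp add: monXY_def add.commute)
    also have "\<dots> = poly_op m (Polynomial.monom 1 (i div m)) * bL m j"
      by (simp add: poly_op_monom bL_def opC_hom power_add mult.assoc)
    also have "\<dots> \<in> ml.span m (range (bL m))" by (intro ml.span_scale ml.span_base) simp
    finally show "monXY (i, j) \<in> ml.span m (range (bL m))" .
  qed
  show "ml.span m (range (bL m)) \<subseteq> cs.span (monXY ` deg0 m)"
  proof
    fix x assume "x \<in> ml.span m (range (bL m))"
    then show "x \<in> cs.span (monXY ` deg0 m)"
    proof (induction rule: ml.span_induct_alt[consumes 1, case_names base step])
      case base
      show ?case by (rule cs.span_zero)
    next
      case (step p x y)
      then obtain j where x: "x = bL m j" by blast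
      have "poly_op m p * x = (\<Sum>k\<le>degree p. opC (Polynomial.coeff p k) * monXY (m * k + j mod m, j))"
        by (simp add: x poly_op_expand sum_distrib_right bL_def monXY_def power_add mult.assoc)
      also have "\<dots> \<in> cs.span (monXY ` deg0 m)"
        by (intro cs.span_sum cs.span_scale cs.span_base imageI) (simp add: deg0_def)
      finally show ?case using step(2) by (rule cs.span_add)
    qed
  qed
qed

lemma cspan_deg0_right: "cs.span (monYX ` deg0 m) = mr.span m (range (bR m))"
proof
  have BT: "mr.span m (range (bR m)) \<subseteq> B"
    by (rule mr.span_minimal)
      (auto simp: bR_def mr.subspace_def intro!: B_mult B_power B_X B_Y B_0 B_add poly_op_B)
  have sub: "cs.subspace (mr.span m (range (bR m)))"
    unfolding cs.subspace_def
  proof (intro conjI allI ballI)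
    fix c x assume x: "x \<in> mr.span m (range (bR m))"
    then have "x * opC c = opC c * x" using BT by (intro opC_central) auto
    then show "opC c * x \<in> mr.span m (range (bR m))"
      using mr.span_scale[OF x, of "[:c:]"] by (simp add: poly_op_const)
  qed (auto intro: mr.span_zero mr.span_add)
  show "cs.span (monYX ` deg0 m) \<subseteq> mr.span m (range (bR m))"
  proof (rule cs.span_minimal[OF _ sub], safe)
    fix i j assume "(i, j) \<in> deg0 m"
    then have i: "i = j mod m + m * (i div m)" by (intro decompose_mod) (simp add: deg0_def)
    have "monYX (i, j) = opY ^ j * opX ^ (j mod m + m * (i div m))"
      using i by (simp add: monYX_def)
    also have "\<dots> = bR m j * poly_op m (Polynomial.monom 1 (i div m))"
      by (simp add: poly_op_monom bR_def opC_hom power_add mult.assoc)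
    also have "\<dots> \<in> mr.span m (range (bR m))" by (intro mr.span_scale mr.span_base) simp
    finally show "monYX (i, j) \<in> mr.span m (range (bR m))" .
  qed
  show "mr.span m (range (bR m)) \<subseteq> cs.span (monYX ` deg0 m)"
  proof
    fix x assume "x \<in> mr.span m (range (bR m))"
    then show "x \<in> cs.span (monYX ` deg0 m)"
    proof (induction rule: mr.span_induct_alt[consumes 1, case_names base step])
      case base
      show ?case by (rule cs.span_zero)
    next
      case (step p x y)
      then obtain j where x: "x = bR m j" by blast
      have c: "x * opC d = opC d * x" for d
        unfolding x bR_def by (intro opC_central B_mult B_power B_X B_Y)
      have "x * poly_op m p = (\<Sum>k\<le>degree p. (x * opC (Polynomial.coeff p k)) * opX ^ (m * k))"
        by (simp add: poly_op_expand sum_distrib_left mult.assoc)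
      also have "\<dots> = (\<Sum>k\<le>degree p. opC (Polynomial.coeff p k) * monYX (j mod m + m * k, j))"
        unfolding c by (simp add: x bR_def monYX_def power_add mult.assoc)
      also have "\<dots> \<in> cs.span (monYX ` deg0 m)"
        by (intro cs.span_sum cs.span_scale cs.span_base imageI) (simp add: deg0_def)
      finally show ?case using step(2) by (rule cs.span_add)
    qed
  qed
qed

lemma L_subspace: "ml.subspace m (L n)" "mr.subspace m (L n)"
  unfolding ml.subspace_def mr.subspace_def by (auto simp: poly_op_def intro: L_add L_lmult L_lmult_right)

lemma lead_bL: "\<exists>u. u \<noteq> 0 \<and> lead j (bL m j) u"
proof -
  obtain a where a: "a \<noteq> 0" "lead j (opY ^ j) a" using lead_Y_power by blast
  have "lead 0 (opX ^ (j mod m)) (Kt ^ (j mod m))"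
    unfolding opX_def lmult_power[symmetric] by (rule lead_lmult)
  from lead_mult[OF this a(2)] show ?thesis using a(1) by (intro exI[of _ "Kt ^ (j mod m) * a"]) (auto simp: bL_def)
qed

lemma lead_bR: "\<exists>u. u \<noteq> 0 \<and> lead j (bR m j) u"
proof -
  obtain a where a: "a \<noteq> 0" "lead j (opY ^ j) a" using lead_Y_power by blast
  have "lead 0 (opX ^ (j mod m)) (Kt ^ (j mod m))"
    unfolding opX_def lmult_power[symmetric] by (rule lead_lmult)
  from lead_mult[OF a(2) this] show ?thesis using a(1) by (intro exI[of _ "a * sh j (Kt ^ (j mod m))"]) (auto simp: bR_def)
qed

lemma poly_op_bL_zero: assumes "m > 0" "poly_op m c * bL m j \<in> L j" shows "c = 0"
proof -
  obtain u where u: "u \<noteq> 0" "lead j (bL m j) u" using lead_bL by blast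
  have "lead (0 + j) (poly_op m c * bL m j) (poly_to_ratfun (c \<circ>\<^sub>p Polynomial.monom 1 m) * sh 0 u)"
    unfolding poly_op_def by (rule lead_mult[OF lead_lmult u(2)])
  from lead_zero[OF this] assms u(1) show ?thesis
    by (simp add: pcompose_eq_0_iff degree_monom_eq)
qed

lemma poly_op_bR_zero: assumes "m > 0" "bR m j * poly_op m c \<in> L j" shows "c = 0"
proof -
  obtain u where u: "u \<noteq> 0" "lead j (bR m j) u" using lead_bR by blast
  have "lead (j + 0) (bR m j * poly_op m c) (u * sh j (poly_to_ratfun (c \<circ>\<^sub>p Polynomial.monom 1 m)))"
    unfolding poly_op_def by (rule lead_mult[OF u(2) lead_lmult])
  from lead_zero[OF this] assms u(1) show ?thesis
    by (simp add: pcompose_eq_0_iff degree_monom_eq)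
qed

lemma bL_L: "bL m j \<in> L (Suc j)" and bR_L: "bR m j \<in> L (Suc j)"
  using lead_bL[of j m] lead_bR[of j m] lead_L by blast+

lemma bL_coefficients_vanish:
  assumes "m > 0" "(\<Sum>j<N. poly_op m (c j) * bL m j) \<in> L n" "n \<le> j" "j < N"
  shows "c j = 0"
  by (rule filtered_coefficients_vanish[OF ml.module_axioms[of m], where L = L and b = "bL m" and N = N and n = n])
    (use assms L_subspace L_Suc bL_L poly_op_bL_zero in auto)

lemma bR_coefficients_vanish:
  assumes "m > 0" "(\<Sum>j<N. bR m j * poly_op m (c j)) \<in> L n" "n \<le> j" "j < N"
  shows "c j = 0"
  by (rule filtered_coefficients_vanish[OF mr.module_axioms[of m], where L = L and b = "bR m" and N = N and n = n])
    (use assms L_subspace L_Suc bR_L poly_op_bR_zero in auto)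

text \<open>
  The degree bound is what makes the invariants in a finite dimensional subspace finitely generated.
\<close>

lemma span_bL_L:
  assumes m: "m > 0" and x: "x \<in> ml.span m (range (bL m))" "x \<in> L n"
  shows "\<exists>c. x = (\<Sum>j<n. poly_op m (c j) * bL m j)"
proof -
  obtain N c where c: "x = (\<Sum>j<N. poly_op m (c j) * bL m j)" using ml.span_range_explicit[OF x(1)] by blast
  have z: "c j = 0" if "n \<le> j" "j < N" for j
    using bL_coefficients_vanish[OF m, of c N n j] c x(2) that by simp
  have "x = (\<Sum>j<n. poly_op m (if j < N then c j else 0) * bL m j)"
    unfolding c by (rule sum.mono_neutral_cong) (auto simp: z poly_op_hom not_less)
  then show ?thesis by (intro exI)
qed

lemma span_bR_L:
  assumes m: "m > 0" and x: "x \<in> mr.span m (range (bR m))" "x \<in> L n"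
  shows "\<exists>c. x = (\<Sum>j<n. bR m j * poly_op m (c j))"
proof -
  obtain N c where c: "x = (\<Sum>j<N. bR m j * poly_op m (c j))" using mr.span_range_explicit[OF x(1)] by blast
  have z: "c j = 0" if "n \<le> j" "j < N" for j
    using bR_coefficients_vanish[OF m, of c N n j] c x(2) that by simp
  have "x = (\<Sum>j<n. bR m j * poly_op m (if j < N then c j else 0))"
    unfolding c by (rule sum.mono_neutral_cong) (auto simp: z poly_op_hom not_less)
  then show ?thesis by (intro exI)
qed

end

section \<open>Automorphisms and their invariants\<close>

text \<open>
  Multiplication by \<open>a \<in> H\<close> permutes \<open>H\<close>, so comparing the products of all elements gives \<open>a\<^sup>h = 1\<close> with
  \<open>h = card H\<close>; and there are only \<open>h\<close> such numbers.
\<close>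

lemma finite_mult_closed_roots_of_unity:
  fixes H :: "complex set"
  assumes H: "finite H" "H \<noteq> {}" "0 \<notin> H" "\<And>x y. x \<in> H \<Longrightarrow> y \<in> H \<Longrightarrow> x * y \<in> H"
  shows "H = {z. z ^ card H = 1}"
proof (rule card_subset_eq)
  have pos: "card H > 0" using H by (simp add: card_gt_0_iff)
  show "finite {z::complex. z ^ card H = 1}" using pos by (intro finite_roots_unity) simp
  show "card H = card {z::complex. z ^ card H = 1}" using card_roots_unity_eq[OF pos] by simp
  show "H \<subseteq> {z. z ^ card H = 1}"
  proof safe
    fix a assume a: "a \<in> H"
    have inj: "inj_on ((*) a) H" using a H(3) by (auto simp: inj_on_def)
    have "(*) a ` H = H"
      using H(4)[OF a] card_image[OF inj] H(1) by (intro card_subset_eq) auto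
    then have "prod id H = prod id ((*) a ` H)" by simp
    also have "\<dots> = (\<Prod>h\<in>H. a * h)" by (simp add: prod.reindex[OF inj])
    also have "\<dots> = a ^ card H * prod id H" by (simp add: prod.distrib)
    finally have "(1 - a ^ card H) * prod id H = 0" by (simp add: algebra_simps)
    moreover have "prod id H \<noteq> 0" using H(1,3) by auto
    ultimately show "a ^ card H = 1" by simp
  qed
qed

lemma primitive_root_power_eq_iff:
  fixes m :: nat
  defines "\<alpha> \<equiv> cis (2 * pi / m)"
  assumes m: "m > 0"
  shows "\<alpha> ^ m = 1" "\<alpha> ^ i = \<alpha> ^ j \<longleftrightarrow> i mod m = j mod m"
proof -
  have pw: "\<alpha> ^ k = cis (2 * pi * real k / real m)" for k
    unfolding \<alpha>_def DeMoivre by (simp add: mult_ac)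
  show 1: "\<alpha> ^ m = 1" using m by (simp add: pw)
  have red: "\<alpha> ^ k = \<alpha> ^ (k mod m)" for k
  proof -
    have "\<alpha> ^ k = \<alpha> ^ (m * (k div m) + k mod m)" by simp
    then show ?thesis unfolding power_add power_mult 1 by simp
  qed
  have "inj_on (\<lambda>k. cis (2 * pi * real k / real m)) {..<m}"
    using bij_betw_roots_unity[OF m] by (simp add: bij_betw_def)
  then have "\<alpha> ^ (i mod m) = \<alpha> ^ (j mod m) \<longleftrightarrow> i mod m = j mod m"
    using m unfolding pw by (auto dest: inj_onD)
  then show "\<alpha> ^ i = \<alpha> ^ j \<longleftrightarrow> i mod m = j mod m" using red by metis
qed

context qparam
begin

lemma opX_opZ: "opX * opZ = opC (inverse q) * (opZ * opX)"
  unfolding opZ_opX using opC_inverse(2)[OF q_nonzero] by (simp add: mult.assoc[symmetric])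

lemma opZ_normal: "b \<in> B \<Longrightarrow> \<exists>b'\<in>B. b * opZ = opZ * b'"
proof (induction rule: B.induct)
  case (B_C c)
  then show ?case by (intro bexI[of _ "opC c"]) (auto simp: opZ_opC intro: B.B_C)
next
  case B_X
  have "opX * opZ = opZ * (opC (inverse q) * opX)"
    unfolding opX_opZ using opZ_opC by (simp flip: mult.assoc)
  then show ?case by (intro bexI[of _ "opC (inverse q) * opX"]) (auto intro: B.intros)
next
  case B_Y
  have "opY * opZ = opZ * (opC q * opY)"
    unfolding opY_opZ using opZ_opC by (simp flip: mult.assoc)
  then show ?case by (intro bexI[of _ "opC q * opY"]) (auto intro: B.intros)
next
  case (B_add a b)
  then obtain a' b' where "a' \<in> B" "b' \<in> B" "a * opZ = opZ * a'" "b * opZ = opZ * b'" by blast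
  then show ?case by (intro bexI[of _ "a' + b'"]) (auto simp: algebra_simps intro: B.B_add)
next
  case (B_mult a b)
  then obtain a' b' where *: "a' \<in> B" "b' \<in> B" "a * opZ = opZ * a'" "b * opZ = opZ * b'" by blast
  have "a * b * opZ = (a * opZ) * b'" using *(4) by (simp add: mult.assoc)
  then show ?case using * by (intro bexI[of _ "a' * b'"]) (auto simp: mult.assoc intro: B.B_mult)
qed

text \<open>
  A commutator is a derivation in each argument and \<open>Z B\<close> is a two-sided ideal, so it suffices to check the
  generators.
\<close>

lemma commutator_extend:
  assumes "\<exists>c\<in>B. a * opX - opX * a = opZ * c" "\<exists>c\<in>B. a * opY - opY * a = opZ * c" "a \<in> B" "b \<in> B"
  shows "\<exists>c\<in>B. a * b - b * a = opZ * c"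
  using assms(4)
proof (induction rule: B.induct)
  case (B_C c)
  show ?case using opC_central[OF assms(3)] by (intro bexI[of _ 0]) (auto intro: B_0)
next
  case (B_add b d)
  then obtain c e where "c \<in> B" "e \<in> B" "a * b - b * a = opZ * c" "a * d - d * a = opZ * e" by blast
  then show ?case by (intro bexI[of _ "c + e"]) (auto simp: algebra_simps intro: B.B_add)
next
  case (B_mult b d)
  then obtain c e where *: "c \<in> B" "e \<in> B" "a * b - b * a = opZ * c" "a * d - d * a = opZ * e" by blast
  obtain b' where b': "b' \<in> B" "b * opZ = opZ * b'" using opZ_normal[OF B_mult(1)] by blast
  have "a * (b * d) - b * d * a = (a * b - b * a) * d + b * (a * d - d * a)"
    by (simp add: algebra_simps)
  also have "\<dots> = opZ * (c * d + b' * e)"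
    unfolding * using b' by (simp add: distrib_left flip: mult.assoc)
  finally show ?case using * b' B_mult by (intro bexI[of _ "c * d + b' * e"]) (auto intro: B.intros)
qed (use assms in auto)

lemma commutator_in_opZ_B:
  assumes "a \<in> B" "b \<in> B" shows "\<exists>c\<in>B. a * b - b * a = opZ * c"
proof -
  have YX: "opY * opX - opX * opY = opZ"
    unfolding opY_opX opZ_eq by (simp add: opC_hom algebra_simps)
  have X: "\<exists>c\<in>B. opX * b - b * opX = opZ * c" if "b \<in> B" for b
  proof (rule commutator_extend[OF _ _ B_X that])
    show "\<exists>c\<in>B. opX * opX - opX * opX = opZ * c" by (intro bexI[of _ 0]) (auto intro: B_0)
    show "\<exists>c\<in>B. opX * opY - opY * opX = opZ * c"
      using YX by (intro bexI[of _ "- 1"]) (auto intro: B_1 B_uminus simp: algebra_simps)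
  qed
  have Y: "\<exists>c\<in>B. opY * b - b * opY = opZ * c" if "b \<in> B" for b
  proof (rule commutator_extend[OF _ _ B_Y that])
    show "\<exists>c\<in>B. opY * opY - opY * opY = opZ * c" by (intro bexI[of _ 0]) (auto intro: B_0)
    show "\<exists>c\<in>B. opY * opX - opX * opY = opZ * c"
      using YX by (intro bexI[of _ 1]) (auto intro: B_1)
  qed
  have neg: "\<exists>c\<in>B. x - y = opZ * c" if h: "\<exists>c\<in>B. y - x = opZ * c" for x y
  proof -
    obtain c where "c \<in> B" "y - x = opZ * c" using h by blast
    then show ?thesis by (intro bexI[of _ "- c"]) (auto intro: B_uminus simp: algebra_simps)
  qed
  show ?thesis
    by (rule commutator_extend[OF neg[OF X[OF assms(1)]] neg[OF Y[OF assms(1)]] assms])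
qed

lemma B_in_L: "b \<in> B \<Longrightarrow> \<exists>n. b \<in> L n"
proof (induction rule: B.induct)
  case (B_C c)
  show ?case using lead_L[OF lead_lmult, of "Kc c"] by (auto simp: opC_def)
next
  case B_X
  show ?case using lead_L[OF lead_lmult, of Kt] by (auto simp: opX_def)
next
  case B_Y
  show ?case using lead_L[OF lead_Y] by blast
next
  case (B_add a b)
  then obtain n k where "a \<in> L n" "b \<in> L k" by blast
  then have "a \<in> L (max n k)" "b \<in> L (max n k)" using L_mono[of n "max n k"] L_mono[of k "max n k"] by auto
  then show ?case using L_add by blast
next
  case (B_mult a b)
  then obtain n k where "a \<in> L n" "b \<in> L k" by blast
  then show ?case using L_mult[of a n b k] L_Suc by blast
qed

lemma B_lead: "b \<in> B \<Longrightarrow> b \<noteq> 0 \<Longrightarrow> \<exists>n a. lead n b a \<and> a \<noteq> 0"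
  using B_in_L lead_nonzero_exists by blast

text \<open>
  The case \<open>m = 1\<close> of the degree bound.
\<close>

lemma B_L_normal_form:
  assumes "b \<in> B" "b \<in> L n"
  shows "\<exists>c. b = (\<Sum>j<n. poly_op 1 (c j) * opY ^ j)"
proof -
  have "deg0 1 = UNIV" by (auto simp: deg0_def)
  then have "b \<in> ml.span 1 (range (bL 1))"
    using assms(1) unfolding B_eq_monXY cspan_deg0_left[symmetric] by simp
  from span_bL_L[OF _ this assms(2)] show ?thesis by (simp add: bL_def)
qed

lemma poly_op_1: "poly_op 1 p = lmult (poly_to_ratfun p)"
proof -
  have "Polynomial.monom (1::complex) 1 = [:0, 1:]" by (simp add: monom_altdef)
  then show ?thesis unfolding poly_op_def by simp
qed

text \<open>
  Degrees of a unit and its inverse add up to zero, so both are polynomials in \<open>t\<close>.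
\<close>

lemma B_unit_scalar:
  assumes "u \<in> B" "v \<in> B" "u * v = 1"
  shows "\<exists>c. c \<noteq> 0 \<and> u = opC c"
proof -
  have "u \<noteq> 0" "v \<noteq> 0" using assms(3) by auto
  then obtain n a k c where lead: "lead n u a" "a \<noteq> 0" "lead k v c" "c \<noteq> 0"
    using B_lead assms by meson
  have "lead (n + k) 1 (a * sh n c)" using lead_mult[OF lead(1,3)] assms(3) by simp
  moreover have "lead 0 1 1" using lead_lmult[of 1] by (simp add: lmult_hom)
  ultimately have "n + k = 0" using lead by (intro lead_degree_unique[of "n + k" 1 "a * sh n c" 0 1]) auto
  then have "u \<in> L 1" "v \<in> L 1" using lead_L[OF lead(1)] lead_L[OF lead(3)] by auto
  then obtain p r where pr: "u = poly_op 1 p" "v = poly_op 1 r"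
    using B_L_normal_form[OF assms(1), of 1] B_L_normal_form[OF assms(2), of 1] by auto
  have "poly_op 1 (p * r) = poly_op 1 1" using assms(3) unfolding pr by (simp add: poly_op_hom)
  then have "p * r = 1" unfolding poly_op_1 by simp
  then have "p dvd 1" by (metis dvdI)
  then obtain c where "p = [:c:]" "c dvd 1" by (auto simp: is_unit_poly_iff)
  moreover from this have "c \<noteq> 0" by auto
  ultimately have "\<exists>c. c \<noteq> 0 \<and> p = [:c:]" by blast
  then show ?thesis unfolding pr(1) by (auto simp: poly_op_const)
qed

text \<open>
  An algebra automorphism of \<open>B\<close>, extended arbitrarily to the other operators.
\<close>

definition is_aut :: "(ratfun endo \<Rightarrow> ratfun endo) \<Rightarrow> bool" where
  "is_aut g \<longleftrightarrow> bij_betw g B B \<and> (\<forall>a\<in>B. \<forall>b\<in>B. g (a + b) = g a + g b \<and> g (a * b) = g a * g b) \<and>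
     (\<forall>c. g (opC c) = opC c)"

lemma is_autD:
  assumes "is_aut g"
  shows "a \<in> B \<Longrightarrow> g a \<in> B" "a \<in> B \<Longrightarrow> b \<in> B \<Longrightarrow> g (a + b) = g a + g b"
    "a \<in> B \<Longrightarrow> b \<in> B \<Longrightarrow> g (a * b) = g a * g b" "g (opC c) = opC c" "g 0 = 0" "g 1 = 1"
  using assms opC_hom(1,2) unfolding is_aut_def by (metis bij_betwE)+

lemma is_aut_inverse:
  assumes g: "is_aut g" shows "is_aut (inv_into B g)" "b \<in> B \<Longrightarrow> g (inv_into B g b) = b"
proof -
  have bij: "bij_betw g B B" using g by (simp add: is_aut_def)
  let ?h = "inv_into B g"
  have h: "bij_betw ?h B B" using bij by (rule bij_betw_inv_into)
  have gh: "g (?h b) = b" if "b \<in> B" for b using bij that by (rule bij_betw_inv_into_right)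
  have hg: "?h (g b) = b" if "b \<in> B" for b using bij that by (rule bij_betw_inv_into_left)
  have hB: "?h b \<in> B" if "b \<in> B" for b using bij_betwE[OF h] that by blast
  have "?h (a + b) = ?h a + ?h b" "?h (a * b) = ?h a * ?h b" if "a \<in> B" "b \<in> B" for a b
  proof -
    have "a + b = g (?h a + ?h b)" "a * b = g (?h a * ?h b)"
      using that by (simp_all add: is_autD(2,3)[OF g] hB gh)
    then show "?h (a + b) = ?h a + ?h b" "?h (a * b) = ?h a * ?h b"
      using hg B_add[OF hB hB] B_mult[OF hB hB] that by metis+
  qed
  moreover have "?h (opC c) = opC c" for c using hg[OF B_C, of c] by (simp add: is_autD(4)[OF g])
  ultimately show "is_aut ?h" using h by (simp add: is_aut_def)
  show "g (?h b) = b" if "b \<in> B" using gh that .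
qed

text \<open>
  Being a commutator, \<open>Z\<close> is sent by each automorphism into \<open>Z B\<close>.  Applying this to \<open>g\<close> and its inverse shows that
  \<open>g(Z) = Z u\<close> with \<open>u\<close> a unit.
\<close>

lemma aut_opZ: assumes g: "is_aut g" shows "\<exists>c. c \<noteq> 0 \<and> g opZ = opC c * opZ"
proof -
  have *: "\<exists>u\<in>B. g opZ = opZ * u" if g: "is_aut g" for g
  proof -
    have YX: "opZ + opX * opY = opY * opX"
      unfolding opY_opX opZ_eq by (simp add: opC_hom algebra_simps)
    have "g opZ + g opX * g opY = g (opZ + opX * opY)"
      by (simp add: is_autD[OF g] B_Z B_X B_Y B_mult)
    also have "\<dots> = g opY * g opX" unfolding YX by (simp add: is_autD[OF g] B_X B_Y)
    finally have "g opZ = g opY * g opX - g opX * g opY" by (simp add: algebra_simps)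
    then show ?thesis using commutator_in_opZ_B[of "g opY" "g opX"] is_autD(1)[OF g] B_X B_Y by simp
  qed
  obtain u where u: "u \<in> B" "g opZ = opZ * u" using *[OF g] by blast
  let ?h = "inv_into B g"
  obtain v where v: "v \<in> B" "?h opZ = opZ * v" using *[OF is_aut_inverse(1)[OF g]] by blast
  have "opZ = g (opZ * v)" using is_aut_inverse(2)[OF g B_Z] v by simp
  also have "\<dots> = opZ * (u * g v)" using u v by (simp add: is_autD[OF g] B_Z mult.assoc)
  finally have "opZinv * opZ = opZinv * opZ * (u * g v)" by (simp only: mult.assoc)
  then have "u * g v = 1" by simp
  then obtain c where "c \<noteq> 0" "u = opC c" using B_unit_scalar[OF u(1) is_autD(1)[OF g v(1)]] by blast
  then show ?thesis using u opZ_opC by auto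
qed

lemma apply_gam_1: "endo_apply (poly_op 1 p) f = poly_to_ratfun p * f"
  unfolding poly_op_1 by simp

lemma apply_opY_values: "endo_apply opY 1 = 0" "endo_apply opY Kt = 1" "endo_apply opY (Kc c * Kt) = Kc c"
proof -
  show "endo_apply opY 1 = 0" by (simp add: apply_Y sh_hom)
  have "Kc q * Kt - Kt = Kc (q - 1) * Kt" by (simp add: Kc_hom algebra_simps)
  then show *: "endo_apply opY Kt = 1" by (simp add: apply_Y sh_Kt q_neq_1)
  have "Kc q * (Kc c * Kt) - Kc c * Kt = Kc (q - 1) * Kt * Kc c" by (simp add: Kc_hom algebra_simps)
  then show "endo_apply opY (Kc c * Kt) = Kc c"
    by (simp add: apply_Y sh_Kt sh_hom q_neq_1 mult.left_commute)
qed

text \<open>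
  Comparison of coefficients in \<open>a p(q t) = b p(t)\<close>.
\<close>

lemma sh_1_poly_eigen:
  assumes "sh 1 (poly_to_ratfun p) * Kc a = Kc b * poly_to_ratfun p"
  shows "q ^ i * Polynomial.coeff p i * a = b * Polynomial.coeff p i"
proof -
  have "poly_to_ratfun (smult a (p \<circ>\<^sub>p [:0, q:])) = poly_to_ratfun (smult b p)"
    using assms unfolding sh_poly by (simp flip: poly_to_ratfun_hom add: mult.commute)
  then have "smult a (p \<circ>\<^sub>p [:0, q:]) = smult b p" by simp
  then have "Polynomial.coeff (smult a (p \<circ>\<^sub>p [:0, q:])) i = Polynomial.coeff (smult b p) i" by simp
  then show ?thesis by (simp add: coeff_pcompose_linear mult_ac)
qed

text \<open>
  With \<open>a = g(x)\<close>, \<open>b = g(y)\<close> and \<open>g(Z) = \<lambda> Z\<close>, applying \<open>g\<close> to \<open>Z x = q x Z\<close>, \<open>y Z = q Z y\<close> and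
  \<open>Z = 1 + (q - 1) x y\<close> gives \<open>Z a = q a Z\<close>, \<open>b Z = q Z b\<close> and \<open>\<lambda> Z = 1 + (q - 1) a b\<close>.  The last equation has degree
  one, so one of \<open>a\<close>, \<open>b\<close> has degree zero, that is, it is a polynomial in \<open>t\<close>.  For \<open>b\<close> this is impossible,
  as no nonzero polynomial satisfies \<open>q b(q t) = b(t)\<close>.  Hence \<open>a\<close> is a polynomial and \<open>b = c\<^sub>0 + c\<^sub>1 y\<close> with
  polynomials \<open>c\<^sub>0\<close>, \<open>c\<^sub>1\<close>, and the eigenvalue equations determine them up to scalars.
\<close>

theorem aut_form:
  assumes g: "is_aut g"
  shows "\<exists>c. c \<noteq> 0 \<and> g opX = opC c * opX \<and> g opY = opC (inverse c) * opY"
proof -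
  define a where "a = g opX"
  define b where "b = g opY"
  have aB: "a \<in> B" and bB: "b \<in> B" unfolding a_def b_def by (intro is_autD[OF g] B_X B_Y)+
  obtain l where l: "l \<noteq> 0" "g opZ = opC l * opZ" using aut_opZ[OF g] by blast
  have canc: "x = y" if "opC l * x = opC l * y" for x y
  proof -
    have "opC (inverse l) * opC l * x = opC (inverse l) * opC l * y" using that by (simp add: mult.assoc)
    then show ?thesis using opC_inverse(2)[OF l(1)] by simp
  qed
  have Za: "opZ * a = opC q * a * opZ"
  proof (rule canc)
    have "g (opZ * opX) = g (opC q * opX * opZ)" by (simp add: opZ_opX)
    then have "opC l * opZ * a = opC q * a * (opC l * opZ)"
      by (simp add: is_autD[OF g] B_Z B_X B_C B_mult l a_def)
    also have "\<dots> = opC q * (a * opC l) * opZ" by (simp add: mult.assoc)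
    also have "\<dots> = opC l * (opC q * a * opZ)"
      unfolding opC_central[OF aB] using opC_commute(3)[of q l] by (simp flip: mult.assoc)
    finally show "opC l * (opZ * a) = opC l * (opC q * a * opZ)" by (simp add: mult.assoc)
  qed
  have bZ: "b * opZ = opC q * opZ * b"
  proof (rule canc)
    have "g (opY * opZ) = g (opC q * opZ * opY)" by (simp add: opY_opZ)
    then have "b * (opC l * opZ) = opC q * (opC l * opZ) * b"
      by (simp add: is_autD[OF g] B_Z B_Y B_C B_mult l b_def)
    moreover have "b * (opC l * opZ) = opC l * (b * opZ)"
      using opC_central[OF bB, of l] by (simp flip: mult.assoc)
    moreover have "opC q * (opC l * opZ) * b = opC l * (opC q * opZ * b)"
      using opC_commute(3)[of q l] by (simp flip: mult.assoc)
    ultimately show "opC l * (b * opZ) = opC l * (opC q * opZ * b)" by simp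
  qed
  have ab: "opC l * opZ = 1 + opC (q - 1) * (a * b)"
  proof -
    have "g opZ = g (1 + opC (q - 1) * opX * opY)" by (simp flip: opZ_eq)
    then show ?thesis
      by (simp add: l is_autD[OF g] B_X B_Y B_C B_mult B_1 a_def b_def mult.assoc)
  qed
  have "opC (q - 1) * (a * b) - lmult (Kc l) * opZ ^ 1 = lmult (-1) * opZ ^ 0"
    using ab by (simp add: opC_def lmult_hom algebra_simps)
  then have leadab: "lead 1 (opC (q - 1) * (a * b)) (Kc l)"
    unfolding lead_def using L_term[of "-1" 0] by simp
  have "a * b \<noteq> 0" using lead_zero[OF leadab] l(1) by auto
  then have "a \<noteq> 0" "b \<noteq> 0" by auto
  then obtain n a' k b' where lead: "lead n a a'" "a' \<noteq> 0" "lead k b b'" "b' \<noteq> 0"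
    using B_lead aB bB by meson
  have "lead (0 + (n + k)) (opC (q - 1) * (a * b)) (Kc (q - 1) * sh 0 (a' * sh n b'))"
    unfolding opC_def by (intro lead_mult lead lead_lmult)
  from lead_degree_unique[OF this _ leadab] lead l(1) have nk: "n + k = 1" by (simp add: q_neq_1)
  \<comment> \<open>Otherwise the degree of b is zero, and the value at 1 of the equation for b leads to b = 0.\<close>
  have n0: "n = 0"
  proof (rule ccontr)
    assume "n \<noteq> 0"
    then have "k = 0" using nk by simp
    then have "b \<in> L 1" using lead_L[OF lead(3)] by simp
    then obtain r where r: "b = poly_op 1 r" using B_L_normal_form[OF bB, of 1] by auto
    have "endo_apply (b * opZ) 1 = endo_apply (opC q * opZ * b) 1" by (simp add: bZ)
    then have "sh 1 (poly_to_ratfun r) * Kc q = Kc 1 * poly_to_ratfun r"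
      unfolding r by (simp add: apply_gam_1 apply_Z sh_hom opC_def Kc_hom mult.commute del: One_nat_def)
    from sh_1_poly_eigen[OF this] have *: "(q ^ Suc i - 1) * Polynomial.coeff r i = 0" for i
      by (simp add: algebra_simps)
    have "Polynomial.coeff r i = 0" for i using *[of i] q_power[of "Suc i"] by simp
    then have "r = 0" by (simp add: poly_eq_iff)
    then show False using \<open>b \<noteq> 0\<close> r by (simp add: poly_op_hom)
  qed
  then have "a \<in> L 1" using lead_L[OF lead(1)] by simp
  then obtain p where p: "a = poly_op 1 p" using B_L_normal_form[OF aB, of 1] by auto
  have "endo_apply (opZ * a) 1 = endo_apply (opC q * a * opZ) 1" by (simp add: Za)
  then have "sh 1 (poly_to_ratfun p) * Kc 1 = Kc q * poly_to_ratfun p"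
    unfolding p by (simp add: apply_gam_1 apply_Z sh_hom opC_def Kc_hom del: One_nat_def)
  from sh_1_poly_eigen[OF this] have *: "(q ^ i - q ^ 1) * Polynomial.coeff p i = 0" for i
    by (simp add: algebra_simps)
  have "Polynomial.coeff p i = 0" if "i \<noteq> 1" for i
    using *[of i] that q_power_eq[of i 1] by auto
  then have "p = Polynomial.monom (Polynomial.coeff p 1) 1" by (auto simp: poly_eq_iff)
  then have "a = opC (Polynomial.coeff p 1) * opX"
    unfolding p using poly_op_monom[of 1 "Polynomial.coeff p 1" 1] by simp
  then obtain \<alpha> where \<alpha>: "a = opC \<alpha> * opX" by blast
  have "k = 1" using n0 nk by simp
  then have "b \<in> L 2" using lead_L[OF lead(3)] by (simp add: numeral_2_eq_2)
  then obtain c where "b = (\<Sum>j<2. poly_op 1 (c j) * opY ^ j)" using B_L_normal_form[OF bB, of 2] by blast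
  then have b: "b = poly_op 1 (c 0) + poly_op 1 (c 1) * opY" by (simp add: numeral_2_eq_2)
  have "endo_apply (b * opZ) 1 = endo_apply (opC q * opZ * b) 1" by (simp add: bZ)
  then have "sh 1 (poly_to_ratfun (c 0)) * Kc q = Kc 1 * poly_to_ratfun (c 0)"
    unfolding b by (simp add: apply_gam_1 apply_Z apply_opY_values sh_hom opC_def Kc_hom mult.commute del: One_nat_def)
  from sh_1_poly_eigen[OF this] have *: "(q ^ Suc i - 1) * Polynomial.coeff (c 0) i = 0" for i
    by (simp add: algebra_simps)
  have "Polynomial.coeff (c 0) i = 0" for i using *[of i] q_power[of "Suc i"] by simp
  then have "c 0 = 0" by (simp add: poly_eq_iff)
  then have b: "b = poly_op 1 (c 1) * opY" using b by (simp add: poly_op_hom)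
  have "endo_apply (b * opZ) Kt = endo_apply (opC q * opZ * b) Kt" by (simp add: bZ)
  then have "Kc q * (sh 1 (poly_to_ratfun (c 1)) * Kc 1) = Kc q * (Kc 1 * poly_to_ratfun (c 1))"
    unfolding b by (auto simp: apply_gam_1 apply_Z apply_opY_values sh_hom opC_def Kc_hom sh_Kt mult.commute simp del: One_nat_def)
  then have "sh 1 (poly_to_ratfun (c 1)) * Kc 1 = Kc 1 * poly_to_ratfun (c 1)"
    using q_nonzero by simp
  from sh_1_poly_eigen[OF this] have *: "(q ^ i - 1) * Polynomial.coeff (c 1) i = 0" for i
    by (simp add: algebra_simps)
  have *: "Polynomial.coeff (c 1) i = 0" if "i > 0" for i using *[of i] q_power[of i] that by simp
  have "c 1 = [:Polynomial.coeff (c 1) 0:]"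
    using * by (auto simp: poly_eq_iff coeff_pCons split: nat.splits)
  then obtain \<beta> where "c 1 = [:\<beta>:]" by blast
  then have \<beta>: "b = opC \<beta> * opY" using b by (simp add: poly_op_const)
  have "g (opY * opX) = g (opC q * opX * opY + 1)" by (simp add: opY_opX)
  then have "b * a = opC q * a * b + 1"
    by (simp add: is_autD[OF g] B_X B_Y B_C B_mult B_1 a_def b_def)
  moreover have "b * a = opC (\<alpha> * \<beta>) * (opY * opX)"
  proof -
    have "b * a = opC \<beta> * (opY * opC \<alpha>) * opX" unfolding \<alpha> \<beta> by (simp add: mult.assoc)
    also have "\<dots> = opC (\<beta> * \<alpha>) * (opY * opX)" by (simp only: opC_commute(1,2) opC_hom(5) mult.assoc)
    finally show ?thesis by (simp only: mult.commute[of \<beta> \<alpha>])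
  qed
  moreover have "opC q * a * b = opC (\<alpha> * \<beta>) * (opC q * opX * opY)"
  proof -
    have "opC q * a * b = opC q * opC \<alpha> * (opX * opC \<beta>) * opY" unfolding \<alpha> \<beta> by (simp add: mult.assoc)
    also have "\<dots> = opC (q * \<alpha> * \<beta>) * (opX * opY)" by (simp only: opC_commute(1,2) opC_hom(5) mult.assoc)
    also have "q * \<alpha> * \<beta> = \<alpha> * \<beta> * q" by simp
    finally show ?thesis by (simp only: opC_hom(5) mult.assoc)
  qed
  ultimately have "opC (\<alpha> * \<beta>) = opC 1"
    unfolding opY_opX by (simp add: distrib_left opC_hom(2))
  then have "\<alpha> * \<beta> = 1" by simp
  then have "\<alpha> \<noteq> 0" "\<beta> = inverse \<alpha>" by (auto simp: inverse_unique)
  then show ?thesis using \<alpha> \<beta> unfolding a_def b_def by blast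
qed

lemma aut_monomials:
  assumes g: "is_aut g" and c: "c \<noteq> 0" "g opX = opC c * opX" "g opY = opC (inverse c) * opY"
  shows "g (monXY (i, j)) = opC (c ^ i * inverse c ^ j) * monXY (i, j)"
    and "g (monYX (i, j)) = opC (c ^ i * inverse c ^ j) * monYX (i, j)"
proof -
  have X: "g (opX ^ i) = opC (c ^ i) * opX ^ i" for i
  proof (induction i)
    case (Suc i)
    have "g (opX ^ Suc i) = opC c * (opX * opC (c ^ i)) * opX ^ i"
      using Suc by (simp add: is_autD[OF g] B_X B_power c mult.assoc)
    then show ?case by (simp only: opC_commute(1,2) opC_hom(5) mult.assoc power_Suc)
  qed (simp add: is_autD[OF g] opC_hom)
  have Y: "g (opY ^ j) = opC (inverse c ^ j) * opY ^ j" for j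
  proof (induction j)
    case (Suc j)
    have "g (opY ^ Suc j) = opC (inverse c) * (opY * opC (inverse c ^ j)) * opY ^ j"
      using Suc by (simp add: is_autD[OF g] B_Y B_power c mult.assoc)
    then show ?case by (simp only: opC_commute(1,2) opC_hom(5) mult.assoc power_Suc)
  qed (simp add: is_autD[OF g] opC_hom)
  have cX: "opX ^ i * opC d = opC d * opX ^ i" and cY: "opY ^ j * opC d = opC d * opY ^ j" for d
    by (intro opC_central B_power B_X B_Y)+
  have "g (monXY (i, j)) = opC (c ^ i) * (opX ^ i * opC (inverse c ^ j)) * opY ^ j"
    by (simp add: monXY_def is_autD[OF g] B_X B_Y B_power X Y mult.assoc)
  then show "g (monXY (i, j)) = opC (c ^ i * inverse c ^ j) * monXY (i, j)"
    by (simp only: monXY_def cX opC_hom(5) mult.assoc prod.case)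
  have "g (monYX (i, j)) = opC (inverse c ^ j) * (opY ^ j * opC (c ^ i)) * opX ^ i"
    by (simp add: monYX_def is_autD[OF g] B_X B_Y B_power X Y mult.assoc)
  also have "\<dots> = opC (inverse c ^ j * c ^ i) * monYX (i, j)"
    by (simp only: monYX_def cY opC_hom(5) mult.assoc prod.case)
  finally show "g (monYX (i, j)) = opC (c ^ i * inverse c ^ j) * monYX (i, j)"
    by (simp only: mult.commute[of "inverse c ^ j"])
qed

lemma aut_iterate:
  assumes g: "is_aut g"
  shows "a \<in> B \<Longrightarrow> (g ^^ k) a \<in> B"
    "a \<in> B \<Longrightarrow> b \<in> B \<Longrightarrow> (g ^^ k) (opC c * a + b) = opC c * (g ^^ k) a + (g ^^ k) b"
proof -
  show B: "(g ^^ k) a \<in> B" if "a \<in> B" for a k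
    using that by (induction k) (auto simp: is_autD[OF g])
  show "(g ^^ k) (opC c * a + b) = opC c * (g ^^ k) a + (g ^^ k) b" if "a \<in> B" "b \<in> B"
    using that by (induction k) (auto simp: is_autD[OF g] B B_C B_mult)
qed

text \<open>
  The sum of all \<open>g\<^sup>k\<close> with \<open>k < m\<close> multiplies an invariant element by \<open>m\<close> and kills each \<open>v p\<close> with
  eigenvalue different from one, since the powers of a nontrivial \<open>m\<close>-th root of unity sum to zero.
\<close>

lemma average_eigenvectors:
  fixes v :: "nat \<times> nat \<Rightarrow> ratfun endo"
  assumes g: "is_aut g" and v: "B = cs.span (range v)" "\<And>p. g (v p) = opC (\<omega> p) * v p"
    and \<omega>: "\<And>p. \<omega> p ^ m = 1" "m > 0" and b: "b \<in> B" "g b = b"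
  shows "b \<in> cs.span (v ` {p. \<omega> p = 1})"
proof -
  let ?T = "cs.span (v ` {p. \<omega> p = 1})"
  have vB: "v p \<in> B" for p unfolding v(1) by (rule cs.span_base) simp
  have gv: "(g ^^ k) (v p) = opC (\<omega> p ^ k) * v p" for k p
    by (induction k) (auto simp: opC_hom v(2) is_autD[OF g] B_C vB mult.assoc[symmetric] opC_commute(3))
  have "x \<in> B \<and> (\<Sum>k<m. (g ^^ k) x) \<in> ?T" if "x \<in> cs.span (range v)" for x
    using that
  proof (induction rule: cs.span_induct_alt)
    case base
    have "(g ^^ k) 0 = 0" for k by (induction k) (auto simp: is_autD[OF g])
    then show ?case by (simp add: cs.span_zero B_0)
  next
    case (step c x y)
    then obtain p where x: "x = v p" by blast
    have "y \<in> B" using step by simp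
    have xB: "opC c * x + y \<in> B" using step x by (auto intro: B_add B_mult B_C vB)
    have "(\<Sum>k<m. (g ^^ k) (opC c * x + y)) = opC c * (opC (\<Sum>k<m. \<omega> p ^ k) * v p) + (\<Sum>k<m. (g ^^ k) y)"
    proof -
      have "opC (\<Sum>k\<in>K. \<omega> p ^ k) = (\<Sum>k\<in>K. opC (\<omega> p ^ k))" if "finite K" for K
        using that by (induction K) (auto simp: opC_hom)
      then show ?thesis using \<open>y \<in> B\<close>
        by (simp add: aut_iterate[OF g] x vB gv sum.distrib sum_distrib_left sum_distrib_right)
    qed
    also have "\<dots> \<in> ?T"
    proof (rule cs.span_add[OF cs.span_scale])
      show "(\<Sum>k<m. (g ^^ k) y) \<in> ?T" using step by simp
      show "opC (\<Sum>k<m. \<omega> p ^ k) * v p \<in> ?T"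
      proof (cases "\<omega> p = 1")
        case True
        then show ?thesis by (intro cs.span_scale cs.span_base) simp
      next
        case False
        then have "(\<Sum>k<m. \<omega> p ^ k) = 0" using \<omega>(1)[of p] by (simp add: geometric_sum)
        then show ?thesis by (simp add: opC_hom cs.span_zero)
      qed
    qed
    finally show ?case using xB by simp
  qed
  then have "(\<Sum>k<m. (g ^^ k) b) \<in> ?T" using b v(1) by simp
  moreover have "(g ^^ k) b = b" for k by (induction k) (auto simp: b)
  moreover have "(\<Sum>k<m. b) = opC (of_nat m) * b"
    by (induction m) (auto simp: opC_hom algebra_simps)
  ultimately have "opC (of_nat m) * b \<in> ?T" by simp
  from cs.span_scale[OF this, of "inverse (of_nat m)"] show ?thesis
    using \<omega>(2) opC_inverse(2)[of "of_nat m"] by (simp flip: mult.assoc)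
qed

text \<open>
  The automorphism of a primitive \<open>m\<close>-th root of unity fixes \<open>x\<^sup>i y\<^sup>j\<close> exactly if \<open>i \<equiv> j\<close> modulo \<open>m\<close>.
\<close>

theorem invariants_of_root_group:
  assumes m: "m > 0" and G: "\<And>g. g \<in> G \<Longrightarrow> is_aut g"
    and ch: "\<And>g. g \<in> G \<Longrightarrow> g opX = opC (\<chi> g) * opX \<and> g opY = opC (inverse (\<chi> g)) * opY"
    and im: "\<chi> ` G = {z. z ^ m = 1}"
  shows "{b \<in> B. \<forall>g\<in>G. g b = b} = cs.span (monXY ` deg0 m)"
    and "{b \<in> B. \<forall>g\<in>G. g b = b} = cs.span (monYX ` deg0 m)"
proof -
  let ?I = "{b \<in> B. \<forall>g\<in>G. g b = b}"
  have nz: "z \<noteq> 0" if "z ^ m = 1" for z :: complex using that m by (auto simp: power_0_left)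
  have ratio: "z ^ i * inverse z ^ j = 1 \<longleftrightarrow> z ^ i = z ^ j" if "z ^ m = 1" for z :: complex and i j
    using nz[OF that] by (simp add: field_simps)
  have sub: "cs.subspace ?I"
    unfolding cs.subspace_def by (auto intro: B_0 B_add B_C B_mult simp: B_C is_autD[OF G])
  have mon: "g (monXY p) = monXY p" "g (monYX p) = monYX p" if g: "g \<in> G" and p: "p \<in> deg0 m" for g p
  proof -
    obtain i j where p': "p = (i, j)" "i mod m = j mod m" using p by (auto simp: deg0_def)
    have z: "\<chi> g ^ m = 1" using im g by blast
    have red: "\<chi> g ^ k = \<chi> g ^ (k mod m)" for k
    proof -
      have "\<chi> g ^ k = \<chi> g ^ (m * (k div m) + k mod m)" by simp
      then show ?thesis unfolding power_add power_mult z by simp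
    qed
    have "\<chi> g ^ i * inverse (\<chi> g) ^ j = 1" using ratio[OF z] red[of i] red[of j] p' by simp
    then show "g (monXY p) = monXY p" "g (monYX p) = monYX p"
      using aut_monomials[OF G[OF g] nz[OF z]] ch[OF g] by (auto simp: p' opC_hom(2))
  qed
  have monB: "monXY p \<in> B" "monYX p \<in> B" for p
    by (auto simp: monXY_def monYX_def split: prod.split intro!: B_mult B_power B_X B_Y)
  define \<alpha> where "\<alpha> = cis (2 * pi / m)"
  note \<alpha> = primitive_root_power_eq_iff[OF m, folded \<alpha>_def]
  obtain g where g: "g \<in> G" "\<chi> g = \<alpha>" using im \<alpha>(1) by (metis (mono_tags, lifting) image_iff mem_Collect_eq)
  define \<omega> where "\<omega> = (\<lambda>(i, j). \<alpha> ^ i * inverse \<alpha> ^ j)"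
  have \<omega>1: "\<omega> p ^ m = 1" for p
  proof -
    obtain i j where p: "p = (i, j)" by (cases p)
    have "(\<alpha> ^ i * inverse \<alpha> ^ j) ^ m = (\<alpha> ^ m) ^ i * inverse (\<alpha> ^ m) ^ j"
      by (simp only: power_mult_distrib power_inverse power_mult[symmetric] mult.commute[of m])
    then show ?thesis by (simp add: p \<omega>_def \<alpha>(1))
  qed
  have \<omega>set: "{p. \<omega> p = 1} = deg0 m"
    using ratio[OF \<alpha>(1)] \<alpha>(2) by (auto simp: \<omega>_def deg0_def)
  have ev: "g (monXY p) = opC (\<omega> p) * monXY p" "g (monYX p) = opC (\<omega> p) * monYX p" for p
    using aut_monomials[OF G[OF g(1)] nz[OF \<alpha>(1)]] ch[OF g(1)] g(2) by (auto simp: \<omega>_def split: prod.split)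
  show "?I = cs.span (monXY ` deg0 m)"
  proof
    show "cs.span (monXY ` deg0 m) \<subseteq> ?I" by (intro cs.span_minimal sub) (auto simp: mon monB)
    show "?I \<subseteq> cs.span (monXY ` deg0 m)"
      using average_eigenvectors[OF G[OF g(1)] B_eq_monXY ev(1) \<omega>1 m] g(1) by (auto simp: \<omega>set)
  qed
  show "?I = cs.span (monYX ` deg0 m)"
  proof
    show "cs.span (monYX ` deg0 m) \<subseteq> ?I" by (intro cs.span_minimal sub) (auto simp: mon monB)
    show "?I \<subseteq> cs.span (monYX ` deg0 m)"
      using average_eigenvectors[OF G[OF g(1)] B_eq_monYX ev(2) \<omega>1 m] g(1) by (auto simp: \<omega>set)
  qed
qed

end

section \<open>Faithful representations\<close>

text \<open>
  The carrier-based rings of the theorem are compared with rings of operators along such a map.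
\<close>

locale ring_rep = ring R for R :: "('a, 'e) ring_scheme" (structure) +
  fixes rep :: "'a \<Rightarrow> 'r::ring_1"
  assumes rep_add: "x \<in> carrier R \<Longrightarrow> y \<in> carrier R \<Longrightarrow> rep (x \<oplus> y) = rep x + rep y"
    and rep_mult: "x \<in> carrier R \<Longrightarrow> y \<in> carrier R \<Longrightarrow> rep (x \<otimes> y) = rep x * rep y"
    and rep_one: "rep \<one> = 1"
    and rep_inj: "inj_on rep (carrier R)"
begin

lemma rep_zero: "rep \<zero> = 0"
  using rep_add[of \<zero> \<zero>] by simp

lemma rep_a_inv: "x \<in> carrier R \<Longrightarrow> rep (\<ominus> x) = - rep x"
  using rep_add[of "\<ominus> x" x] by (simp add: l_neg rep_zero eq_neg_iff_add_eq_0)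

lemma rep_eq_iff: "x \<in> carrier R \<Longrightarrow> y \<in> carrier R \<Longrightarrow> rep x = rep y \<longleftrightarrow> x = y"
  using rep_inj by (auto dest: inj_onD)

lemma rep_pow: "x \<in> carrier R \<Longrightarrow> rep (x [^] (n::nat)) = rep x ^ n"
  by (induction n) (auto simp: rep_one rep_mult power_commutes)

lemma rep_finsum:
  "f \<in> A \<rightarrow> carrier R \<Longrightarrow> rep (finsum R f A) = (\<Sum>a\<in>A. rep (f a))"
proof (induction A rule: infinite_finite_induct)
  case (insert a A)
  then have "f \<in> A \<rightarrow> carrier R" "f a \<in> carrier R" by auto
  then show ?case using insert by (simp add: rep_add finsum_closed)
qed (auto simp: rep_zero)

lemma left_span_carrier:
  assumes "S \<subseteq> carrier R" "V \<subseteq> carrier R" shows "left_span R S V \<subseteq> carrier R"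
  unfolding left_span_def using add.generate_incl[of "S <#> V"] assms by (auto simp: set_mult_def)

lemma right_span_carrier:
  assumes "S \<subseteq> carrier R" "V \<subseteq> carrier R" shows "right_span R S V \<subseteq> carrier R"
  unfolding right_span_def using add.generate_incl[of "V <#> S"] assms by (auto simp: set_mult_def)

lemma rep_generate:
  assumes V: "V \<subseteq> carrier R" and P: "0 \<in> P" "\<And>x. x \<in> V \<Longrightarrow> rep x \<in> P"
    "\<And>x y. x \<in> P \<Longrightarrow> y \<in> P \<Longrightarrow> x + y \<in> P" "\<And>x. x \<in> P \<Longrightarrow> - x \<in> P"
  shows "rep ` generate (add_monoid R) V \<subseteq> P"
proof -
  have "h \<in> carrier R \<and> rep h \<in> P" if "h \<in> generate (add_monoid R) V" for h
    using that
  proof (induction rule: generate.induct)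
    case one
    then show ?case using P by (simp add: rep_zero)
  next
    case (incl h)
    then show ?case using V P by auto
  next
    case (inv h)
    then have h: "h \<in> carrier R" using V by auto
    then show ?case using P inv by (simp add: rep_a_inv flip: a_inv_def)
  next
    case (eng h1 h2)
    then show ?case using P by (simp add: rep_add)
  qed
  then show ?thesis by blast
qed

lemma rep_generate_span:
  fixes scale :: "'s::comm_ring_1 \<Rightarrow> 'r \<Rightarrow> 'r"
  assumes M: "Modules.module scale" and P: "P \<subseteq> carrier R"
    and eq: "rep ` P = {scale p x | p x. x \<in> rep ` V}"
  shows "rep ` generate (add_monoid R) P = Modules.module.span scale (rep ` V)"
proof -
  interpret M: Modules.module scale by (rule M)
  show ?thesis
  proof
    show "rep ` generate (add_monoid R) P \<subseteq> M.span (rep ` V)"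
    proof (rule rep_generate[OF P])
      fix x assume "x \<in> P"
      then have "rep x \<in> {scale p x | p x. x \<in> rep ` V}" using eq by blast
      then obtain p y where "rep x = scale p y" "y \<in> rep ` V" by blast
      then show "rep x \<in> M.span (rep ` V)" by (simp add: M.span_scale M.span_base)
    qed (auto intro: M.span_zero M.span_add M.span_neg)
    show "M.span (rep ` V) \<subseteq> rep ` generate (add_monoid R) P"
    proof
      fix x assume "x \<in> M.span (rep ` V)"
      then show "x \<in> rep ` generate (add_monoid R) P"
      proof (induction rule: M.span_induct_alt)
        case base
        show ?case using generate.one[of "add_monoid R" P] rep_zero by (force simp: image_iff)
      next
        case (step c v y)
        have "scale c v \<in> rep ` P" unfolding eq using step(1) by blast
        then obtain z where z: "z \<in> P" "scale c v = rep z" by blast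
        obtain w where w: "w \<in> generate (add_monoid R) P" "y = rep w" using step(2) by blast
        have "z \<oplus> w \<in> generate (add_monoid R) P"
          using generate.eng[OF generate.incl[OF z(1), of "add_monoid R"] w(1)] by simp
        moreover have "w \<in> carrier R" using w(1) add.generate_incl[of P] P by auto
        moreover have "rep (z \<oplus> w) = scale c v + y"
          using z w P \<open>w \<in> carrier R\<close> rep_add[of z w] by auto
        ultimately show ?case by (metis imageI)
      qed
    qed
  qed
qed

text \<open>
  Translates the submodules generated in a ring into the spans of a module over \<open>'s\<close>, where \<open>g\<close> describes how \<open>'s\<close>
  acts.
\<close>

lemma rep_left_span:
  fixes g :: "'s::comm_ring_1 \<Rightarrow> 'r"
  assumes "Modules.module (\<lambda>p b. g p * b)" and S: "S \<subseteq> carrier R" "rep ` S = range g"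
    and V: "V \<subseteq> carrier R"
  shows "rep ` left_span R S V = Modules.module.span (\<lambda>p b. g p * b) (rep ` V)"
  unfolding left_span_def
proof (rule rep_generate_span[OF assms(1)])
  show "S <#> V \<subseteq> carrier R" using S V by (auto simp: set_mult_def)
  have "rep ` (S <#> V) = {s * v | s v. s \<in> rep ` S \<and> v \<in> rep ` V}"
    using S(1) V by (force simp: set_mult_def rep_mult subset_iff image_iff)
  then show "rep ` (S <#> V) = {g p * x | p x. x \<in> rep ` V}" unfolding S(2) by blast
qed

lemma rep_right_span:
  fixes g :: "'s::comm_ring_1 \<Rightarrow> 'r"
  assumes "Modules.module (\<lambda>p b. b * g p)" and S: "S \<subseteq> carrier R" "rep ` S = range g"
    and V: "V \<subseteq> carrier R"
  shows "rep ` right_span R S V = Modules.module.span (\<lambda>p b. b * g p) (rep ` V)"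
  unfolding right_span_def
proof (rule rep_generate_span[OF assms(1)])
  show "V <#> S \<subseteq> carrier R" using S V by (auto simp: set_mult_def)
  have "rep ` (V <#> S) = {v * s | s v. s \<in> rep ` S \<and> v \<in> rep ` V}"
    using S(1) V by (force simp: set_mult_def rep_mult subset_iff image_iff)
  then show "rep ` (V <#> S) = {x * g p | p x. x \<in> rep ` V}" unfolding S(2) by blast
qed

text \<open>
  Left and right modules at once: \<open>op s x\<close> is \<open>s x\<close> or \<open>x s\<close>, and \<open>scale\<close> the corresponding action.
\<close>

lemma combination_zero:
  fixes g :: "'s::comm_ring_1 \<Rightarrow> 'r" and b :: "nat \<Rightarrow> 'a"
  assumes M: "Modules.module scale" and S: "S \<subseteq> carrier R" "rep ` S = range g" and g0: "g 0 = 0"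
    and b: "\<And>j. b j \<in> carrier R"
    and indep: "\<And>N c j. (\<Sum>j<N. scale (c j) (rep (b j))) = 0 \<Longrightarrow> j < N \<Longrightarrow> c j = 0"
    and op: "\<And>s x. s \<in> carrier R \<Longrightarrow> x \<in> carrier R \<Longrightarrow> op s x \<in> carrier R"
      "\<And>s x p. s \<in> carrier R \<Longrightarrow> x \<in> carrier R \<Longrightarrow> rep s = g p \<Longrightarrow> rep (op s x) = scale p (rep x)"
    and F: "finite F" "F \<subseteq> range b" "c \<in> F \<rightarrow> S" "(\<Oplus>x\<in>F. op (c x) x) = \<zero>"
  shows "\<forall>x\<in>F. c x = \<zero>"
proof
  interpret M: Modules.module scale by (rule M)
  have "\<exists>p. rep (c x) = g p" if "x \<in> F" for x
    using F that S(2) by blast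
  then obtain p where p: "\<And>x. x \<in> F \<Longrightarrow> rep (c x) = g (p x)" by metis
  have cF: "c x \<in> carrier R" "x \<in> carrier R" if "x \<in> F" for x using F S(1) b that by auto
  have inj: "inj_on rep F" by (rule inj_on_subset[OF rep_inj]) (use cF(2) in blast)
  have "0 = rep (\<Oplus>x\<in>F. op (c x) x)" using F by (simp add: rep_zero)
  also have "\<dots> = (\<Sum>x\<in>F. scale (p x) (rep x))"
    using cF p op by (subst rep_finsum) auto
  also have "\<dots> = (\<Sum>y\<in>rep ` F. scale (p (inv_into F rep y)) y)"
    by (simp add: sum.reindex[OF inj] inj)
  finally have z: "(\<Sum>y\<in>rep ` F. scale (p (inv_into F rep y)) y) = 0" by simp
  fix x assume x: "x \<in> F"
  have "p (inv_into F rep (rep x)) = 0"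
  proof (rule M.coefficients_vanish_on_range[where b = "\<lambda>j. rep (b j)" and F = "rep ` F"
        and p = "\<lambda>y. p (inv_into F rep y)"])
    show "\<And>N c j. (\<Sum>j<N. scale (c j) (rep (b j))) = 0 \<Longrightarrow> j < N \<Longrightarrow> c j = 0" by (rule indep)
  qed (use F x z in auto)
  then have "p x = 0" using x inj by simp
  then have "rep (c x) = rep \<zero>" using p[OF x] by (simp add: g0 rep_zero)
  then show "c x = \<zero>" using rep_eq_iff cF[OF x] by simp
qed

lemma free_leftI:
  fixes g :: "'s::comm_ring_1 \<Rightarrow> 'r" and b :: "nat \<Rightarrow> 'a"
  assumes M: "Modules.module (\<lambda>p b. g p * b)" and S: "S \<subseteq> carrier R" "rep ` S = range g"
    and b: "\<And>j. b j \<in> carrier R"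
    and span: "Modules.module.span (\<lambda>p b. g p * b) (range (\<lambda>j. rep (b j))) = rep ` carrier R"
    and indep: "\<And>N c j. (\<Sum>j<N. g (c j) * rep (b j)) = 0 \<Longrightarrow> j < N \<Longrightarrow> c j = 0"
  shows "free_left_module R S"
  unfolding free_left_module_def
proof (intro exI[of _ "range b"] conjI allI impI)
  show bc: "range b \<subseteq> carrier R" using b by auto
  have "rep ` left_span R S (range b) = rep ` carrier R"
    unfolding rep_left_span[OF M S bc] image_image span ..
  then show "left_span R S (range b) = carrier R"
    using inj_on_image_eq_iff[OF rep_inj left_span_carrier[OF S(1) bc]] by blast
  fix F c assume F: "finite F \<and> F \<subseteq> range b \<and> c \<in> F \<rightarrow> S \<and> (\<Oplus>b\<in>F. c b \<otimes> b) = \<zero>"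
  have g0: "g 0 = 0"
    using Modules.module.scale_zero_left[OF M, of 1] by (simp only: mult_1_left mult_1_right)
  show "\<forall>b\<in>F. c b = \<zero>"
  proof (rule combination_zero[where op = "\<lambda>s x. s \<otimes> x", OF M S g0 b])
    show "\<And>N c j. (\<Sum>j<N. g (c j) * rep (b j)) = 0 \<Longrightarrow> j < N \<Longrightarrow> c j = 0" by (rule indep)
    show "rep (s \<otimes> x) = g p * rep x" if "s \<in> carrier R" "x \<in> carrier R" "rep s = g p" for s x p
      using that by (simp add: rep_mult)
  qed (use F in auto)
qed

lemma free_rightI:
  fixes g :: "'s::comm_ring_1 \<Rightarrow> 'r" and b :: "nat \<Rightarrow> 'a"
  assumes M: "Modules.module (\<lambda>p b. b * g p)" and S: "S \<subseteq> carrier R" "rep ` S = range g"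
    and b: "\<And>j. b j \<in> carrier R"
    and span: "Modules.module.span (\<lambda>p b. b * g p) (range (\<lambda>j. rep (b j))) = rep ` carrier R"
    and indep: "\<And>N c j. (\<Sum>j<N. rep (b j) * g (c j)) = 0 \<Longrightarrow> j < N \<Longrightarrow> c j = 0"
  shows "free_right_module R S"
  unfolding free_right_module_def
proof (intro exI[of _ "range b"] conjI allI impI)
  show bc: "range b \<subseteq> carrier R" using b by auto
  have "rep ` right_span R S (range b) = rep ` carrier R"
    unfolding rep_right_span[OF M S bc] image_image span ..
  then show "right_span R S (range b) = carrier R"
    using inj_on_image_eq_iff[OF rep_inj right_span_carrier[OF S(1) bc]] by blast
  fix F c assume F: "finite F \<and> F \<subseteq> range b \<and> c \<in> F \<rightarrow> S \<and> (\<Oplus>b\<in>F. b \<otimes> c b) = \<zero>"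
  have g0: "g 0 = 0"
    using Modules.module.scale_zero_left[OF M, of 1] by (simp only: mult_1_left mult_1_right)
  show "\<forall>b\<in>F. c b = \<zero>"
  proof (rule combination_zero[where op = "\<lambda>s x. x \<otimes> s", OF M S g0 b])
    show "\<And>N c j. (\<Sum>j<N. rep (b j) * g (c j)) = 0 \<Longrightarrow> j < N \<Longrightarrow> c j = 0" by (rule indep)
    show "rep (x \<otimes> s) = rep x * g p" if "s \<in> carrier R" "x \<in> carrier R" "rep s = g p" for s x p
      using that by (simp add: rep_mult)
  qed (use F in auto)
qed

end

section \<open>The quantum Weyl algebra as an algebra of operators\<close>

interpretation words: skew_action "free_monoid :: weyl_gen list monoid" "\<lambda>_ c. c :: complex"
  by standard (auto simp: free_monoid_def)

lemma free_alg_eq: "free_alg = words.S"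
  by (simp add: free_alg_def)

interpretation FA: ring free_alg
  unfolding free_alg_eq by (rule words.ring_S)

abbreviation wmono :: "complex \<Rightarrow> weyl_gen list \<Rightarrow> weyl_gen list \<Rightarrow> complex" where
  "wmono \<equiv> monom_elem ring_of_type_algebra"

lemma wmono_closed [simp]: "wmono c w \<in> carrier free_alg"
  unfolding free_alg_eq by simp

lemma wmono_mult: "wmono c v \<otimes>\<^bsub>free_alg\<^esub> wmono d w = wmono (c * d) (v @ w)"
  unfolding free_alg_eq words.mult_monom_elem by (simp add: free_monoid_def)

lemma wmono_zero: "wmono 0 w = \<zero>\<^bsub>free_alg\<^esub>"
  unfolding free_alg_eq by (rule ext) (simp add: monom_elem_def)

lemma free_monoid_one: "\<one>\<^bsub>free_monoid\<^esub> = []"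
  by (simp add: free_monoid_def)

lemma wmono_one: "\<one>\<^bsub>free_alg\<^esub> = wmono 1 []"
  unfolding free_alg_eq by (rule ext) (simp add: monom_elem_def free_monoid_one)

lemma wmono_minus: "\<ominus>\<^bsub>free_alg\<^esub> wmono c w = wmono (- c) w"
  unfolding free_alg_eq words.a_inv_S[OF words.monom_elem_closed] by (rule ext) (simp add: monom_elem_def)

definition xy :: "nat \<Rightarrow> nat \<Rightarrow> weyl_gen list" where
  "xy i j = replicate i Gen_x @ replicate j Gen_y"

lemma xy_inj: "xy i j = xy i' j' \<longleftrightarrow> i = i' \<and> j = j'"
proof
  assume "xy i j = xy i' j'"
  then have "count_list (xy i j) Gen_x = count_list (xy i' j') Gen_x"
    "count_list (xy i j) Gen_y = count_list (xy i' j') Gen_y" by simp_all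
  moreover have "count_list (replicate n a) b = (if a = b then n else 0)" for n and a b :: weyl_gen
    by (induction n) auto
  ultimately show "i = i' \<and> j = j'" by (simp add: xy_def)
qed simp

text \<open>
  Linear combinations of the words \<open>x\<^sup>i y\<^sup>j\<close>.
\<close>

inductive_set NF :: "(weyl_gen list \<Rightarrow> complex) set" where
  NF_zero: "\<zero>\<^bsub>free_alg\<^esub> \<in> NF"
| NF_step: "n \<in> NF \<Longrightarrow> wmono c (xy i j) \<oplus>\<^bsub>free_alg\<^esub> n \<in> NF"

lemma NF_carrier: "n \<in> NF \<Longrightarrow> n \<in> carrier free_alg"
  by (induction rule: NF.induct) auto

lemma NF_wmono: "wmono c (xy i j) \<in> NF"
  using NF_step[OF NF_zero, of c i j] by simp

lemma NF_add: "m \<in> NF \<Longrightarrow> n \<in> NF \<Longrightarrow> m \<oplus>\<^bsub>free_alg\<^esub> n \<in> NF"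
  by (induction rule: NF.induct) (auto simp: NF_carrier FA.a_assoc intro: NF_step)

lemma NF_supp: "n \<in> NF \<Longrightarrow> n w \<noteq> 0 \<Longrightarrow> \<exists>i j. w = xy i j"
  by (induction rule: NF.induct) (auto simp: free_alg_eq monom_elem_def split: if_splits)

lemma qweyl_relator_eq:
  "qweyl_relator q = wmono 1 [Gen_y, Gen_x] \<oplus>\<^bsub>free_alg\<^esub> wmono (- q) [Gen_x, Gen_y] \<oplus>\<^bsub>free_alg\<^esub> wmono (- 1) []"
  unfolding qweyl_relator_def a_minus_def wmono_one wmono_mult wmono_minus by simp

lemma qweyl_relator_closed: "qweyl_relator q \<in> carrier free_alg"
  unfolding qweyl_relator_eq by simp

lemma ideal_qweyl: "ideal (qweyl_ideal q) free_alg"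
  unfolding qweyl_ideal_def by (rule FA.genideal_ideal) (simp add: qweyl_relator_closed)

lemma qweyl_ideal_closed: "i \<in> qweyl_ideal q \<Longrightarrow> i \<in> carrier free_alg"
  using ideal.Icarr[OF ideal_qweyl] .

definition normalizable :: "complex \<Rightarrow> (weyl_gen list \<Rightarrow> complex) set" where
  "normalizable q = {i \<oplus>\<^bsub>free_alg\<^esub> n | i n. i \<in> qweyl_ideal q \<and> n \<in> NF}"

lemma normalizable_add:
  assumes "f \<in> normalizable q" "g \<in> normalizable q"
  shows "f \<oplus>\<^bsub>free_alg\<^esub> g \<in> normalizable q"
proof -
  obtain i n where f: "f = i \<oplus>\<^bsub>free_alg\<^esub> n" "i \<in> qweyl_ideal q" "n \<in> NF"
    using assms(1) by (auto simp: normalizable_def)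
  obtain k l where g: "g = k \<oplus>\<^bsub>free_alg\<^esub> l" "k \<in> qweyl_ideal q" "l \<in> NF"
    using assms(2) by (auto simp: normalizable_def)
  have "f \<oplus>\<^bsub>free_alg\<^esub> g = (i \<oplus>\<^bsub>free_alg\<^esub> k) \<oplus>\<^bsub>free_alg\<^esub> (n \<oplus>\<^bsub>free_alg\<^esub> l)"
    using f g NF_carrier qweyl_ideal_closed by (simp add: FA.a_ac)
  moreover have "i \<oplus>\<^bsub>free_alg\<^esub> k \<in> qweyl_ideal q"
    using f g ideal_qweyl by (simp add: additive_subgroup.a_closed ideal.axioms(1))
  ultimately show ?thesis using f g NF_add unfolding normalizable_def by blast
qed

lemma ideal_normalizable: "i \<in> qweyl_ideal q \<Longrightarrow> i \<in> normalizable q"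
  unfolding normalizable_def mem_Collect_eq
  by (intro exI[of _ i] exI[of _ "\<zero>\<^bsub>free_alg\<^esub>"]) (simp add: NF_zero qweyl_ideal_closed)

lemma NF_normalizable: "n \<in> NF \<Longrightarrow> n \<in> normalizable q"
proof -
  assume n: "n \<in> NF"
  have "\<zero>\<^bsub>free_alg\<^esub> \<in> qweyl_ideal q"
    using ideal_qweyl by (simp add: additive_subgroup.zero_closed ideal.axioms(1))
  moreover have "n = \<zero>\<^bsub>free_alg\<^esub> \<oplus>\<^bsub>free_alg\<^esub> n" using NF_carrier[OF n] by simp
  ultimately show ?thesis unfolding normalizable_def using n by blast
qed

lemma normalizable_mult_left:
  assumes "\<And>c i j. wmono 1 [g] \<otimes>\<^bsub>free_alg\<^esub> wmono c (xy i j) \<in> normalizable q" "f \<in> normalizable q"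
  shows "wmono 1 [g] \<otimes>\<^bsub>free_alg\<^esub> f \<in> normalizable q"
proof -
  obtain i n where f: "f = i \<oplus>\<^bsub>free_alg\<^esub> n" "i \<in> qweyl_ideal q" "n \<in> NF"
    using assms(2) by (auto simp: normalizable_def)
  have n: "wmono 1 [g] \<otimes>\<^bsub>free_alg\<^esub> n \<in> normalizable q"
    using f(3)
  proof (induction rule: NF.induct)
    case NF_zero
    then show ?case using NF_normalizable[OF NF.NF_zero] by simp
  next
    case (NF_step n c i j)
    then show ?case using assms(1) NF_carrier normalizable_add by (simp add: FA.r_distr)
  qed
  have "wmono 1 [g] \<otimes>\<^bsub>free_alg\<^esub> i \<in> qweyl_ideal q"
    using ideal.I_l_closed[OF ideal_qweyl f(2)] by simp
  then show ?thesis
    using f n NF_carrier qweyl_ideal_closed normalizable_add ideal_normalizable by (simp add: FA.r_distr)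
qed

lemma normalizable_x:
  "f \<in> normalizable q \<Longrightarrow> wmono 1 [Gen_x] \<otimes>\<^bsub>free_alg\<^esub> f \<in> normalizable q"
proof (rule normalizable_mult_left)
  fix c i j
  have "[Gen_x] @ xy i j = xy (Suc i) j" by (simp add: xy_def)
  then show "wmono 1 [Gen_x] \<otimes>\<^bsub>free_alg\<^esub> wmono c (xy i j) \<in> normalizable q"
    unfolding wmono_mult using NF_normalizable[OF NF_wmono] by simp
qed

text \<open>
  Induction on \<open>i\<close>: modulo the relator, \<open>y x\<^sup>i\<^sup>+\<^sup>1 y\<^sup>j\<close> is a combination of \<open>x (y x\<^sup>i y\<^sup>j)\<close> and \<open>x\<^sup>i y\<^sup>j\<close>.
\<close>

lemma normalizable_y:
  "f \<in> normalizable q \<Longrightarrow> wmono 1 [Gen_y] \<otimes>\<^bsub>free_alg\<^esub> f \<in> normalizable q"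
proof (rule normalizable_mult_left)
  fix c i j
  have "wmono c (Gen_y # xy i j) \<in> normalizable q"
  proof (induction i arbitrary: c)
    case 0
    have "Gen_y # xy 0 j = xy 0 (Suc j)" by (simp add: xy_def)
    then show ?case using NF_normalizable[OF NF_wmono] by simp
  next
    case (Suc i)
    let ?w = "xy i j"
    have "qweyl_relator q \<in> qweyl_ideal q"
      unfolding qweyl_ideal_def by (rule FA.genideal_self') (rule qweyl_relator_closed)
    then have "qweyl_relator q \<otimes>\<^bsub>free_alg\<^esub> wmono c ?w \<in> qweyl_ideal q"
      by (rule ideal.I_r_closed[OF ideal_qweyl]) simp
    then have 1: "qweyl_relator q \<otimes>\<^bsub>free_alg\<^esub> wmono c ?w \<in> normalizable q" by (rule ideal_normalizable)
    have 2: "wmono (q * c) (Gen_x # Gen_y # ?w) \<in> normalizable q"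
      using normalizable_x[OF Suc[of "q * c"]] unfolding wmono_mult by simp
    have 3: "wmono c ?w \<in> normalizable q" by (rule NF_normalizable[OF NF_wmono])
    have w: "Gen_y # xy (Suc i) j = Gen_y # Gen_x # ?w" by (simp add: xy_def)
    have "(qweyl_relator q \<otimes>\<^bsub>free_alg\<^esub> wmono c ?w) \<oplus>\<^bsub>free_alg\<^esub> wmono (q * c) (Gen_x # Gen_y # ?w)
        \<oplus>\<^bsub>free_alg\<^esub> wmono c ?w = wmono c (Gen_y # Gen_x # ?w)"
      unfolding qweyl_relator_eq
      by (simp add: FA.l_distr wmono_mult) (auto simp: free_alg_eq monom_elem_def)
    then show ?case unfolding w using normalizable_add[OF normalizable_add[OF 1 2] 3] by simp
  qed
  then show "wmono 1 [Gen_y] \<otimes>\<^bsub>free_alg\<^esub> wmono c (xy i j) \<in> normalizable q"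
    unfolding wmono_mult by simp
qed

lemma normalizable_all: "f \<in> carrier free_alg \<Longrightarrow> f \<in> normalizable q"
  unfolding free_alg_eq
proof (induction rule: words.carrier_induct)
  case zero
  then show ?case using NF_normalizable[OF NF_zero] by (simp add: free_alg_eq)
next
  case (monom c w)
  show ?case
  proof (induction w)
    case Nil
    then show ?case using NF_normalizable[OF NF_wmono[of c 0 0]] by (simp add: xy_def)
  next
    case (Cons g w)
    then show ?case using normalizable_x[OF Cons] normalizable_y[OF Cons] wmono_mult[of 1 "[g]" c w]
      by (cases g) auto
  qed
next
  case (add f g)
  then show ?case using normalizable_add[of f q g] by (simp add: free_alg_eq)
qed

context qparam
begin

definition word_op :: "weyl_gen list \<Rightarrow> ratfun endo" where
  "word_op w = prod_list (map (case_weyl_gen opX opY) w)"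

lemma word_op_B: "word_op w \<in> B"
  by (induction w) (auto simp: word_op_def intro!: B_1 B_mult split: weyl_gen.split intro: B_X B_Y)

definition ev :: "(weyl_gen list \<Rightarrow> complex) \<Rightarrow> ratfun endo" where
  "ev = words.eval opC word_op"

lemma ev_add: "f \<in> carrier free_alg \<Longrightarrow> g \<in> carrier free_alg \<Longrightarrow> ev (f \<oplus>\<^bsub>free_alg\<^esub> g) = ev f + ev g"
  unfolding ev_def free_alg_eq by (rule words.eval_add) (auto simp: opC_hom)

lemma ev_mult: "f \<in> carrier free_alg \<Longrightarrow> g \<in> carrier free_alg \<Longrightarrow> ev (f \<otimes>\<^bsub>free_alg\<^esub> g) = ev f * ev g"
  unfolding ev_def free_alg_eq
  by (rule words.eval_mult)
    (auto simp: opC_hom(3,5) free_monoid_def word_op_def[of "_ @ _"] opC_central[OF word_op_B] simp flip: word_op_def)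

lemma ev_wmono: "ev (wmono c w) = opC c * word_op w"
  unfolding ev_def by (rule words.eval_monom_elem) (simp add: opC_hom)

lemma ev_zero: "ev \<zero>\<^bsub>free_alg\<^esub> = 0"
  using ev_wmono[of 0 "[]"] by (simp add: wmono_zero opC_hom)

lemma ev_minus: assumes "f \<in> carrier free_alg" shows "ev (\<ominus>\<^bsub>free_alg\<^esub> f) = - ev f"
proof -
  have "ev (\<ominus>\<^bsub>free_alg\<^esub> f \<oplus>\<^bsub>free_alg\<^esub> f) = ev (\<ominus>\<^bsub>free_alg\<^esub> f) + ev f"
    using assms by (intro ev_add) auto
  then show ?thesis using assms by (simp add: FA.l_neg ev_zero eq_neg_iff_add_eq_0)
qed

lemma ev_qweyl_relator: "ev (qweyl_relator q) = 0"
  unfolding qweyl_relator_eq by (simp add: ev_add ev_wmono word_op_def opC_hom opY_opX mult.assoc)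

lemma ev_qweyl_ideal: "i \<in> qweyl_ideal q \<Longrightarrow> ev i = 0"
proof -
  let ?K = "{f \<in> carrier free_alg. ev f = 0}"
  have "ideal ?K free_alg"
  proof (rule idealI[OF FA.ring_axioms])
    show "subgroup ?K (add_monoid free_alg)"
      by (rule FA.add.subgroupI) (auto simp: ev_add ev_minus ev_zero simp flip: a_inv_def)
  qed (auto simp: ev_mult)
  then have "qweyl_ideal q \<subseteq> ?K"
    unfolding qweyl_ideal_def
    by (rule FA.genideal_minimal) (simp add: ev_qweyl_relator qweyl_relator_closed)
  then show "i \<in> qweyl_ideal q \<Longrightarrow> ev i = 0" by blast
qed

lemma word_op_xy: "word_op (xy i j) = opX ^ i * opY ^ j"
proof -
  have "word_op (replicate n g) = (case g of Gen_x \<Rightarrow> opX | Gen_y \<Rightarrow> opY) ^ n" for n g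
    by (induction n) (auto simp: word_op_def)
  moreover have "word_op (u @ v) = word_op u * word_op v" for u v by (simp add: word_op_def)
  ultimately show ?thesis by (simp add: xy_def)
qed

text \<open>
  Grouping the terms by the exponent of \<open>y\<close> gives a combination of the \<open>y\<^sup>j\<close> with polynomial coefficients,
  and the \<open>y\<^sup>j\<close> are independent.
\<close>

lemma NF_ev_inj:
  assumes n: "n \<in> NF" and z: "ev n = 0" shows "n = \<zero>\<^bsub>free_alg\<^esub>"
proof -
  have fin: "finite (words.supp n)" using NF_carrier[OF n] unfolding free_alg_eq words.in_carrier_iff .
  have "inj (\<lambda>(i, j). xy i j)" by (auto simp: inj_def xy_inj)
  then have "finite {p. (\<lambda>(i, j). xy i j) p \<in> words.supp n}"
    using finite_vimageI[OF fin] by (simp add: vimage_def)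
  then have fin2: "finite {(i, j). xy i j \<in> words.supp n}" by (simp add: case_prod_unfold)
  obtain M where M: "fst ` {(i, j). xy i j \<in> words.supp n} \<subseteq> {..<M}"
    using fin2 finite_nat_iff_bounded by blast
  obtain N where N: "snd ` {(i, j). xy i j \<in> words.supp n} \<subseteq> {..<N}"
    using fin2 finite_nat_iff_bounded by blast
  have MN: "i < M" "j < N" if "n (xy i j) \<noteq> 0" for i j
    using that M N by (auto simp: words.supp_def image_subset_iff)
  let ?A = "(\<lambda>(i, j). xy i j) ` ({..<M} \<times> {..<N})"
  have sub: "words.supp n \<subseteq> ?A"
  proof
    fix w assume "w \<in> words.supp n"
    then have "n w \<noteq> 0" by (simp add: words.supp_def)
    moreover from this obtain i j where "w = xy i j" using NF_supp[OF n] by blast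
    ultimately show "w \<in> ?A" using MN by force
  qed
  define P where "P j = (\<Sum>i<M. Polynomial.monom (n (xy i j)) i)" for j
  have "ev n = (\<Sum>w\<in>?A. opC (n w) * word_op w)"
    unfolding ev_def using sub by (intro words.eval_eq) (auto simp: opC_hom)
  also have "\<dots> = (\<Sum>(i, j)\<in>{..<M} \<times> {..<N}. opC (n (xy i j)) * (opX ^ i * opY ^ j))"
    by (subst sum.reindex) (auto simp: inj_on_def xy_inj word_op_xy case_prod_unfold)
  also have "\<dots> = (\<Sum>j<N. \<Sum>i<M. opC (n (xy i j)) * (opX ^ i * opY ^ j))"
    by (subst sum.swap) (simp add: sum.cartesian_product)
  also have "\<dots> = (\<Sum>j<N. poly_op 1 (P j) * bL 1 j)"
    by (simp add: P_def poly_op_sum poly_op_monom bL_def sum_distrib_right mult.assoc del: One_nat_def)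
  finally have "(\<Sum>j<N. poly_op 1 (P j) * bL 1 j) \<in> L 0" using z by (simp add: L_0)
  from bL_coefficients_vanish[OF _ this] have P0: "P j = 0" if "j < N" for j using that by simp
  have "n (xy i j) = 0" for i j
  proof (rule ccontr)
    assume nz: "n (xy i j) \<noteq> 0"
    have "Polynomial.coeff (P j) i = n (xy i j)" using MN[OF nz] by (simp add: P_def coeff_sum)
    then show False using P0[OF MN(2)[OF nz]] nz by simp
  qed
  then have "n w = 0" for w using NF_supp[OF n] by metis
  then show ?thesis by (auto simp: free_alg_eq)
qed

text \<open>
  Every element is congruent to a normal form, and evaluation is injective on normal forms.
\<close>

lemma ev_eq_0_iff: assumes "f \<in> carrier free_alg" shows "ev f = 0 \<longleftrightarrow> f \<in> qweyl_ideal q"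
proof
  assume z: "ev f = 0"
  obtain i n where f: "f = i \<oplus>\<^bsub>free_alg\<^esub> n" "i \<in> qweyl_ideal q" "n \<in> NF"
    using normalizable_all[OF assms, of q] by (auto simp: normalizable_def)
  have c: "i \<in> carrier free_alg" "n \<in> carrier free_alg" using f NF_carrier qweyl_ideal_closed by auto
  then have "ev n = 0" using z f ev_add[OF c] ev_qweyl_ideal by simp
  then have "n = \<zero>\<^bsub>free_alg\<^esub>" using NF_ev_inj f by simp
  then show "f \<in> qweyl_ideal q" using f c by simp
qed (rule ev_qweyl_ideal)

lemma ev_image: "ev ` carrier free_alg = B"
proof
  show "ev ` carrier free_alg \<subseteq> B"
    unfolding ev_def words.eval_def by (auto intro!: B_sum B_mult B_C word_op_B)
  show "B \<subseteq> ev ` carrier free_alg"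
  proof
    fix b assume "b \<in> B"
    then show "b \<in> ev ` carrier free_alg"
    proof (induction rule: B.induct)
      case (B_C c)
      show ?case using ev_wmono[of c "[]"] by (intro image_eqI[of _ _ "wmono c []"]) (auto simp: word_op_def)
    next
      case B_X
      show ?case using ev_wmono[of 1 "[Gen_x]"]
        by (intro image_eqI[of _ _ "wmono 1 [Gen_x]"]) (auto simp: word_op_def opC_hom)
    next
      case B_Y
      show ?case using ev_wmono[of 1 "[Gen_y]"]
        by (intro image_eqI[of _ _ "wmono 1 [Gen_y]"]) (auto simp: word_op_def opC_hom)
    next
      case (B_add a b)
      then obtain f g where "f \<in> carrier free_alg" "g \<in> carrier free_alg" "a = ev f" "b = ev g" by blast
      then show ?case by (intro image_eqI[of _ _ "f \<oplus>\<^bsub>free_alg\<^esub> g"]) (auto simp: ev_add)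
    next
      case (B_mult a b)
      then obtain f g where "f \<in> carrier free_alg" "g \<in> carrier free_alg" "a = ev f" "b = ev g" by blast
      then show ?case by (intro image_eqI[of _ _ "f \<otimes>\<^bsub>free_alg\<^esub> g"]) (auto simp: ev_mult)
    qed
  qed
qed

text \<open>
  The isomorphism from the quantum Weyl algebra to \<open>B\<close> induced by evaluation; the choice of a representative of the
  coset does not matter by \<open>ev_eq_0_iff\<close>.
\<close>

definition \<Theta> :: "(weyl_gen list \<Rightarrow> complex) set \<Rightarrow> ratfun endo" where
  "\<Theta> a = ev (SOME f. f \<in> carrier free_alg \<and> a = qweyl_ideal q +>\<^bsub>free_alg\<^esub> f)"

lemma coset_eq_iff:
  assumes "f \<in> carrier free_alg" "g \<in> carrier free_alg"
  shows "qweyl_ideal q +>\<^bsub>free_alg\<^esub> f = qweyl_ideal q +>\<^bsub>free_alg\<^esub> g \<longleftrightarrow> ev f = ev g"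
proof -
  have "f \<ominus>\<^bsub>free_alg\<^esub> g \<in> qweyl_ideal q \<longleftrightarrow> ev f = ev g"
    using assms ev_eq_0_iff[of "f \<ominus>\<^bsub>free_alg\<^esub> g"] by (simp add: a_minus_def ev_add ev_minus)
  then show ?thesis using FA.quotient_eq_iff_same_a_r_cos[OF ideal_qweyl assms] by simp
qed

lemma \<Theta>_coset: assumes "f \<in> carrier free_alg" shows "\<Theta> (qweyl_ideal q +>\<^bsub>free_alg\<^esub> f) = ev f"
proof -
  let ?P = "\<lambda>g. g \<in> carrier free_alg \<and> qweyl_ideal q +>\<^bsub>free_alg\<^esub> f = qweyl_ideal q +>\<^bsub>free_alg\<^esub> g"
  have "?P (SOME g. ?P g)" by (rule someI[of ?P f]) (use assms in simp)
  then have "ev f = ev (SOME g. ?P g)" using coset_eq_iff[OF assms] by blast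
  then show ?thesis unfolding \<Theta>_def by (rule sym)
qed

lemma qweyl_carrier: "carrier (qweyl q) = (\<lambda>f. qweyl_ideal q +>\<^bsub>free_alg\<^esub> f) ` carrier free_alg"
  by (auto simp: qweyl_def FactRing_def A_RCOSETS_def')

lemma ring_qweyl: "ring (qweyl q)"
  unfolding qweyl_def by (rule ideal.quotient_is_ring[OF ideal_qweyl])

lemma coset_hom: "(\<lambda>f. qweyl_ideal q +>\<^bsub>free_alg\<^esub> f) \<in> ring_hom free_alg (qweyl q)"
  unfolding qweyl_def using ideal.rcos_ring_hom[OF ideal_qweyl] .

lemma ring_rep_qweyl: "ring_rep (qweyl q) \<Theta>"
proof -
  note h = ring_hom_add[OF coset_hom] ring_hom_mult[OF coset_hom] ring_hom_one[OF coset_hom]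
  show ?thesis
  proof (intro ring_rep.intro ring_rep_axioms.intro ring_qweyl)
    show "\<Theta> (x \<oplus>\<^bsub>qweyl q\<^esub> y) = \<Theta> x + \<Theta> y" if "x \<in> carrier (qweyl q)" "y \<in> carrier (qweyl q)" for x y
      using that unfolding qweyl_carrier by (auto simp: \<Theta>_coset ev_add simp flip: h)
    show "\<Theta> (x \<otimes>\<^bsub>qweyl q\<^esub> y) = \<Theta> x * \<Theta> y" if "x \<in> carrier (qweyl q)" "y \<in> carrier (qweyl q)" for x y
      using that unfolding qweyl_carrier by (auto simp: \<Theta>_coset ev_mult simp flip: h)
    show "\<Theta> \<one>\<^bsub>qweyl q\<^esub> = 1"
      using ev_wmono[of 1 "[]"] by (simp add: \<Theta>_coset opC_hom word_op_def flip: h wmono_one)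
    show "inj_on \<Theta> (carrier (qweyl q))"
      unfolding qweyl_carrier by (auto simp: inj_on_def \<Theta>_coset coset_eq_iff)
  qed
qed

sublocale T: ring_rep "qweyl q" \<Theta>
  by (rule ring_rep_qweyl)

lemma \<Theta>_image: "\<Theta> ` carrier (qweyl q) = B"
  unfolding qweyl_carrier image_image ev_image[symmetric] by (rule image_cong) (auto simp: \<Theta>_coset)

lemma \<Theta>_scalar: "\<Theta> (qweyl_scalar q c) = opC c" "qweyl_scalar q c \<in> carrier (qweyl q)"
  unfolding qweyl_scalar_def qweyl_carrier by (simp_all add: \<Theta>_coset ev_wmono word_op_def)

lemma \<Theta>_x: "\<Theta> (qweyl_x q) = opX" "qweyl_x q \<in> carrier (qweyl q)"
  unfolding qweyl_x_def qweyl_carrier by (simp_all add: \<Theta>_coset ev_wmono word_op_def opC_hom)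

lemma \<Theta>_eval: "\<Theta> (qweyl_eval q m p) = poly_op m p" "qweyl_eval q m p \<in> carrier (qweyl q)"
proof -
  have c: "(\<lambda>k. qweyl_scalar q (Polynomial.coeff p k) \<otimes>\<^bsub>qweyl q\<^esub> ((qweyl_x q [^]\<^bsub>qweyl q\<^esub> m) [^]\<^bsub>qweyl q\<^esub> k))
    \<in> {..degree p} \<rightarrow> carrier (qweyl q)"
    by (auto simp: \<Theta>_scalar \<Theta>_x)
  then show "qweyl_eval q m p \<in> carrier (qweyl q)" unfolding qweyl_eval_def by (rule T.finsum_closed)
  show "\<Theta> (qweyl_eval q m p) = poly_op m p"
    unfolding qweyl_eval_def T.rep_finsum[OF c]
    by (simp add: T.rep_mult T.rep_pow \<Theta>_scalar \<Theta>_x power_mult poly_op_expand)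
qed

end

section \<open>The invariants as a Galois order\<close>

text \<open>
  The properties of the algebra \<open>I\<close> of invariants from which the Galois order property and freeness follow.
\<close>

locale invariant_ops = qparam +
  fixes m :: nat and I :: "ratfun endo set"
  assumes m_pos: "m > 0" and I_XY: "I = cs.span (monXY ` deg0 m)" and I_YX: "I = cs.span (monYX ` deg0 m)"
    and I_mult: "a \<in> I \<Longrightarrow> b \<in> I \<Longrightarrow> a * b \<in> I"
begin

lemma I_left: "I = ml.span m (range (bL m))" and I_right: "I = mr.span m (range (bR m))"
  using I_XY I_YX cspan_deg0_left cspan_deg0_right by auto

lemma I_monXY: "i mod m = j mod m \<Longrightarrow> opX ^ i * opY ^ j \<in> I"
  unfolding I_XY by (rule cs.span_base) (auto simp: monXY_def deg0_def image_iff)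

lemma I_closed: "0 \<in> I" "1 \<in> I" "a \<in> I \<Longrightarrow> b \<in> I \<Longrightarrow> a + b \<in> I" "a \<in> I \<Longrightarrow> - a \<in> I"
  "a \<in> I \<Longrightarrow> opC c * a \<in> I"
  using I_monXY[of 0 0] unfolding I_XY by (auto intro: cs.span_zero cs.span_add cs.span_neg cs.span_scale)

lemma I_power: "a \<in> I \<Longrightarrow> a ^ k \<in> I"
  by (induction k) (auto intro: I_closed I_mult)

lemma I_opZ: "opZ \<in> I"
  unfolding opZ_eq mult.assoc using I_monXY[of 1 1] by (intro I_closed) simp

lemma I_poly_op: "poly_op m p \<in> I"
  using ml.span_scale[of 1 m "range (bL m)" p] I_closed(2) unfolding I_left by simp

text \<open>
  The field \<open>\<complex>(x\<^sup>m)\<close> is modelled as \<open>\<complex>(t)\<close>; \<open>iota\<close> is its inclusion \<open>t \<mapsto> t\<^sup>m\<close> in the field on which the operators act,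
  and \<open>gact\<close> is the action of \<open>\<nat>\<close> that corresponds to the powers of \<open>Z\<close> (\<open>iota_gact\<close>).
\<close>

definition iota :: "ratfun \<Rightarrow> ratfun" where "iota = ratfun_subst (Polynomial.monom 1 m)"
definition gact :: "nat \<Rightarrow> ratfun \<Rightarrow> ratfun" where "gact k = sh (m * k)"

lemma iota_degree: "degree (Polynomial.monom (1::complex) m) > 0"
  using m_pos by (simp add: degree_monom_eq)

lemmas iota_hom = ratfun_subst_hom[OF iota_degree, folded iota_def]
lemmas iota_inverse = ratfun_subst_inverse[OF iota_degree, folded iota_def]
lemmas iota_inj = inj_ratfun_subst[OF iota_degree, folded iota_def]

lemma iota_Kc: "iota (Kc c) = Kc c"
  unfolding iota_def by (rule ratfun_subst_const[OF iota_degree])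

lemma iota_poly: "lmult (iota (poly_to_ratfun p)) = poly_op m p"
  unfolding iota_def poly_op_def by (subst ratfun_subst_poly[OF iota_degree]) simp

lemma iota_Kt_power: "iota (Kt ^ k) = Kt ^ (m * k)"
proof -
  have "iota Kt = poly_to_ratfun ([:0, 1:] \<circ>\<^sub>p Polynomial.monom 1 m)"
    unfolding iota_def by (rule ratfun_subst_poly[OF iota_degree])
  also have "\<dots> = Kt ^ m"
    by (simp add: pcompose_pCons monom_altdef poly_to_ratfun_power)
  finally show ?thesis
    unfolding iota_def by (subst ratfun_subst_power[OF iota_degree]) (simp add: power_mult)
qed

lemma iota_gact: "iota (gact k a) = sh k (iota a)"
proof -
  have "[:0, q ^ (m * k):] \<circ>\<^sub>p Polynomial.monom 1 m = Polynomial.monom 1 m \<circ>\<^sub>p [:0, q ^ k:]"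
    by (rule poly_eqI) (simp add: coeff_pcompose_linear pcompose_pCons coeff_monom power_mult mult.commute flip: power_mult)
  then show ?thesis
    unfolding iota_def gact_def sh_def
    by (simp only: ratfun_subst_subst[OF iota_degree sh_degree] ratfun_subst_subst[OF sh_degree iota_degree])
qed

sublocale N: skew_action nat_add_monoid gact
  by standard (auto simp: nat_add_monoid_def gact_def sh_hom sh_sh algebra_simps)

text \<open>
  The embedding of the skew monoid ring \<open>\<complex>(x\<^sup>m) * \<nat>\<close> in the operators; it is injective by \<open>dedekind\<close>.
\<close>

definition E :: "(nat \<Rightarrow> ratfun) \<Rightarrow> ratfun endo" where
  "E = N.eval (\<lambda>a. lmult (iota a)) (\<lambda>k. opZ ^ k)"

lemma E_eq:
  assumes "N.supp f \<subseteq> {..<n}" shows "E f = (\<Sum>k<n. lmult (iota (f k)) * opZ ^ k)"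
  unfolding E_def by (rule N.eval_eq) (use assms in \<open>auto simp: iota_hom lmult_hom\<close>)

lemma supp_bounded: assumes "f \<in> carrier N.S" shows "\<exists>n. N.supp f \<subseteq> {..<n}"
  using assms finite_nat_iff_bounded unfolding N.in_carrier_iff by blast

lemma E_L: "N.supp f \<subseteq> {..<n} \<Longrightarrow> E f \<in> L n"
  by (subst E_eq) (auto intro: L_I)

lemma E_monom: "E (monom_elem ratfun_field a k) = lmult (iota a) * opZ ^ k"
  unfolding E_def by (rule N.eval_monom_elem) (simp add: iota_hom lmult_hom)

lemma E_coeff_embed: "E (coeff_embed ratfun_field nat_add_monoid a) = lmult (iota a)"
  by (simp add: coeff_embed_def E_monom nat_add_monoid_def)

lemma coeff_embed_closed: "coeff_embed ratfun_field nat_add_monoid a \<in> carrier N.S"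
  by (simp add: coeff_embed_def)

sublocale E: ring_rep N.S E
proof (intro ring_rep.intro ring_rep_axioms.intro N.ring_S)
  show "E (x \<oplus>\<^bsub>N.S\<^esub> y) = E x + E y" if "x \<in> carrier N.S" "y \<in> carrier N.S" for x y
    using that unfolding E_def by (rule N.eval_add) (simp add: iota_hom lmult_hom)
  show "E (x \<otimes>\<^bsub>N.S\<^esub> y) = E x * E y" if "x \<in> carrier N.S" "y \<in> carrier N.S" for x y
    using that unfolding E_def
  proof (rule N.eval_mult)
    show "opZ ^ k * lmult (iota a) = lmult (iota (gact k a)) * opZ ^ k" for k a
      by (simp add: opZ_lmult iota_gact)
  qed (auto simp: iota_hom lmult_hom nat_add_monoid_def power_add)
  have "\<one>\<^bsub>N.S\<^esub> = coeff_embed ratfun_field nat_add_monoid 1"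
    by (rule ext) (simp add: coeff_embed_def monom_elem_def)
  then show "E \<one>\<^bsub>N.S\<^esub> = 1" by (simp only: E_coeff_embed iota_hom lmult_hom)
  show "inj_on E (carrier N.S)"
  proof (rule inj_onI)
    fix f g assume fg: "f \<in> carrier N.S" "g \<in> carrier N.S" "E f = E g"
    obtain n n' where "N.supp f \<subseteq> {..<n}" "N.supp g \<subseteq> {..<n'}" using supp_bounded fg by meson
    then have sub: "N.supp f \<subseteq> {..<max n n'}" "N.supp g \<subseteq> {..<max n n'}" by auto
    have "(\<Sum>k<max n n'. lmult (iota (f k) - iota (g k)) * opZ ^ k) = 0"
      using fg(3) unfolding E_eq[OF sub(1)] E_eq[OF sub(2)]
      by (simp add: lmult_hom left_diff_distrib sum_subtractf)
    from dedekind[OF this] have "f k = g k" if "k < max n n'" for k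
      using injD[OF iota_inj, of "f k" "g k"] that by simp
    moreover have "f k = g k" if k: "\<not> k < max n n'" for k
    proof -
      have "k \<notin> N.supp f" "k \<notin> N.supp g" using sub k by blast+
      then show ?thesis by (simp add: N.supp_def)
    qed
    ultimately show "f = g" by blast
  qed
qed

abbreviation imE where "imE \<equiv> E ` carrier N.S"

lemma imE_closed:
  "a \<in> imE \<Longrightarrow> b \<in> imE \<Longrightarrow> a + b \<in> imE" "a \<in> imE \<Longrightarrow> b \<in> imE \<Longrightarrow> a * b \<in> imE" "lmult (iota r) \<in> imE" "opZ \<in> imE"
proof -
  show "a + b \<in> imE" if ab: "a \<in> imE" "b \<in> imE"
  proof -
    obtain f g where "f \<in> carrier N.S" "g \<in> carrier N.S" "a = E f" "b = E g" using ab by blast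
    then show ?thesis by (intro image_eqI[of _ _ "f \<oplus>\<^bsub>N.S\<^esub> g"]) (simp_all only: E.rep_add E.a_closed)
  qed
  show "a * b \<in> imE" if ab: "a \<in> imE" "b \<in> imE"
  proof -
    obtain f g where "f \<in> carrier N.S" "g \<in> carrier N.S" "a = E f" "b = E g" using ab by blast
    then show ?thesis by (intro image_eqI[of _ _ "f \<otimes>\<^bsub>N.S\<^esub> g"]) (simp_all only: E.rep_mult E.m_closed)
  qed
  show "lmult (iota r) \<in> imE" using E_coeff_embed[of r] coeff_embed_closed[of r] by (metis imageI)
  have "E (monom_elem ratfun_field 1 1) = opZ" by (simp add: E_monom iota_hom lmult_hom)
  then show "opZ \<in> imE" using N.monom_elem_closed[of 1 1] by (metis imageI)
qed

lemma imE_opC: "opC c \<in> imE"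
  using imE_closed(3)[of "Kc c"] by (simp add: iota_Kc opC_def)

lemma opX_power_opZ: "opX ^ r * opZ = opC (inverse q ^ r) * opZ * opX ^ r"
proof (induction r)
  case (Suc r)
  have "opX ^ Suc r * opZ = opX * (opX ^ r * opZ)" by (simp add: mult.assoc)
  also have "\<dots> = (opX * opC (inverse q ^ r)) * opZ * opX ^ r" unfolding Suc by (simp only: mult.assoc)
  also have "\<dots> = opC (inverse q ^ r) * (opX * opZ) * opX ^ r" by (simp only: opC_commute(1) mult.assoc)
  also have "\<dots> = (opC (inverse q ^ r) * opC (inverse q)) * opZ * (opX * opX ^ r)"
    by (simp only: opX_opZ mult.assoc)
  also have "\<dots> = opC (inverse q ^ Suc r) * opZ * opX ^ Suc r"
    by (simp only: opC_hom(5)[symmetric] power_Suc2[symmetric] power_Suc[symmetric])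
  finally show ?case .
qed (simp add: opC_hom)

lemma opX_opY_diag: "opX * opY = opC (inverse (q - 1)) * (opZ - 1)"
proof -
  have "opC (inverse (q - 1)) * (opZ - 1) = (opC (inverse (q - 1)) * opC (q - 1)) * opX * opY"
    unfolding opZ_eq by (simp add: mult.assoc)
  then show ?thesis using opC_inverse(2)[of "q - 1"] q_neq_1 by simp
qed

text \<open>
  \<open>x y\<close> is a linear polynomial in \<open>Z\<close>, and \<open>x\<^sup>r\<close> commutes with \<open>Z\<close> up to a scalar, so
  \<open>x\<^sup>r\<^sup>+\<^sup>1 y\<^sup>r\<^sup>+\<^sup>1 = x\<^sup>r (x y) y\<^sup>r\<close> is a linear polynomial in \<open>Z\<close> times \<open>x\<^sup>r y\<^sup>r\<close>.
\<close>

lemma imE_diag: "opX ^ r * opY ^ r \<in> imE"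
proof (induction r)
  case 0
  show ?case using imE_opC[of 1] by (simp add: opC_hom)
next
  case (Suc r)
  have c: "opX ^ r * opC d = opC d * opX ^ r" for d
    by (rule opC_central) (intro B_power B_X)
  have "opX ^ Suc r * opY ^ Suc r = opX ^ r * (opX * opY) * opY ^ r"
    by (simp only: power_Suc2[of opX r] power_Suc[of opY r] mult.assoc)
  also have "\<dots> = (opX ^ r * opC (inverse (q - 1))) * (opZ - 1) * opY ^ r"
    unfolding opX_opY_diag by (simp only: mult.assoc)
  also have "\<dots> = opC (inverse (q - 1)) * (opX ^ r * opZ - opX ^ r) * opY ^ r"
    unfolding c by (simp add: right_diff_distrib mult.assoc)
  also have "\<dots> = opC (inverse (q - 1)) * (opC (inverse q ^ r) * opZ + opC (- 1)) * (opX ^ r * opY ^ r)"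
    unfolding opX_power_opZ by (simp add: opC_hom(2,6) algebra_simps)
  also have "\<dots> \<in> imE"
    by (rule imE_closed(2)[OF imE_closed(2)[OF imE_opC imE_closed(1)[OF imE_closed(2)[OF imE_opC imE_closed(4)] imE_opC]] Suc])
  finally show ?case .
qed

text \<open>
  \<open>x\<^sup>i y\<^sup>j\<close> is \<open>x\<^sup>j y\<^sup>j\<close> multiplied by a possibly negative power of \<open>t\<^sup>m\<close>.
\<close>

lemma imE_monXY: assumes "i mod m = j mod m" shows "opX ^ i * opY ^ j \<in> imE"
proof -
  have "\<exists>r. Kt ^ i = iota r * Kt ^ j"
  proof (cases "i \<ge> j")
    case True
    then obtain a where "i - j = m * a" using mod_eq_dvd_iff_nat[OF True] assms by (metis dvdE)
    then have "i = m * a + j" using True by simp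
    then show ?thesis by (intro exI[of _ "Kt ^ a"]) (simp add: iota_Kt_power power_add)
  next
    case False
    then obtain a where "j - i = m * a" using mod_eq_dvd_iff_nat[of i j] assms by (metis dvdE linear)
    then have "j = m * a + i" using False by simp
    then show ?thesis
      by (intro exI[of _ "inverse (Kt ^ a)"]) (simp only: iota_inverse iota_Kt_power, simp add: power_add)
  qed
  then obtain r where "Kt ^ i = iota r * Kt ^ j" by blast
  then have "opX ^ i * opY ^ j = lmult (iota r) * (opX ^ j * opY ^ j)"
    unfolding opX_def lmult_power[symmetric] by (simp add: lmult_hom mult.assoc)
  then show ?thesis using imE_closed(2)[OF imE_closed(3) imE_diag] by simp
qed

lemma I_subset_imE: "I \<subseteq> imE"
  unfolding I_XY
proof (rule cs.span_minimal)
  show "monXY ` deg0 m \<subseteq> imE" using imE_monXY by (auto simp: monXY_def deg0_def)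
  show "cs.subspace imE"
    unfolding cs.subspace_def using imE_closed(1) imE_closed(2)[OF imE_opC] imE_opC[of 0] by (auto simp: opC_hom)
qed

text \<open>
  The copy of the invariants inside the skew monoid ring.
\<close>

definition U :: "(nat \<Rightarrow> ratfun) set" where "U = {f \<in> carrier N.S. E f \<in> I}"

lemma U_image: "E ` U = I"
  using I_subset_imE unfolding U_def by blast

abbreviation Kemb where "Kemb \<equiv> coeff_embed ratfun_field nat_add_monoid ` carrier ratfun_field"
abbreviation \<Gamma>emb where "\<Gamma>emb \<equiv> coeff_embed ratfun_field nat_add_monoid ` range poly_to_ratfun"

lemma Kemb: "Kemb \<subseteq> carrier N.S" "E ` Kemb = range (\<lambda>a. lmult (iota a))"
  by (auto simp: coeff_embed_closed image_image E_coeff_embed)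

lemma \<Gamma>emb: "\<Gamma>emb \<subseteq> carrier N.S" "E ` \<Gamma>emb = range (poly_op m)"
  by (auto simp: coeff_embed_closed image_image E_coeff_embed iota_poly)

sublocale kl: Modules.module "\<lambda>a b. lmult (iota a) * b"
  by standard (auto simp: iota_hom lmult_hom algebra_simps)

sublocale kr: Modules.module "\<lambda>a b. b * lmult (iota a)"
proof
  fix a b x
  show "x * lmult (iota b) * lmult (iota a) = x * lmult (iota (a * b))"
    by (simp add: iota_hom lmult_hom mult.assoc lmult_commute[of "iota b"])
qed (auto simp: iota_hom lmult_hom algebra_simps)

lemma subset_eq_of_E_image:
  assumes "V \<subseteq> carrier N.S" "W \<subseteq> carrier N.S" "E ` V = E ` W" shows "V = W"
  using inj_on_image_eq_iff[OF E.rep_inj assms(1,2)] assms(3) by simp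

lemma galois_datum: "galois_datum ratfun_consts (range poly_to_ratfun) ratfun_field nat_add_monoid gact"
proof (rule galois_datum.intro)
  interpret K: field ratfun_field by (rule field_from_type_algebra)
  have ainv: "\<ominus>\<^bsub>ratfun_field\<^esub> x = - x" for x :: ratfun
    by (rule K.minus_equality) auto
  show sr: "subring (range poly_to_ratfun) ratfun_field"
    by (rule K.subringI) (auto simp: ainv simp flip: poly_to_ratfun_hom)
  have inv: "inv\<^bsub>ratfun_field\<^esub> x = inverse x" if "x \<noteq> 0" for x :: ratfun
    using that by (intro K.comm_inv_char) auto
  show "subfield ratfun_consts ratfun_field"
  proof (rule K.subfieldI')
    show "subring ratfun_consts ratfun_field"
      by (rule K.subringI) (auto simp: ratfun_consts_def ainv Kc_hom(2)[symmetric] simp flip: Kc_hom(3,5,6))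
    show "inv\<^bsub>ratfun_field\<^esub> k \<in> ratfun_consts" if k: "k \<in> ratfun_consts - {\<zero>\<^bsub>ratfun_field\<^esub>}" for k
      using k inv[of k] by (auto simp: ratfun_consts_def simp flip: Kc_inverse)
  qed
  show "\<exists>g\<in>range poly_to_ratfun. \<exists>h\<in>range poly_to_ratfun. h \<noteq> \<zero>\<^bsub>ratfun_field\<^esub> \<and> a \<otimes>\<^bsub>ratfun_field\<^esub> h = g" for a
  proof -
    obtain c d where "d \<noteq> 0" "a = poly_to_ratfun c / poly_to_ratfun d" by (rule ratfun_cases)
    then show ?thesis
      by (intro bexI[of _ "poly_to_ratfun c"] bexI[of _ "poly_to_ratfun d"]) auto
  qed
  show "gact k \<in> ring_iso ratfun_field ratfun_field" for k
  proof (rule ring_iso_memI)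
    show "bij_betw (gact k) (carrier ratfun_field) (carrier ratfun_field)"
      unfolding gact_def by (rule bij_betw_byWitness[of _ "sh_inv (m * k)"]) auto
  qed (auto simp: gact_def sh_hom)
  show "gact k c = c" if "c \<in> ratfun_consts" for k c
    using that by (auto simp: ratfun_consts_def gact_def)
  show "k = l" if "\<forall>a\<in>carrier ratfun_field. gact k a = gact l a" for k l
  proof -
    have "sh (m * k) Kt = sh (m * l) Kt" using that by (simp add: gact_def)
    then have "q ^ (m * k) = q ^ (m * l)" by (simp add: sh_Kt)
    then show ?thesis using m_pos by (simp add: q_power_eq)
  qed
qed (auto simp: N.monoid N.act_id N.act_comp)

text \<open>
  Over \<open>\<Gamma>\<close>, the invariants are generated by \<open>y\<^sup>m\<close> and the \<open>x\<^sup>r y\<^sup>r\<close> with \<open>r < m\<close>, because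
  \<open>x\<^sup>r y\<^sup>j = x\<^sup>r y\<^sup>r (y\<^sup>m)\<^sup>k\<close> for \<open>j = m k + r\<close>.  The \<open>K\<close>-spans are everything because \<open>Z\<close> is invariant; on the right one
  uses that \<open>\<nat>\<close> acts by automorphisms, so that \<open>K Z\<^sup>k = Z\<^sup>k K\<close>.
\<close>

lemma galois_ring: "galois_ring ratfun_consts (range poly_to_ratfun) ratfun_field nat_add_monoid gact U"
proof -
  have Uc: "U \<subseteq> carrier N.S" by (auto simp: U_def)
  have sub: "subring U N.S"
  proof (rule E.subringI)
    show "U \<subseteq> carrier N.S" by (rule Uc)
    show "\<one>\<^bsub>N.S\<^esub> \<in> U" unfolding U_def mem_Collect_eq E.rep_one using I_closed(2) E.one_closed by blast
    show "\<ominus>\<^bsub>N.S\<^esub> h \<in> U" if "h \<in> U" for h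
      using that I_closed(4) unfolding U_def mem_Collect_eq by (auto simp only: E.rep_a_inv E.a_inv_closed)
    show "h \<otimes>\<^bsub>N.S\<^esub> g \<in> U" if "h \<in> U" "g \<in> U" for h g
      using that I_mult unfolding U_def mem_Collect_eq by (auto simp only: E.rep_mult E.m_closed)
    show "h \<oplus>\<^bsub>N.S\<^esub> g \<in> U" if "h \<in> U" "g \<in> U" for h g
      using that I_closed(3) unfolding U_def mem_Collect_eq by (auto simp only: E.rep_add E.a_closed)
  qed
  have \<Gamma>U: "\<Gamma>emb \<subseteq> U"
    using \<Gamma>emb I_poly_op by (auto simp: U_def E_coeff_embed iota_poly)
  define T where "T = {f \<in> carrier N.S. E f \<in> insert (opY ^ m) ((\<lambda>r. opX ^ r * opY ^ r) ` {..<m})}"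
  have finT: "finite T"
  proof -
    have "T = E -` insert (opY ^ m) ((\<lambda>r. opX ^ r * opY ^ r) ` {..<m}) \<inter> carrier N.S"
      by (auto simp: T_def)
    also have "finite \<dots>" by (intro finite_vimage_IntI E.rep_inj) simp
    finally show ?thesis .
  qed
  have TU: "T \<subseteq> U"
    using I_monXY[of 0 m] I_monXY by (auto simp: T_def U_def)
  have gen: "U = generate_ring N.S (\<Gamma>emb \<union> T)"
  proof
    show "generate_ring N.S (\<Gamma>emb \<union> T) \<subseteq> U"
      using \<Gamma>U TU Uc by (intro E.generate_ring_min_subring1 sub) auto
    let ?D = "E ` generate_ring N.S (\<Gamma>emb \<union> T)"
    have gc: "generate_ring N.S (\<Gamma>emb \<union> T) \<subseteq> carrier N.S"
      using \<Gamma>U TU Uc by (intro E.generate_ring_incl) auto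
    have add: "a + b \<in> ?D" if ab: "a \<in> ?D" "b \<in> ?D" for a b
    proof -
      obtain f g where fg: "f \<in> generate_ring N.S (\<Gamma>emb \<union> T)" "g \<in> generate_ring N.S (\<Gamma>emb \<union> T)"
        "a = E f" "b = E g" using ab by blast
      then show ?thesis using gc
        by (intro image_eqI[OF _ generate_ring.eng_add[OF fg(1,2)]]) (simp only: E.rep_add subset_iff)
    qed
    have mult: "a * b \<in> ?D" if ab: "a \<in> ?D" "b \<in> ?D" for a b
    proof -
      obtain f g where fg: "f \<in> generate_ring N.S (\<Gamma>emb \<union> T)" "g \<in> generate_ring N.S (\<Gamma>emb \<union> T)"
        "a = E f" "b = E g" using ab by blast
      then show ?thesis using gc
        by (intro image_eqI[OF _ generate_ring.eng_mult[OF fg(1,2)]]) (simp only: E.rep_mult subset_iff)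
    qed
    have DG: "poly_op m p \<in> ?D" for p
    proof -
      have "poly_op m p \<in> E ` \<Gamma>emb" unfolding \<Gamma>emb(2) by blast
      then show ?thesis using generate_ring.incl[of _ "\<Gamma>emb \<union> T" N.S] by blast
    qed
    have DT: "x \<in> ?D" if x: "x \<in> insert (opY ^ m) ((\<lambda>r. opX ^ r * opY ^ r) ` {..<m})" for x
    proof -
      have "x \<in> I" using x I_monXY[of 0 m] I_monXY by auto
      then obtain f where "f \<in> carrier N.S" "E f = x" using I_subset_imE by blast
      then have "f \<in> T" using x by (simp add: T_def)
      then show ?thesis using generate_ring.incl[of f "\<Gamma>emb \<union> T" N.S] \<open>E f = x\<close> by blast
    qed
    have pw: "(opY ^ m) ^ k \<in> ?D" for k
    proof (induction k)
      case 0
      show ?case using DG[of 1] by (simp add: poly_op_hom)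
    next
      case (Suc k)
      then show ?case using mult[OF DT[of "opY ^ m"] Suc] by simp
    qed
    have "bL m j \<in> ?D" for j
    proof -
      have "opY ^ j = opY ^ (j mod m + m * (j div m))" by simp
      then have "bL m j = (opX ^ (j mod m) * opY ^ (j mod m)) * (opY ^ m) ^ (j div m)"
        unfolding bL_def by (simp only: power_add power_mult mult.assoc)
      then show ?thesis using mult[OF DT pw] m_pos by simp
    qed
    moreover have "ml.subspace m ?D"
      unfolding ml.subspace_def using add mult[OF DG] DG[of 0] by (auto simp: poly_op_hom)
    ultimately have "I \<subseteq> ?D" unfolding I_left by (intro ml.span_minimal) auto
    show "U \<subseteq> generate_ring N.S (\<Gamma>emb \<union> T)"
    proof
      fix f assume f: "f \<in> U"
      then have "E f \<in> ?D" using \<open>I \<subseteq> ?D\<close> by (auto simp: U_def)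
      then obtain g where g: "g \<in> generate_ring N.S (\<Gamma>emb \<union> T)" "E f = E g" by blast
      then have "f = g" using E.rep_eq_iff[of f g] gc f Uc by blast
      then show "f \<in> generate_ring N.S (\<Gamma>emb \<union> T)" using g by simp
    qed
  qed
  have "left_span N.S Kemb U = carrier N.S"
  proof (rule subset_eq_of_E_image[OF E.left_span_carrier[OF Kemb(1) Uc] order_refl])
    have "imE \<subseteq> kl.span I"
    proof safe
      fix f assume "f \<in> carrier N.S"
      then obtain n where "N.supp f \<subseteq> {..<n}" using supp_bounded by blast
      then have "E f = (\<Sum>k<n. lmult (iota (f k)) * opZ ^ k)" by (rule E_eq)
      also have "\<dots> \<in> kl.span I" by (intro kl.span_sum kl.span_scale kl.span_base I_power I_opZ)
      finally show "E f \<in> kl.span I" .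
    qed
    moreover have "E ` left_span N.S Kemb U = kl.span I"
      unfolding E.rep_left_span[OF kl.module_axioms Kemb Uc] U_image ..
    moreover have "E ` left_span N.S Kemb U \<subseteq> imE"
      using E.left_span_carrier[OF Kemb(1) Uc] by blast
    ultimately show "E ` left_span N.S Kemb U = imE" by blast
  qed
  moreover have "right_span N.S Kemb U = carrier N.S"
  proof (rule subset_eq_of_E_image[OF E.right_span_carrier[OF Kemb(1) Uc] order_refl])
    have "imE \<subseteq> kr.span I"
    proof safe
      fix f assume "f \<in> carrier N.S"
      then obtain n where "N.supp f \<subseteq> {..<n}" using supp_bounded by blast
      then have "E f = (\<Sum>k<n. lmult (iota (f k)) * opZ ^ k)" by (rule E_eq)
      also have "\<dots> = (\<Sum>k<n. opZ ^ k * lmult (iota (sh_inv (m * k) (f k))))"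
        by (simp add: opZ_lmult gact_def flip: iota_gact)
      also have "\<dots> \<in> kr.span I" by (intro kr.span_sum kr.span_scale kr.span_base I_power I_opZ)
      finally show "E f \<in> kr.span I" .
    qed
    moreover have "E ` right_span N.S Kemb U = kr.span I"
      unfolding E.rep_right_span[OF kr.module_axioms Kemb Uc] U_image ..
    moreover have "E ` right_span N.S Kemb U \<subseteq> imE"
      using E.right_span_carrier[OF Kemb(1) Uc] by blast
    ultimately show "E ` right_span N.S Kemb U = imE" by blast
  qed
  ultimately show ?thesis
    unfolding galois_ring_def Let_def using galois_datum sub \<Gamma>U finT TU gen by blast
qed

lemma fin_gen_L:
  assumes "finite V" "V \<subseteq> carrier N.S" shows "\<exists>n. E ` V \<subseteq> L n"
  using assms
proof (induction V rule: finite_induct)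
  case (insert f V)
  then obtain n where n: "E ` V \<subseteq> L n" by blast
  obtain k where "N.supp f \<subseteq> {..<k}" using supp_bounded insert.prems by blast
  then have "E f \<in> L k" by (rule E_L)
  then show ?case using n L_mono[of n "max n k"] L_mono[of k "max n k"]
    by (intro exI[of _ "max n k"]) auto
qed simp

lemma pull_back_finite:
  assumes "finite F" "F \<subseteq> imE" shows "\<exists>V. finite V \<and> V \<subseteq> carrier N.S \<and> E ` V = F"
  using finite_subset_image[OF assms] by metis

text \<open>
  The core of the Galois order condition, for left and right modules at once: \<open>sK\<close> is the \<open>K\<close>-action on one side, \<open>sG\<close>
  its restriction to \<open>\<Gamma>\<close>, and \<open>b\<close> the \<open>\<Gamma>\<close>-basis of the invariants on that side.
\<close>

lemma span_meet_I_fin_gen: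
  fixes b :: "nat \<Rightarrow> ratfun endo"
  assumes K: "Modules.module sK" and G: "Modules.module sG"
    and sG: "\<And>p x. sG p x = sK (poly_to_ratfun p) x"
    and L: "\<And>n. Modules.module.subspace sK (L n)" and I: "Modules.module.subspace sG I"
    and I_L: "\<And>x n. x \<in> I \<Longrightarrow> x \<in> L n \<Longrightarrow> x \<in> Modules.module.span sG (b ` {..<n})"
    and V: "finite V" "V \<subseteq> carrier N.S"
  shows "\<exists>V'. finite V' \<and> V' \<subseteq> carrier N.S \<and>
    Modules.module.span sK (E ` V) \<inter> I = Modules.module.span sG (E ` V')"
proof -
  interpret K: Modules.module sK by (rule K)
  interpret G: Modules.module sG by (rule G)
  obtain n where n: "E ` V \<subseteq> L n" using fin_gen_L[OF V] by blast
  have KL: "K.span (E ` V) \<subseteq> L n" by (rule K.span_minimal[OF n L])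
  have "G.subspace (K.span (E ` V))"
    unfolding G.subspace_def by (auto simp: sG intro: K.span_zero K.span_add K.span_scale)
  then have "G.subspace (K.span (E ` V) \<inter> I)" using I by (rule G.subspace_inter)
  moreover have "K.span (E ` V) \<inter> I \<subseteq> G.span (b ` {..<n})" using KL I_L by blast
  ultimately obtain F where F: "finite F" "K.span (E ` V) \<inter> I = G.span F"
    using submodule_fin_gen[OF G, of "b ` {..<n}" "K.span (E ` V) \<inter> I"] by blast
  have "F \<subseteq> imE" using F(2) G.span_superset[of F] I_subset_imE by blast
  from pull_back_finite[OF F(1) this] show ?thesis using F(2) by blast
qed

lemma left_galois_order: "left_galois_order ratfun_consts (range poly_to_ratfun) ratfun_field nat_add_monoid gact U"
  unfolding left_galois_order_def Let_def
proof (intro conjI galois_ring allI impI)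
  fix W assume "fin_gen_left N.S Kemb W"
  then obtain V where V: "finite V" "V \<subseteq> carrier N.S" "W = left_span N.S Kemb V"
    unfolding fin_gen_left_def by blast
  have Wc: "W \<subseteq> carrier N.S" unfolding V(3) by (rule E.left_span_carrier[OF Kemb(1) V(2)])
  have EW: "E ` W = kl.span (E ` V)" unfolding V(3) by (rule E.rep_left_span[OF kl.module_axioms Kemb V(2)])
  have "\<exists>V'. finite V' \<and> V' \<subseteq> carrier N.S \<and> kl.span (E ` V) \<inter> I = ml.span m (E ` V')"
  proof (rule span_meet_I_fin_gen[OF kl.module_axioms ml.module_axioms _ _ _ _ V(1,2), where b = "bL m"])
    show "ml.subspace m I" unfolding I_left by (rule ml.subspace_span)
    show "x \<in> ml.span m (bL m ` {..<n})" if x: "x \<in> I" "x \<in> L n" for x n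
    proof -
      obtain c where "x = (\<Sum>j<n. poly_op m (c j) * bL m j)"
        using span_bL_L[OF m_pos x[unfolded I_left]] by blast
      then show ?thesis by (simp only:) (intro ml.span_sum ml.span_scale ml.span_base; simp)
    qed
  qed (auto simp: iota_poly kl.subspace_def intro: L_add L_lmult)
  then obtain V' where V': "finite V'" "V' \<subseteq> carrier N.S" "kl.span (E ` V) \<inter> I = ml.span m (E ` V')"
    by blast
  have "W \<inter> U = left_span N.S \<Gamma>emb V'"
  proof (rule subset_eq_of_E_image)
    have "E ` (W \<inter> U) = E ` W \<inter> E ` U"
      by (rule inj_on_image_Int[OF E.rep_inj Wc]) (auto simp: U_def)
    then show "E ` (W \<inter> U) = E ` left_span N.S \<Gamma>emb V'"
      unfolding E.rep_left_span[OF ml.module_axioms \<Gamma>emb V'(2)] by (simp only: EW U_image V'(3))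
  qed (use Wc E.left_span_carrier[OF \<Gamma>emb(1) V'(2)] in auto)
  then show "fin_gen_left N.S \<Gamma>emb (W \<inter> U)" unfolding fin_gen_left_def using V' by blast
qed

lemma right_galois_order: "right_galois_order ratfun_consts (range poly_to_ratfun) ratfun_field nat_add_monoid gact U"
  unfolding right_galois_order_def Let_def
proof (intro conjI galois_ring allI impI)
  fix W assume "fin_gen_right N.S Kemb W"
  then obtain V where V: "finite V" "V \<subseteq> carrier N.S" "W = right_span N.S Kemb V"
    unfolding fin_gen_right_def by blast
  have Wc: "W \<subseteq> carrier N.S" unfolding V(3) by (rule E.right_span_carrier[OF Kemb(1) V(2)])
  have EW: "E ` W = kr.span (E ` V)" unfolding V(3) by (rule E.rep_right_span[OF kr.module_axioms Kemb V(2)])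
  have "\<exists>V'. finite V' \<and> V' \<subseteq> carrier N.S \<and> kr.span (E ` V) \<inter> I = mr.span m (E ` V')"
  proof (rule span_meet_I_fin_gen[OF kr.module_axioms mr.module_axioms _ _ _ _ V(1,2), where b = "bR m"])
    show "mr.subspace m I" unfolding I_right by (rule mr.subspace_span)
    show "x \<in> mr.span m (bR m ` {..<n})" if x: "x \<in> I" "x \<in> L n" for x n
    proof -
      obtain c where "x = (\<Sum>j<n. bR m j * poly_op m (c j))"
        using span_bR_L[OF m_pos x[unfolded I_right]] by blast
      then show ?thesis by (simp only:) (intro mr.span_sum mr.span_scale mr.span_base; simp)
    qed
  qed (auto simp: iota_poly kr.subspace_def intro: L_add L_lmult_right)
  then obtain V' where V': "finite V'" "V' \<subseteq> carrier N.S" "kr.span (E ` V) \<inter> I = mr.span m (E ` V')"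
    by blast
  have "W \<inter> U = right_span N.S \<Gamma>emb V'"
  proof (rule subset_eq_of_E_image)
    have "E ` (W \<inter> U) = E ` W \<inter> E ` U"
      by (rule inj_on_image_Int[OF E.rep_inj Wc]) (auto simp: U_def)
    then show "E ` (W \<inter> U) = E ` right_span N.S \<Gamma>emb V'"
      unfolding E.rep_right_span[OF mr.module_axioms \<Gamma>emb V'(2)] by (simp only: EW U_image V'(3))
  qed (use Wc E.right_span_carrier[OF \<Gamma>emb(1) V'(2)] in auto)
  then show "fin_gen_right N.S \<Gamma>emb (W \<inter> U)" unfolding fin_gen_right_def using V' by blast
qed

lemma gact_1_Kt: "gact 1 Kt = poly_to_ratfun [:0, q ^ m:]"
  by (simp add: gact_def sh_Kt flip: poly_to_ratfun_hom)

end

section \<open>Finite groups of automorphisms\<close>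

context qparam
begin

definition transport :: "((weyl_gen list \<Rightarrow> complex) set \<Rightarrow> (weyl_gen list \<Rightarrow> complex) set) \<Rightarrow> ratfun endo \<Rightarrow> ratfun endo" where
  "transport g b = \<Theta> (g (inv_into (carrier (qweyl q)) \<Theta> b))"

lemma transport_\<Theta>: "a \<in> carrier (qweyl q) \<Longrightarrow> transport g (\<Theta> a) = \<Theta> (g a)"
  unfolding transport_def by (simp add: inv_into_f_f[OF T.rep_inj])

lemma aut_group_carrier:
  "g \<in> carrier (qweyl_aut_group q) \<longleftrightarrow> g \<in> Bij (carrier (qweyl q)) \<and> g \<in> ring_hom (qweyl q) (qweyl q) \<and>
    (\<forall>c. g (qweyl_scalar q c) = qweyl_scalar q c)"
  by (simp add: qweyl_aut_group_def)

lemma aut_group_closed: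
  assumes "g \<in> carrier (qweyl_aut_group q)" "a \<in> carrier (qweyl q)"
  shows "g a \<in> carrier (qweyl q)"
  using assms ring_hom_closed[of g "qweyl q" "qweyl q" a] by (simp add: aut_group_carrier)

lemma transport_is_aut: assumes g: "g \<in> carrier (qweyl_aut_group q)" shows "is_aut (transport g)"
proof -
  note g' = g[unfolded aut_group_carrier]
  have bij: "bij_betw g (carrier (qweyl q)) (carrier (qweyl q))" using g' by (simp add: Bij_def)
  have gc: "g a \<in> carrier (qweyl q)" if "a \<in> carrier (qweyl q)" for a using bij_betwE[OF bij] that by blast
  have \<Theta>: "bij_betw \<Theta> (carrier (qweyl q)) B" using T.rep_inj \<Theta>_image by (simp add: bij_betw_def)
  have "bij_betw (\<Theta> \<circ> (g \<circ> inv_into (carrier (qweyl q)) \<Theta>)) B B"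
    by (intro bij_betw_trans[OF bij_betw_trans[OF bij_betw_inv_into[OF \<Theta>] bij] \<Theta>])
  moreover have "\<Theta> \<circ> (g \<circ> inv_into (carrier (qweyl q)) \<Theta>) = transport g" by (auto simp: transport_def)
  ultimately have "bij_betw (transport g) B B" by simp
  moreover have "transport g (a + b) = transport g a + transport g b"
    "transport g (a * b) = transport g a * transport g b" if ab: "a \<in> B" "b \<in> B" for a b
  proof -
    obtain x y where xy: "x \<in> carrier (qweyl q)" "y \<in> carrier (qweyl q)" "a = \<Theta> x" "b = \<Theta> y"
      using ab unfolding \<Theta>_image[symmetric] by blast
    have h: "g (x \<oplus>\<^bsub>qweyl q\<^esub> y) = g x \<oplus>\<^bsub>qweyl q\<^esub> g y" "g (x \<otimes>\<^bsub>qweyl q\<^esub> y) = g x \<otimes>\<^bsub>qweyl q\<^esub> g y"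
      by (simp_all add: ring_hom_add[of g] ring_hom_mult[of g] g' xy)
    have "transport g (a + b) = transport g (\<Theta> (x \<oplus>\<^bsub>qweyl q\<^esub> y))"
      by (simp add: xy T.rep_add)
    also have "\<dots> = \<Theta> (g x \<oplus>\<^bsub>qweyl q\<^esub> g y)"
      using xy by (simp add: transport_\<Theta> h)
    also have "\<dots> = transport g a + transport g b"
      using xy gc by (simp add: T.rep_add transport_\<Theta>)
    finally show "transport g (a + b) = transport g a + transport g b" .
    have "transport g (a * b) = transport g (\<Theta> (x \<otimes>\<^bsub>qweyl q\<^esub> y))"
      by (simp add: xy T.rep_mult)
    also have "\<dots> = \<Theta> (g x \<otimes>\<^bsub>qweyl q\<^esub> g y)"
      using xy by (simp add: transport_\<Theta> h)
    also have "\<dots> = transport g a * transport g b"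
      using xy gc by (simp add: T.rep_mult transport_\<Theta>)
    finally show "transport g (a * b) = transport g a * transport g b" .
  qed
  moreover have "transport g (opC c) = opC c" for c
    using transport_\<Theta>[OF \<Theta>_scalar(2), of g c] g' by (simp add: \<Theta>_scalar)
  ultimately show ?thesis unfolding is_aut_def by blast
qed

lemma aut_eqI:
  assumes "is_aut g" "is_aut h" "g opX = h opX" "g opY = h opY" "b \<in> B" shows "g b = h b"
  using assms(5) by (induction rule: B.induct) (auto simp: is_autD[OF assms(1)] is_autD[OF assms(2)] assms(3,4))

lemma transport_invariants:
  assumes G: "G \<subseteq> carrier (qweyl_aut_group q)"
  shows "\<Theta> ` {a \<in> carrier (qweyl q). \<forall>g\<in>G. g a = a} = {b \<in> B. \<forall>g\<in>transport ` G. g b = b}"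
proof -
  have gc: "g a \<in> carrier (qweyl q)" if "g \<in> G" "a \<in> carrier (qweyl q)" for g a
    by (rule aut_group_closed[OF subsetD[OF G that(1)] that(2)])
  have "(\<forall>g\<in>transport ` G. g (\<Theta> a) = \<Theta> a) \<longleftrightarrow> (\<forall>g\<in>G. g a = a)" if a: "a \<in> carrier (qweyl q)" for a
    using T.rep_eq_iff[OF gc[OF _ a] a] by (auto simp: transport_\<Theta>[OF a])
  then show ?thesis unfolding \<Theta>_image[symmetric] by auto
qed

lemma character_exists:
  assumes "g \<in> carrier (qweyl_aut_group q)"
  shows "\<exists>c. c \<noteq> 0 \<and> transport g opX = opC c * opX \<and> transport g opY = opC (inverse c) * opY"
  using aut_form[OF transport_is_aut[OF assms]] .

lemma opC_opX_inj: "opC c * opX = opC d * opX \<Longrightarrow> c = d"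
proof -
  assume "opC c * opX = opC d * opX"
  then have "lmult (Kc c * Kt) = lmult (Kc d * Kt)" unfolding opC_def opX_def by (simp add: lmult_hom)
  then show "c = d" by simp
qed

text \<open>
  The scalar \<open>\<chi>(g)\<close> in \<open>g(x) = \<chi>(g) x\<close> determines \<open>g\<close>, and \<open>\<chi>\<close> is multiplicative.  So \<open>\<chi>\<close> maps \<open>G\<close> bijectively to a finite
  subgroup of order \<open>m\<close> of \<open>\<complex>\<^sup>\<times>\<close>, which consists of all \<open>m\<close>-th roots of unity.
\<close>

lemma finite_group_invariants:
  assumes G: "subgroup G (qweyl_aut_group q)" "finite G"
  defines "m \<equiv> card G"
  shows "invariant_ops q m (\<Theta> ` {a \<in> carrier (qweyl q). \<forall>g\<in>G. g a = a})"
proof -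
  have GA: "G \<subseteq> carrier (qweyl_aut_group q)" using G(1) by (rule subgroup.subset)
  have "\<forall>g\<in>G. \<exists>c. c \<noteq> 0 \<and> transport g opX = opC c * opX \<and> transport g opY = opC (inverse c) * opY"
    using character_exists GA by blast
  from bchoice[OF this] obtain \<chi> where "\<forall>g\<in>G. \<chi> g \<noteq> 0 \<and>
      transport g opX = opC (\<chi> g) * opX \<and> transport g opY = opC (inverse (\<chi> g)) * opY"
    by blast
  then have \<chi>: "\<chi> g \<noteq> 0" "transport g opX = opC (\<chi> g) * opX" "transport g opY = opC (inverse (\<chi> g)) * opY"
    if "g \<in> G" for g using that by blast+
  have inj: "inj_on \<chi> G"
  proof (rule inj_onI)
    fix g h assume gh: "g \<in> G" "h \<in> G" "\<chi> g = \<chi> h"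
    have gA: "g \<in> carrier (qweyl_aut_group q)" and hA: "h \<in> carrier (qweyl_aut_group q)" using gh GA by auto
    have "g a = h a" if a: "a \<in> carrier (qweyl q)" for a
    proof -
      have "transport g (\<Theta> a) = transport h (\<Theta> a)"
        using \<chi>[OF gh(1)] \<chi>[OF gh(2)] gh(3) a \<Theta>_image
        by (intro aut_eqI[OF transport_is_aut[OF gA] transport_is_aut[OF hA], of "\<Theta> a"]) auto
      moreover have "g a \<in> carrier (qweyl q)" "h a \<in> carrier (qweyl q)"
        by (rule aut_group_closed[OF gA a], rule aut_group_closed[OF hA a])
      ultimately show ?thesis using T.rep_eq_iff by (simp add: transport_\<Theta>[OF a])
    qed
    moreover have "g \<in> extensional (carrier (qweyl q))" "h \<in> extensional (carrier (qweyl q))"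
      using gA hA by (simp_all add: aut_group_carrier Bij_imp_extensional)
    ultimately show "g = h" by (intro extensionalityI)
  qed
  have one: "\<one>\<^bsub>qweyl_aut_group q\<^esub> \<in> G" using G(1) by (rule subgroup.one_closed)
  have mult: "\<chi> g * \<chi> h \<in> \<chi> ` G" if gh: "g \<in> G" "h \<in> G" for g h
  proof -
    let ?k = "g \<otimes>\<^bsub>qweyl_aut_group q\<^esub> h"
    have k: "?k \<in> G" using subgroup.m_closed[OF G(1) gh] .
    have gA: "g \<in> carrier (qweyl_aut_group q)" and hA: "h \<in> carrier (qweyl_aut_group q)" using gh GA by auto
    have gB: "g \<in> Bij (carrier (qweyl q))" "h \<in> Bij (carrier (qweyl q))" using gA hA by (simp_all add: aut_group_carrier)
    have "?k = compose (carrier (qweyl q)) g h"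
      using gB by (simp add: qweyl_aut_group_def BijGroup_def)
    then have "transport ?k opX = \<Theta> (g (h (qweyl_x q)))"
      using transport_\<Theta>[OF \<Theta>_x(2), of ?k] by (simp add: \<Theta>_x compose_eq)
    also have "\<dots> = transport g (\<Theta> (h (qweyl_x q)))"
      by (rule transport_\<Theta>[OF aut_group_closed[OF hA \<Theta>_x(2)], symmetric])
    also have "\<Theta> (h (qweyl_x q)) = opC (\<chi> h) * opX"
      using transport_\<Theta>[OF \<Theta>_x(2), of h] \<chi>(2)[OF gh(2)] by (simp add: \<Theta>_x)
    also have "transport g (opC (\<chi> h) * opX) = opC (\<chi> h) * (opC (\<chi> g) * opX)"
      using is_autD[OF transport_is_aut[OF gA]] \<chi>(2)[OF gh(1)] by (simp add: B_C B_X)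
    also have "\<dots> = opC (\<chi> h * \<chi> g) * opX" by (simp only: opC_hom(5) mult.assoc)
    finally have "opC (\<chi> ?k) * opX = opC (\<chi> h * \<chi> g) * opX" using \<chi>(2)[OF k] by simp
    then have "\<chi> ?k = \<chi> h * \<chi> g" by (rule opC_opX_inj)
    then show ?thesis using k by (metis image_eqI mult.commute)
  qed
  have m: "m > 0" unfolding m_def using G(2) one by (auto simp: card_gt_0_iff)
  have "\<chi> ` G = {z. z ^ card (\<chi> ` G) = 1}"
    using G(2) one \<chi>(1) mult by (intro finite_mult_closed_roots_of_unity) auto
  then have im: "\<chi> ` G = {z. z ^ m = 1}" unfolding m_def card_image[OF inj] .
  define \<chi>' where "\<chi>' h = \<chi> (inv_into G transport h)" for h
  have inv: "inv_into G transport h \<in> G" "transport (inv_into G transport h) = h" if "h \<in> transport ` G" for h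
    by (rule inv_into_into[OF that], rule f_inv_into_f[OF that])
  have \<chi>': "h opX = opC (\<chi>' h) * opX \<and> h opY = opC (inverse (\<chi>' h)) * opY" if "h \<in> transport ` G" for h
    using \<chi>(2,3)[OF inv(1)[OF that]] inv(2)[OF that] by (simp add: \<chi>'_def)
  have "\<chi>' (transport g) = \<chi> g" if "g \<in> G" for g
    using \<chi>'[OF imageI[OF that]] \<chi>(2)[OF that] opC_opX_inj by metis
  then have im': "\<chi>' ` transport ` G = {z. z ^ m = 1}" unfolding im[symmetric] image_image by (rule image_cong[OF refl])
  have auts: "is_aut h" if "h \<in> transport ` G" for h using that transport_is_aut GA by blast
  let ?I = "\<Theta> ` {a \<in> carrier (qweyl q). \<forall>g\<in>G. g a = a}"
  have I: "?I = {b \<in> B. \<forall>h\<in>transport ` G. h b = b}" by (rule transport_invariants[OF GA])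
  show ?thesis
  proof (intro invariant_ops.intro invariant_ops_axioms.intro qparam_axioms m)
    show "?I = cs.span (monXY ` deg0 m)"
      unfolding I by (rule invariants_of_root_group(1)[OF m auts \<chi>' im'])
    show "?I = cs.span (monYX ` deg0 m)"
      unfolding I by (rule invariants_of_root_group(2)[OF m auts \<chi>' im'])
    show "a * b \<in> ?I" if "a \<in> ?I" "b \<in> ?I" for a b
      using that unfolding I by (auto simp: is_autD(3)[OF auts] B_mult)
  qed
qed

end

context invariant_ops
begin

text \<open>
  The isomorphism with \<open>U\<close> is \<open>\<Theta>\<close> followed by the inverse of \<open>E\<close>.
\<close>

lemma invariant_ring_results:
  assumes G: "G \<subseteq> carrier (qweyl_aut_group q)" and I: "I = \<Theta> ` {a \<in> carrier (qweyl q). \<forall>g\<in>G. g a = a}"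
  shows "is_galois_order_over ratfun_consts cpoly_ring poly_to_ratfun ratfun_field
      nat_add_monoid gact (qweyl_eval q m) (invariant_ring (qweyl q) G)"
    and "free_left_module (invariant_ring (qweyl q) G) (range (qweyl_eval q m))"
    and "free_right_module (invariant_ring (qweyl q) G) (range (qweyl_eval q m))"
proof -
  let ?R = "invariant_ring (qweyl q) G"
  let ?C = "{a \<in> carrier (qweyl q). \<forall>g\<in>G. g a = a}"
  have R: "?R = (qweyl q)\<lparr>carrier := ?C\<rparr>" by (simp add: invariant_ring_def)
  have C_I: "a \<in> ?C" if a: "a \<in> carrier (qweyl q)" "\<Theta> a \<in> I" for a
  proof -
    obtain b where "b \<in> ?C" "\<Theta> a = \<Theta> b" using a(2) unfolding I by blast
    then show ?thesis using T.rep_eq_iff[of a b] a(1) by auto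
  qed
  have "subring ?C (qweyl q)"
  proof (rule T.subringI)
    show "\<one>\<^bsub>qweyl q\<^esub> \<in> ?C" by (rule C_I) (simp_all add: T.rep_one I_closed)
    show "\<ominus>\<^bsub>qweyl q\<^esub> h \<in> ?C" if "h \<in> ?C" for h
      using that by (intro C_I) (auto simp: T.rep_a_inv I intro!: I_closed(4)[unfolded I])
    show "h \<otimes>\<^bsub>qweyl q\<^esub> k \<in> ?C" if "h \<in> ?C" "k \<in> ?C" for h k
      using that by (intro C_I) (auto simp: T.rep_mult I intro!: I_mult[unfolded I])
    show "h \<oplus>\<^bsub>qweyl q\<^esub> k \<in> ?C" if "h \<in> ?C" "k \<in> ?C" for h k
      using that by (intro C_I) (auto simp: T.rep_add I intro!: I_closed(3)[unfolded I])
  qed auto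
  then have ringR: "ring ?R" unfolding R by (rule T.subring_is_ring)
  interpret R: ring_rep ?R \<Theta>
  proof (intro ring_rep.intro ring_rep_axioms.intro ringR)
    show "inj_on \<Theta> (carrier ?R)" unfolding R by (rule inj_on_subset[OF T.rep_inj]) auto
  qed (auto simp: R T.rep_add T.rep_mult T.rep_one)
  have carr: "\<Theta> ` carrier ?R = I" by (simp add: R I)
  have evc: "qweyl_eval q m p \<in> carrier ?R" for p
    using C_I[OF \<Theta>_eval(2)] I_poly_op by (simp add: R \<Theta>_eval)
  have S: "range (qweyl_eval q m) \<subseteq> carrier ?R" "\<Theta> ` range (qweyl_eval q m) = range (poly_op m)"
    using evc by (auto simp: image_image \<Theta>_eval)
  have lift: "\<exists>a\<in>carrier ?R. \<Theta> a = x" if "x \<in> I" for x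
    using that unfolding carr[symmetric] by auto
  have "\<forall>j. \<exists>a\<in>carrier ?R. \<Theta> a = bL m j"
    using lift I_left ml.span_base[of _ "range (bL m)" m] by blast
  then obtain l where l: "\<And>j. l j \<in> carrier ?R" "\<And>j. \<Theta> (l j) = bL m j" by metis
  show "free_left_module ?R (range (qweyl_eval q m))"
  proof (rule R.free_leftI[OF ml.module_axioms[of m] S l(1)])
    show "ml.span m (range (\<lambda>j. \<Theta> (l j))) = \<Theta> ` carrier ?R" by (simp only: l(2) carr I_left[symmetric])
    show "c j = 0" if "(\<Sum>j<N. poly_op m (c j) * \<Theta> (l j)) = 0" "j < N" for N c j
      using bL_coefficients_vanish[OF m_pos, of c N 0 j] that by (simp add: l L_0)
  qed
  have "\<forall>j. \<exists>a\<in>carrier ?R. \<Theta> a = bR m j"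
    using lift I_right mr.span_base[of _ "range (bR m)" m] by blast
  then obtain r where r: "\<And>j. r j \<in> carrier ?R" "\<And>j. \<Theta> (r j) = bR m j" by metis
  show "free_right_module ?R (range (qweyl_eval q m))"
  proof (rule R.free_rightI[OF mr.module_axioms[of m] S r(1)])
    show "mr.span m (range (\<lambda>j. \<Theta> (r j))) = \<Theta> ` carrier ?R" by (simp only: r(2) carr I_right[symmetric])
    show "c j = 0" if "(\<Sum>j<N. \<Theta> (r j) * poly_op m (c j)) = 0" "j < N" for N c j
      using bR_coefficients_vanish[OF m_pos, of c N 0 j] that by (simp add: r L_0)
  qed
  show "is_galois_order_over ratfun_consts cpoly_ring poly_to_ratfun ratfun_field
      nat_add_monoid gact (qweyl_eval q m) ?R"
    unfolding is_galois_order_over_def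
  proof (intro conjI exI)
    show "poly_to_ratfun \<in> ring_hom cpoly_ring ratfun_field"
      by (rule ring_hom_memI) (auto simp: poly_to_ratfun_hom)
    show "inj_on poly_to_ratfun (carrier cpoly_ring)" by (auto simp: inj_on_def)
    have eqI: "a = b" if "a \<in> carrier ?R" "b \<in> carrier ?R" "\<Theta> a = \<Theta> b" for a b
      using R.rep_eq_iff that by blast
    show "qweyl_eval q m \<in> ring_hom cpoly_ring ?R"
    proof (rule ring_hom_memI)
      fix x y :: "complex poly"
      show "qweyl_eval q m x \<in> carrier ?R" by (rule evc)
      show "qweyl_eval q m (x \<otimes>\<^bsub>cpoly_ring\<^esub> y) = qweyl_eval q m x \<otimes>\<^bsub>?R\<^esub> qweyl_eval q m y"
        by (rule eqI) (simp_all add: evc R.rep_mult \<Theta>_eval poly_op_hom)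
      show "qweyl_eval q m (x \<oplus>\<^bsub>cpoly_ring\<^esub> y) = qweyl_eval q m x \<oplus>\<^bsub>?R\<^esub> qweyl_eval q m y"
        by (rule eqI) (simp_all add: evc R.rep_add \<Theta>_eval poly_op_hom)
      show "qweyl_eval q m \<one>\<^bsub>cpoly_ring\<^esub> = \<one>\<^bsub>?R\<^esub>"
        by (rule eqI) (simp_all add: evc R.rep_one \<Theta>_eval poly_op_hom)
    qed
    show "inj_on (qweyl_eval q m) (carrier cpoly_ring)"
    proof (rule inj_onI)
      fix x y assume "qweyl_eval q m x = qweyl_eval q m y"
      then have "poly_op m x = poly_op m y" using \<Theta>_eval(1)[of m] by metis
      then have "iota (poly_to_ratfun x) = iota (poly_to_ratfun y)" unfolding iota_poly[symmetric] by simp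
      from injD[OF iota_inj this] show "x = y" by simp
    qed
    show "galois_order ratfun_consts (poly_to_ratfun ` carrier cpoly_ring) ratfun_field nat_add_monoid gact U"
      unfolding galois_order_def using left_galois_order right_galois_order by simp
    define \<phi> where "\<phi> a = inv_into (carrier N.S) E (\<Theta> a)" for a
    have \<phi>: "\<phi> a \<in> U" "E (\<phi> a) = \<Theta> a" if "a \<in> carrier ?R" for a
    proof -
      have aI: "\<Theta> a \<in> I" using that carr by blast
      then have "\<Theta> a \<in> imE" using I_subset_imE by blast
      then have "\<phi> a \<in> carrier N.S" "E (\<phi> a) = \<Theta> a"
        unfolding \<phi>_def by (rule inv_into_into, rule f_inv_into_f)
      then show "\<phi> a \<in> U" "E (\<phi> a) = \<Theta> a" using aI by (auto simp: U_def)
    qed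
    have Uc: "u \<in> carrier N.S" if "u \<in> U" for u using that by (simp add: U_def)
    have EI: "u = v" if "u \<in> carrier N.S" "v \<in> carrier N.S" "E u = E v" for u v
      using E.rep_eq_iff that by blast
    show "\<phi> \<in> ring_iso ?R (N.S\<lparr>carrier := U\<rparr>)"
    proof (rule ring_iso_memI)
      fix x y assume xy: "x \<in> carrier ?R" "y \<in> carrier ?R"
      show "\<phi> x \<in> carrier (N.S\<lparr>carrier := U\<rparr>)" using \<phi>(1)[OF xy(1)] by simp
      have "\<phi> (x \<otimes>\<^bsub>?R\<^esub> y) = \<phi> x \<otimes>\<^bsub>N.S\<^esub> \<phi> y"
        by (rule EI) (simp_all only: Uc \<phi> xy R.m_closed E.m_closed E.rep_mult R.rep_mult)
      then show "\<phi> (x \<otimes>\<^bsub>?R\<^esub> y) = \<phi> x \<otimes>\<^bsub>N.S\<lparr>carrier := U\<rparr>\<^esub> \<phi> y" by simp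
      have "\<phi> (x \<oplus>\<^bsub>?R\<^esub> y) = \<phi> x \<oplus>\<^bsub>N.S\<^esub> \<phi> y"
        by (rule EI) (simp_all only: Uc \<phi> xy R.a_closed E.a_closed E.rep_add R.rep_add)
      then show "\<phi> (x \<oplus>\<^bsub>?R\<^esub> y) = \<phi> x \<oplus>\<^bsub>N.S\<lparr>carrier := U\<rparr>\<^esub> \<phi> y" by simp
    next
      have "\<phi> \<one>\<^bsub>?R\<^esub> = \<one>\<^bsub>N.S\<^esub>"
        by (rule EI) (simp_all only: Uc \<phi> R.one_closed E.one_closed E.rep_one R.rep_one)
      then show "\<phi> \<one>\<^bsub>?R\<^esub> = \<one>\<^bsub>N.S\<lparr>carrier := U\<rparr>\<^esub>" by simp
      have "inj_on \<phi> (carrier ?R)"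
        by (rule inj_onI) (metis \<phi>(2) eqI)
      moreover have "\<phi> ` carrier ?R = U"
      proof
        show "\<phi> ` carrier ?R \<subseteq> U" using \<phi>(1) by blast
        show "U \<subseteq> \<phi> ` carrier ?R"
        proof
          fix u assume u: "u \<in> U"
          then obtain a where a: "a \<in> carrier ?R" "\<Theta> a = E u" using lift[of "E u"] by (auto simp: U_def)
          have "\<phi> a = u" by (rule EI) (simp_all only: Uc \<phi> a u)
          then show "u \<in> \<phi> ` carrier ?R" using a by blast
        qed
      qed
      ultimately show "bij_betw \<phi> (carrier ?R) (carrier (N.S\<lparr>carrier := U\<rparr>))"
        by (simp add: bij_betw_def)
    qed
    show "\<forall>\<gamma>\<in>carrier cpoly_ring. \<phi> (qweyl_eval q m \<gamma>) = coeff_embed ratfun_field nat_add_monoid (poly_to_ratfun \<gamma>)"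
    proof
      fix \<gamma> :: "complex poly"
      show "\<phi> (qweyl_eval q m \<gamma>) = coeff_embed ratfun_field nat_add_monoid (poly_to_ratfun \<gamma>)"
        by (rule EI) (simp_all only: Uc \<phi> evc coeff_embed_closed E_coeff_embed iota_poly \<Theta>_eval(1))
    qed
  qed
qed

end

theorem proposition7:
  fixes q :: complex and m :: nat
    and G :: "((weyl_gen list \<Rightarrow> complex) set \<Rightarrow> (weyl_gen list \<Rightarrow> complex) set) set"
  assumes q_nonzero: "q \<noteq> 0"
    and q_not_root_of_unity: "\<And>k::nat. k > 0 \<Longrightarrow> q ^ k \<noteq> 1"
    and G_subgroup: "subgroup G (qweyl_aut_group q)"
    and G_finite: "finite G"
    and m_def: "m = card G"
  shows "(\<exists>n::nat. n > 0 \<and>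
            (\<exists>act. act 1 (poly_to_ratfun [:0, 1:]) = poly_to_ratfun [:0, q ^ n:] \<and>
               is_galois_order_over ratfun_consts cpoly_ring poly_to_ratfun ratfun_field
                 nat_add_monoid act (qweyl_eval q m) (invariant_ring (qweyl q) G))) \<and>
         free_left_module (invariant_ring (qweyl q) G) (range (qweyl_eval q m)) \<and>
         free_right_module (invariant_ring (qweyl q) G) (range (qweyl_eval q m))"
proof -
  interpret qparam q by (rule qparam.intro[OF q_nonzero q_not_root_of_unity])
  interpret invariant_ops q m "\<Theta> ` {a \<in> carrier (qweyl q). \<forall>g\<in>G. g a = a}"
    unfolding m_def by (rule finite_group_invariants[OF G_subgroup G_finite])
  note results = invariant_ring_results[OF subgroup.subset[OF G_subgroup] refl]
  show ?thesis
    using m_pos gact_1_Kt results by blast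
qed

end
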